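(* Let $\widehat f_r(x)=x^\top\widehat\alpha_r+\widehat g_r(x)$, where $$(\widehat\alpha_r,\widehat g_r)=\operatorname*{arg\,min}_{\alpha\in\mathbb R^d,\ g\in\mathcal H_K}\Big\{\frac1n\sum_{i=1}^n\big(Y_i-X_i^\top\alpha-g(X_i)\big)^2+\mu\|\alpha\|^2+\lambda\|g\|_K^2\Big\}$$ is computed from the random-design data described in the context. Assume that $K$ is symmetric, positive semi-definite and continuous, and that the integral operator $L_K$ admits the eigen-decomposition described in the context. Then for any $\mu,\lambda>0$, $$\mathcal R(\widehat f_r-f^* )\ \le\ \inf_{\alpha\in\mathbb R^d,\ f\in\mathcal H_K}\Big\{\mathcal R(\langle\alpha,\cdot\rangle+f-f^* )+\mu\|\alpha\|^2+\lambda\|f\|_K^2\Big\}+\sigma^2\Big(\frac1n\sum_{i=1}^d\frac{\tau_i}{\tau_i+\mu}+\frac{R(\lambda)^2}{\lambda}\Big).$$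
   Context: Model and random design: $\mathcal X\subseteq\mathbb R^d$; $(X_i,Y_i)$, $i=1,\dots,n$, are independent, $X_1,\dots,X_n$ are i.i.d. copies of a random vector $X\in\mathcal X$ with distribution $\rho$ satisfying $\mathbb E\|X\|^2<\infty$, and $Y_i=f^*(X_i)+\epsilon_i$ with $f^*:\mathcal X\to\mathbb R$, $\mathbb E[\epsilon_i\mid X_i]=0$ and $\mathbb E[\epsilon_i^2\mid X_i]=\sigma^2$. No rank assumption is made on the design. $\Sigma=\mathbb E[XX^\top]\in\mathbb R^{d\times d}$ has eigenvalues $\tau_1\ge\cdots\ge\tau_d\ge0$. Kernel: $K:\mathcal X\times\mathcal X\to\mathbb R$ is a kernel function; positive semi-definite means every matrix $(K(x_i,x_j))_{i,j}$ for finitely many points is positive semi-definite. $\mathcal H_K$ is the reproducing kernel Hilbert space of $K$, with norm $\|\cdot\|_K$. Integral operator: $L_K:\mathcal L_2(\rho)\to\mathcal L_2(\rho)$, $L_Kf=\int_{\mathcal X}K(\cdot,x)f(x)\,d\rho(x)$. Eigen-decomposition assumption: there exist eigenvalues $\{\mu_j\}_{j\ge1}$ in non-increasing order (nonnegative, with $\mu_1>0$) and corresponding eigenfunctions $\{\phi_j\}_{j\ge1}$ forming an orthonormal basis of $\mathcal L_2(\rho)$ such that $L_K=\sum_{j=1}^\infty\mu_j\langle\phi_j,\cdot\rangle_\rho\,\phi_j$, where $\langle\cdot,\cdot\rangle_\rho$ is the inner product of $\mathcal L_2(\rho)$. (The eigenvalues $\mu_j$ are not to be confused with the ridge parameter $\mu$.)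 Kernel complexity function: $R(\lambda)=\big(\frac1n\sum_{j=1}^\infty\min\{\lambda,\mu_j\}\big)^{1/2}$ for $\lambda\ge0$. Risk: for a (possibly data-dependent) measurable function $f:\mathcal X\to\mathbb R$, $\mathcal R(f-f^* )=\frac1n\sum_{i=1}^n\mathbb E[(f(X_i)-f^*(X_i))^2]$; the expectation is over all the data, including the design. $\langle\alpha,\cdot\rangle$ denotes the linear function $x\mapsto x^\top\alpha$. *)

theory Defs
  imports "HOL-Probability.Probability"
begin

section \<open>Kernels and reproducing kernel Hilbert spaces\<close>

definition symmetric_kernel_on :: "'a set \<Rightarrow> ('a \<Rightarrow> 'a \<Rightarrow> real) \<Rightarrow> bool" where
  "symmetric_kernel_on S K \<longleftrightarrow> (\<forall>x\<in>S. \<forall>y\<in>S. K x y = K y x)"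

definition psd_kernel_on :: "'a set \<Rightarrow> ('a \<Rightarrow> 'a \<Rightarrow> real) \<Rightarrow> bool" where
  "psd_kernel_on S K \<longleftrightarrow>
     (\<forall>(m::nat) (x :: nat \<Rightarrow> 'a) (c :: nat \<Rightarrow> real). (\<forall>i<m. x i \<in> S) \<longrightarrow>
        0 \<le> (\<Sum>i<m. \<Sum>j<m. c i * c j * K (x i) (x j)))"

text \<open>
  Functions on \<open>S\<close> are represented by total functions that vanish outside \<open>S\<close>, so that
  equality of elements of the space is equality on \<open>S\<close> and the space is closed under
  pointwise operations.
\<close>

definition kernel_section :: "'a set \<Rightarrow> ('a \<Rightarrow> 'a \<Rightarrow> real) \<Rightarrow> 'a \<Rightarrow> 'a \<Rightarrow> real" where
  "kernel_section S K x = (\<lambda>y. if y \<in> S then K y x else 0)"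

definition rkhs_norm :: "(('a \<Rightarrow> real) \<Rightarrow> ('a \<Rightarrow> real) \<Rightarrow> real) \<Rightarrow> ('a \<Rightarrow> real) \<Rightarrow> real" where
  "rkhs_norm ip f = sqrt (ip f f)"

text \<open>
  \<open>rkhs S K H ip\<close>: the set \<open>H\<close> with inner product \<open>ip\<close> is a Hilbert space of functions on \<open>S\<close>
  with reproducing kernel \<open>K\<close>.  By the Moore--Aronszajn theorem a symmetric positive
  semi-definite kernel determines \<open>H\<close>, and \<open>ip\<close> on \<open>H\<close>, uniquely.
\<close>

locale rkhs =
  fixes S :: "'a set"
    and K :: "'a \<Rightarrow> 'a \<Rightarrow> real"
    and H :: "('a \<Rightarrow> real) set"
    and ip :: "('a \<Rightarrow> real) \<Rightarrow> ('a \<Rightarrow> real) \<Rightarrow> real"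
  assumes vanish_outside: "f \<in> H \<Longrightarrow> x \<notin> S \<Longrightarrow> f x = 0"
    and zero_mem: "(\<lambda>_. 0) \<in> H"
    and add_mem: "f \<in> H \<Longrightarrow> g \<in> H \<Longrightarrow> (\<lambda>x. f x + g x) \<in> H"
    and scale_mem: "f \<in> H \<Longrightarrow> (\<lambda>x. c * f x) \<in> H"
    and ip_commute: "f \<in> H \<Longrightarrow> g \<in> H \<Longrightarrow> ip f g = ip g f"
    and ip_add_left: "f \<in> H \<Longrightarrow> g \<in> H \<Longrightarrow> h \<in> H \<Longrightarrow> ip (\<lambda>x. f x + g x) h = ip f h + ip g h"
    and ip_scale_left: "f \<in> H \<Longrightarrow> g \<in> H \<Longrightarrow> ip (\<lambda>x. c * f x) g = c * ip f g"
    and ip_nonneg: "f \<in> H \<Longrightarrow> 0 \<le> ip f f"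
    and ip_eq_zero: "f \<in> H \<Longrightarrow> ip f f = 0 \<Longrightarrow> f = (\<lambda>_. 0)"
    and complete:
      "(\<And>k. u k \<in> H) \<Longrightarrow>
       (\<And>e. 0 < e \<Longrightarrow> \<exists>N. \<forall>k\<ge>N. \<forall>l\<ge>N. rkhs_norm ip (\<lambda>x. u k x - u l x) < e) \<Longrightarrow>
       \<exists>f\<in>H. (\<lambda>k. rkhs_norm ip (\<lambda>x. u k x - f x)) \<longlonglongrightarrow> 0"
    and section_mem: "x \<in> S \<Longrightarrow> kernel_section S K x \<in> H"
    and reproducing: "f \<in> H \<Longrightarrow> x \<in> S \<Longrightarrow> f x = ip f (kernel_section S K x)"

section \<open>The space of square integrable functions and the integral operator\<close>

text \<open>
  Elements of \<open>L2 \<rho>\<close> are functions rather than equivalence classes; all statements below are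
  invariant under changes on \<open>\<rho>\<close>-null sets.
\<close>

definition L2 :: "'a measure \<Rightarrow> ('a \<Rightarrow> real) set" where
  "L2 \<rho> = {f \<in> borel_measurable \<rho>. integrable \<rho> (\<lambda>x. (f x)\<^sup>2)}"

definition L2_inner :: "'a measure \<Rightarrow> ('a \<Rightarrow> real) \<Rightarrow> ('a \<Rightarrow> real) \<Rightarrow> real" where
  "L2_inner \<rho> f g = (\<integral>x. f x * g x \<partial>\<rho>)"

definition L2_sums :: "'a measure \<Rightarrow> (nat \<Rightarrow> 'a \<Rightarrow> real) \<Rightarrow> ('a \<Rightarrow> real) \<Rightarrow> bool" where
  "L2_sums \<rho> u g \<longleftrightarrow> (\<forall>j. u j \<in> L2 \<rho>) \<and> g \<in> L2 \<rho> \<and>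
     (\<lambda>N. \<integral>x. (g x - (\<Sum>j<N. u j x))\<^sup>2 \<partial>\<rho>) \<longlonglongrightarrow> 0"

definition L2_orthonormal_basis :: "'a measure \<Rightarrow> (nat \<Rightarrow> 'a \<Rightarrow> real) \<Rightarrow> bool" where
  "L2_orthonormal_basis \<rho> \<phi> \<longleftrightarrow>
     (\<forall>j. \<phi> j \<in> L2 \<rho>) \<and>
     (\<forall>i j. L2_inner \<rho> (\<phi> i) (\<phi> j) = (if i = j then 1 else 0)) \<and>
     (\<forall>f\<in>L2 \<rho>. L2_sums \<rho> (\<lambda>j x. L2_inner \<rho> (\<phi> j) f * \<phi> j x) f)"

definition kernel_operator :: "'a measure \<Rightarrow> ('a \<Rightarrow> 'a \<Rightarrow> real) \<Rightarrow> ('a \<Rightarrow> real) \<Rightarrow> 'a \<Rightarrow> real" where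
  "kernel_operator \<rho> K f = (\<lambda>x. \<integral>y. K x y * f y \<partial>\<rho>)"

text \<open>
  The eigenpairs are indexed from 0: \<open>eigval j\<close> and \<open>\<phi> j\<close> are the eigenvalue and the eigenfunction
  number \<open>j + 1\<close>.  The integrability clause says that the kernel operator is defined on all
  of \<open>L2 \<rho>\<close> (otherwise the Bochner integral would silently be 0); that it maps into \<open>L2 \<rho>\<close> is
  part of \<open>L2_sums\<close>.
\<close>

definition kernel_eigen_decomposition ::
  "'a measure \<Rightarrow> ('a \<Rightarrow> 'a \<Rightarrow> real) \<Rightarrow> (nat \<Rightarrow> real) \<Rightarrow> (nat \<Rightarrow> 'a \<Rightarrow> real) \<Rightarrow> bool" where
  "kernel_eigen_decomposition \<rho> K eigval \<phi> \<longleftrightarrow>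
     decseq eigval \<and> (\<forall>j. 0 \<le> eigval j) \<and> 0 < eigval 0 \<and>
     L2_orthonormal_basis \<rho> \<phi> \<and>
     (\<forall>f\<in>L2 \<rho>. (AE x in \<rho>. integrable \<rho> (\<lambda>y. K x y * f y)) \<and>
        L2_sums \<rho> (\<lambda>j x. eigval j * L2_inner \<rho> (\<phi> j) f * \<phi> j x) (kernel_operator \<rho> K f))"

text \<open>
  The series may diverge (no trace class assumption is made), so the kernel complexity takes
  values in \<open>[0, \<infinity>]\<close>.
\<close>

definition ennreal_sqrt :: "ennreal \<Rightarrow> ennreal" where
  "ennreal_sqrt x = (if x = \<infinity> then \<infinity> else ennreal (sqrt (enn2real x)))"

definition kernel_complexity :: "nat \<Rightarrow> (nat \<Rightarrow> real) \<Rightarrow> real \<Rightarrow> ennreal" where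
  "kernel_complexity n eigval lam =
     ennreal_sqrt (ennreal (1 / real n) * (\<Sum>j. ennreal (min lam (eigval j))))"

section \<open>Second moment matrix, risk and estimator\<close>

definition second_moment_matrix :: "(real ^ 'd) measure \<Rightarrow> real ^ 'd ^ 'd" where
  "second_moment_matrix \<rho> = (\<chi> i j. \<integral>x. x $ i * x $ j \<partial>\<rho>)"

text \<open>
  \<open>\<tau> 1, \<dots>, \<tau> d\<close> is the non-increasing list of the (real) eigenvalues of a \<open>d \<times> d\<close> matrix,
  i.e. of the roots of its characteristic polynomial, repeated according to multiplicity.
\<close>

definition ordered_eigenvalues :: "real ^ 'd ^ 'd \<Rightarrow> (nat \<Rightarrow> real) \<Rightarrow> bool" where
  "ordered_eigenvalues A \<tau> \<longleftrightarrow>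
     (\<forall>t. det (mat t - A) = (\<Prod>i = 1..CARD('d). t - \<tau> i)) \<and>
     (\<forall>i j. 1 \<le> i \<longrightarrow> i \<le> j \<longrightarrow> j \<le> CARD('d) \<longrightarrow> \<tau> j \<le> \<tau> i)"

text \<open>
  The in-sample risk \<open>(1/n) \<Sum>\<^sub>i E[h(X\<^sub>i)\<^sup>2]\<close> of a possibly data-dependent function \<open>h\<close>.  The
  dependence on the data is the dependence of \<open>h \<omega>\<close> on the sample point \<open>\<omega>\<close>; the
  expectation is over all the data and may be infinite.
\<close>

definition risk ::
  "'w measure \<Rightarrow> nat \<Rightarrow> (nat \<Rightarrow> 'w \<Rightarrow> 'a) \<Rightarrow> ('w \<Rightarrow> 'a \<Rightarrow> real) \<Rightarrow> ennreal" where
  "risk M n X h = ennreal (1 / real n) * (\<Sum>i = 1..n. \<integral>\<^sup>+\<omega>. ennreal ((h \<omega> (X i \<omega>))\<^sup>2) \<partial>M)"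

definition ridge_objective ::
  "nat \<Rightarrow> (nat \<Rightarrow> real ^ 'd) \<Rightarrow> (nat \<Rightarrow> real) \<Rightarrow> real \<Rightarrow> real \<Rightarrow>
   ((real ^ 'd \<Rightarrow> real) \<Rightarrow> (real ^ 'd \<Rightarrow> real) \<Rightarrow> real) \<Rightarrow>
   (real ^ 'd) \<times> (real ^ 'd \<Rightarrow> real) \<Rightarrow> real" where
  "ridge_objective n x y mu lam ip = (\<lambda>(\<alpha>, g).
     (1 / real n) * (\<Sum>i = 1..n. (y i - x i \<bullet> \<alpha> - g (x i))\<^sup>2)
       + mu * (norm \<alpha>)\<^sup>2 + lam * (rkhs_norm ip g)\<^sup>2)"

end

theory Submission
  imports Defs
begin

text \<open>
  The estimator is a linear smoother. On a fixed design, a pair \<open>(\<alpha>, g)\<close> enters the objective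
  only through its values at the design points and through its penalty, which is the squared norm
  of a Hilbert space with reproducing kernel \<open>x \<bullet> y / mu + K x y / lam\<close>. Let \<open>G\<close> be the matrix of
  this kernel at the design points. Completing the square (\<open>objective_decomposition\<close>,
  \<open>ridge_objective_decomposition\<close>) shows that the fitted values are \<open>S Y\<close> with
  \<open>S = G (G + n I)\<inverse>\<close> (\<open>ridge_minimizer_fit\<close>), and the same identity, applied to the noiseless
  responses, bounds the squared bias of \<open>S\<close> by the penalized approximation error of every
  competitor \<open>(\<alpha>, f)\<close> (\<open>ridge_bias_le\<close>). Given the design, the noise variables are uncorrelated with
  mean \<open>0\<close> and variance \<open>\<sigma>\<^sup>2\<close>, so the noise contributes \<open>\<sigma>\<^sup>2 / n\<close> times the expected sum of the
  squared entries of \<open>S\<close> (\<open>expectation_linear_smoother_square\<close>), which is at most \<open>\<sigma>\<^sup>2 / n\<close> times the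
  expected trace of \<open>S\<close> because \<open>S\<^sup>2 \<le> S\<close>.

  It remains to bound the expected trace. With \<open>R = (G + n I)\<inverse>\<close>, the trace of \<open>S\<close> is the trace of
  \<open>G R\<close>, which is linear in the factor \<open>G\<close>. A rank one part \<open>p p\<^sup>T\<close> of \<open>G\<close> contributes \<open>p\<^sup>T R p\<close>,
  and this is at most \<open>a / (1 + a)\<close> with \<open>a = \<bar>p\<bar>\<^sup>2 / n\<close> because \<open>p p\<^sup>T \<le> G\<close>; in particular it is at
  most the minimum of \<open>1\<close> and \<open>a\<close>. Both bounds are concave in \<open>a\<close>, so by Jensen's inequality
  only the mean of \<open>a\<close> matters. The linear part of \<open>G\<close> is split along an orthonormal eigenbasis \<open>u\<close> of
  the second moment matrix: \<open>p\<^sub>i = (X\<^sub>i \<bullet> u) / sqrt mu\<close> has mean energy \<open>\<tau> / mu\<close>, whence the terms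
  \<open>\<tau> / (\<tau> + mu)\<close>. The kernel part is split along the eigenfunctions: \<open>p\<^sub>i = sqrt (eigval j / lam) * \<phi> j X\<^sub>i\<close>
  has mean energy \<open>eigval j / lam\<close>, and the minima of \<open>1\<close> and \<open>eigval j / lam\<close> add up to
  \<open>n R(lam)\<^sup>2 / lam\<close>.

  The eigenfunction expansion converges in \<open>L2\<close> only and says nothing about the kernel at given
  points. Therefore the kernel is replaced by its averages over pairs of dyadic cells. These have a
  pointwise expansion in the cell averages of the eigenfunctions (\<open>kernel_cell_average_sums\<close>), whose
  \<open>L2\<close> norms are at most \<open>1\<close> (\<open>nn_integral_cell_average_square_le\<close>), and since \<open>K\<close> is continuous they
  tend to the values of \<open>K\<close> when the cells shrink (\<open>kernel_cell_average_tendsto\<close>). Fatou's lemma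
  carries the trace bound to the limit (\<open>expected_smoother_trace_le\<close>).
\<close>

(* Index sets are written {1..n}; this keeps the simplifier from rewriting them to {Suc 0..n}. *)
declare One_nat_def [simp del]

section \<open>Ridge smoothers on a finite index set\<close>

text \<open>
  The equation \<open>\<nu> S = G - G S\<close> states \<open>S = G (G + \<nu> I)\<inverse>\<close> without mentioning an inverse.
\<close>

locale ridge_smoother =
  fixes I :: "'i set" and G S :: "'i \<Rightarrow> 'i \<Rightarrow> real" and \<nu> :: real
  assumes finite_index: "finite I"
    and nu_pos: "0 < \<nu>"
    and gram_psd: "\<And>c. 0 \<le> (\<Sum>i\<in>I. \<Sum>j\<in>I. c i * c j * G i j)"
    and smoother_sym: "\<And>i j. i \<in> I \<Longrightarrow> j \<in> I \<Longrightarrow> S i j = S j i"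
    and smoother_eq: "\<And>i j. i \<in> I \<Longrightarrow> j \<in> I \<Longrightarrow> \<nu> * S i j = G i j - (\<Sum>k\<in>I. G i k * S k j)"
begin

definition fit :: "('i \<Rightarrow> real) \<Rightarrow> 'i \<Rightarrow> real" where
  "fit f i = (\<Sum>j\<in>I. S i j * f j)"

text \<open>
  The vector \<open>(G + \<nu> I)\<inverse> f\<close>.
\<close>

definition dual_coeff :: "('i \<Rightarrow> real) \<Rightarrow> 'i \<Rightarrow> real" where
  "dual_coeff f i = (f i - fit f i) / \<nu>"

lemma gram_dual_coeff:
  assumes "i \<in> I"
  shows "(\<Sum>j\<in>I. G i j * dual_coeff f j) = fit f i"
proof -
  have "\<nu> * fit f i = (\<Sum>j\<in>I. (G i j - (\<Sum>k\<in>I. G i k * S k j)) * f j)"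
    unfolding fit_def sum_distrib_left
    by (rule sum.cong[OF refl]) (simp add: smoother_eq[OF assms, symmetric])
  also have "\<dots> = (\<Sum>j\<in>I. G i j * f j) - (\<Sum>j\<in>I. \<Sum>k\<in>I. G i k * S k j * f j)"
    by (simp add: left_diff_distrib sum_subtractf sum_distrib_right)
  also have "(\<Sum>j\<in>I. \<Sum>k\<in>I. G i k * S k j * f j) = (\<Sum>k\<in>I. G i k * fit f k)"
    unfolding fit_def sum_distrib_left
    by (subst sum.swap) (simp add: mult.assoc)
  finally have *: "\<nu> * fit f i = (\<Sum>j\<in>I. G i j * (f j - fit f j))"
    by (simp add: right_diff_distrib sum_subtractf)
  have "(\<Sum>j\<in>I. G i j * dual_coeff f j) = (\<Sum>j\<in>I. G i j * (f j - fit f j)) / \<nu>"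
    by (simp add: dual_coeff_def sum_divide_distrib)
  then show ?thesis
    using * nu_pos by (metis nonzero_mult_div_cancel_left less_irrefl)
qed

lemma gram_form_dual_coeff:
  "(\<Sum>i\<in>I. \<Sum>j\<in>I. dual_coeff f i * dual_coeff f j * G i j) = (\<Sum>i\<in>I. dual_coeff f i * fit f i)"
proof -
  have "(\<Sum>j\<in>I. dual_coeff f i * dual_coeff f j * G i j) = dual_coeff f i * fit f i" if "i \<in> I" for i
    unfolding gram_dual_coeff[OF that, symmetric] sum_distrib_left
    by (intro sum.cong) auto
  then show ?thesis by (simp cong: sum.cong)
qed

lemma dual_coeff_fit_nonneg: "0 \<le> (\<Sum>i\<in>I. dual_coeff f i * fit f i)"
  using gram_psd[of "dual_coeff f"] by (simp add: gram_form_dual_coeff)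

text \<open>
  In matrix terms \<open>S\<^sup>2 \<le> S\<close>: since \<open>f - S f = \<nu> c\<close> and \<open>S f = G c\<close> for the dual coefficients
  \<open>c\<close>, the difference of the two sides is \<open>\<nu> c\<^sup>T G c\<close>.
\<close>

lemma fit_square_le: "(\<Sum>i\<in>I. (fit f i)\<^sup>2) \<le> (\<Sum>i\<in>I. f i * fit f i)"
proof -
  have "0 \<le> \<nu> * (\<Sum>i\<in>I. dual_coeff f i * fit f i)"
    using dual_coeff_fit_nonneg nu_pos by simp
  also have "\<dots> = (\<Sum>i\<in>I. f i * fit f i - (fit f i)\<^sup>2)"
    unfolding sum_distrib_left using nu_pos
    by (intro sum.cong) (auto simp: dual_coeff_def field_simps power2_eq_square)
  finally show ?thesis by (simp add: sum_subtractf)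
qed

lemma fit_unit: "j \<in> I \<Longrightarrow> fit (\<lambda>k. if k = j then 1 else 0) i = S i j"
  by (simp add: fit_def finite_index if_distrib[of "\<lambda>x. _ * x"] cong: if_cong)

lemma column_square_le:
  assumes "j \<in> I"
  shows "(\<Sum>i\<in>I. (S i j)\<^sup>2) \<le> S j j"
  using fit_square_le[of "\<lambda>k. if k = j then 1 else 0"] assms
  by (simp add: fit_unit if_distrib[of "\<lambda>x. x * _"] finite_index cong: if_cong)

lemma square_entries_le_trace: "(\<Sum>i\<in>I. \<Sum>j\<in>I. (S i j)\<^sup>2) \<le> (\<Sum>j\<in>I. S j j)"
  by (subst sum.swap) (intro sum_mono column_square_le)

lemma entry_square_le_diag: "i \<in> I \<Longrightarrow> j \<in> I \<Longrightarrow> (S i j)\<^sup>2 \<le> S j j"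
  using column_square_le[of j] member_le_sum[of i I "\<lambda>i. (S i j)\<^sup>2"] finite_index
  by fastforce

lemma diag_nonneg: "i \<in> I \<Longrightarrow> 0 \<le> S i i"
  using entry_square_le_diag[of i i] zero_le_power2[of "S i i"] by linarith

text \<open>
  Bounded entries make the products of entries of \<open>S\<close> with square integrable variables integrable.
\<close>

lemma abs_entry_le_1:
  assumes "i \<in> I" "j \<in> I"
  shows "\<bar>S i j\<bar> \<le> 1"
proof -
  have "S j j \<le> 1"
    using entry_square_le_diag[OF assms(2) assms(2)] diag_nonneg[OF assms(2)]
    by (cases "S j j = 0") (auto simp: power2_eq_square mult_le_cancel_right)
  then have "(S i j)\<^sup>2 \<le> 1"
    using entry_square_le_diag[OF assms] by linarith
  then show ?thesis by (simp add: abs_square_le_1)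
qed

text \<open>
  Completing the square in the vector of values \<open>w\<close>. When \<open>N\<close> is the squared norm of a function with
  the values \<open>w\<close>, the last bracket is the squared distance from this function to the kernel
  expansion with the dual coefficients of \<open>f\<close>.
\<close>

lemma objective_decomposition:
  "(\<Sum>i\<in>I. (f i - w i)\<^sup>2) / \<nu> + N =
     (\<Sum>i\<in>I. (w i - fit f i)\<^sup>2) / \<nu> + (\<Sum>i\<in>I. (f i - fit f i)\<^sup>2) / \<nu>
     + (\<Sum>i\<in>I. dual_coeff f i * fit f i)
     + (N - 2 * (\<Sum>i\<in>I. dual_coeff f i * w i) + (\<Sum>i\<in>I. dual_coeff f i * fit f i))"
proof -
  have "(f i - w i)\<^sup>2 / \<nu> = (w i - fit f i)\<^sup>2 / \<nu> + (f i - fit f i)\<^sup>2 / \<nu>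
     + 2 * (dual_coeff f i * fit f i) - 2 * (dual_coeff f i * w i)" for i
    using nu_pos by (simp add: dual_coeff_def field_simps power2_eq_square)
  then have "(\<Sum>i\<in>I. (f i - w i)\<^sup>2 / \<nu>) = (\<Sum>i\<in>I. (w i - fit f i)\<^sup>2 / \<nu> + (f i - fit f i)\<^sup>2 / \<nu>
     + 2 * (dual_coeff f i * fit f i) - 2 * (dual_coeff f i * w i))"
    by simp
  then show ?thesis
    by (simp add: sum.distrib sum_subtractf sum_divide_distrib sum_distrib_left)
qed

text \<open>
  The quadratic form \<open>p\<^sup>T (G + \<nu> I)\<inverse> p\<close>.
\<close>

definition resolvent_form :: "('i \<Rightarrow> real) \<Rightarrow> real" where
  "resolvent_form p = (\<Sum>i\<in>I. p i * dual_coeff p i)"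

lemma resolvent_form_eq:
  "resolvent_form p = (\<Sum>i\<in>I. \<Sum>j\<in>I. dual_coeff p i * dual_coeff p j * G i j)
     + \<nu> * (\<Sum>i\<in>I. (dual_coeff p i)\<^sup>2)"
proof -
  have "p i * dual_coeff p i = dual_coeff p i * fit p i + \<nu> * (dual_coeff p i)\<^sup>2" for i
    using nu_pos by (simp add: dual_coeff_def field_simps power2_eq_square)
  then show ?thesis
    by (simp add: resolvent_form_def gram_form_dual_coeff sum.distrib sum_distrib_left)
qed

lemma resolvent_form_nonneg: "0 \<le> resolvent_form p"
  unfolding resolvent_form_eq using nu_pos gram_psd by (simp add: sum_nonneg)

lemma resolvent_form_le_energy: "resolvent_form p \<le> (\<Sum>i\<in>I. (p i)\<^sup>2) / \<nu>"
proof -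
  have "resolvent_form p = (\<Sum>i\<in>I. (p i)\<^sup>2) / \<nu> - (\<Sum>i\<in>I. p i * fit p i) / \<nu>"
    by (simp add: resolvent_form_def dual_coeff_def power2_eq_square right_diff_distrib
        diff_divide_distrib sum_subtractf sum_divide_distrib)
  moreover have "0 \<le> (\<Sum>i\<in>I. p i * fit p i)"
    using fit_square_le[of p] sum_nonneg[of I "\<lambda>i. (fit p i)\<^sup>2"] by force
  ultimately show ?thesis using nu_pos by simp
qed

text \<open>
  For \<open>u = (G + \<nu> I)\<inverse> p\<close> both \<open>p \<bullet> u\<close> and \<open>u\<^sup>T (G + \<nu> I) u\<close> equal the resolvent form \<open>r\<close>,
  so the hypothesis at \<open>u\<close> reads \<open>r\<^sup>2 \<le> r\<close>.
\<close>

lemma resolvent_form_le_1: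
  assumes "\<And>u. (\<Sum>i\<in>I. p i * u i)\<^sup>2 \<le> (\<Sum>i\<in>I. \<Sum>j\<in>I. u i * u j * G i j) + \<nu> * (\<Sum>i\<in>I. (u i)\<^sup>2)"
  shows "resolvent_form p \<le> 1"
proof -
  have "(resolvent_form p)\<^sup>2 \<le> resolvent_form p"
    using assms[of "dual_coeff p"] unfolding resolvent_form_def[symmetric] resolvent_form_eq[symmetric] .
  then show ?thesis
    using resolvent_form_nonneg[of p]
    by (cases "resolvent_form p = 0") (auto simp: power2_eq_square mult_le_cancel_right)
qed

text \<open>
  With \<open>u\<close> and \<open>r\<close> as before, the stronger hypothesis gives \<open>r\<^sup>2 + \<nu> \<bar>u\<bar>\<^sup>2 \<le> r\<close>, and \<open>\<bar>u\<bar>\<close> is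
  bounded below by Cauchy-Schwarz, \<open>r\<^sup>2 \<le> \<bar>p\<bar>\<^sup>2 \<bar>u\<bar>\<^sup>2\<close>.
\<close>

lemma resolvent_form_le_ratio:
  assumes dom: "\<And>u. (\<Sum>i\<in>I. p i * u i)\<^sup>2 \<le> (\<Sum>i\<in>I. \<Sum>j\<in>I. u i * u j * G i j)"
  defines "a \<equiv> (\<Sum>i\<in>I. (p i)\<^sup>2) / \<nu>"
  shows "resolvent_form p \<le> a / (1 + a)"
proof -
  let ?r = "resolvent_form p" and ?U = "\<Sum>i\<in>I. (dual_coeff p i)\<^sup>2"
  have a0: "0 \<le> a" using nu_pos by (simp add: a_def sum_nonneg)
  have U: "0 \<le> ?U" by (simp add: sum_nonneg)
  have 1: "?r\<^sup>2 + \<nu> * ?U \<le> ?r"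
    using dom[of "dual_coeff p"] unfolding resolvent_form_def[symmetric]
    by (subst (2) resolvent_form_eq) linarith
  have "?r\<^sup>2 \<le> (\<Sum>i\<in>I. (p i)\<^sup>2) * ?U"
    unfolding resolvent_form_def by (rule Cauchy_Schwarz_ineq_sum)
  also have "\<dots> = a * (\<nu> * ?U)" using nu_pos by (simp add: a_def)
  also have "\<dots> \<le> a * (?r - ?r\<^sup>2)"
    using 1 a0 by (intro mult_left_mono) auto
  finally have "?r * (?r * (1 + a)) \<le> ?r * a"
    by (simp add: power2_eq_square algebra_simps)
  then have "?r * (1 + a) \<le> a"
    using resolvent_form_nonneg[of p] a0
    by (cases "?r = 0") (auto simp: mult_le_cancel_left)
  then show ?thesis using a0 by (simp add: field_simps)
qed

text \<open>
  The trace of \<open>A (G + \<nu> I)\<inverse>\<close>, written with \<open>\<nu> (G + \<nu> I)\<inverse> = I - S\<close>. It is linear in \<open>A\<close> and gives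
  the trace of \<open>S\<close> at \<open>A = G\<close>, so a decomposition of \<open>G\<close> splits the trace of \<open>S\<close>.
\<close>

definition resolvent_trace :: "('i \<Rightarrow> 'i \<Rightarrow> real) \<Rightarrow> real" where
  "resolvent_trace A = (\<Sum>i\<in>I. A i i - (\<Sum>k\<in>I. A i k * S k i)) / \<nu>"

lemma resolvent_trace_gram: "resolvent_trace G = (\<Sum>i\<in>I. S i i)"
proof -
  have "(\<Sum>i\<in>I. G i i - (\<Sum>k\<in>I. G i k * S k i)) = (\<Sum>i\<in>I. \<nu> * S i i)"
    by (intro sum.cong) (auto simp: smoother_eq)
  then show ?thesis using nu_pos by (simp add: resolvent_trace_def sum_distrib_left[symmetric])
qed

lemma resolvent_trace_rank_one: "resolvent_trace (\<lambda>i j. p i * p j) = resolvent_form p"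
proof -
  have "p i * p i - (\<Sum>k\<in>I. p i * p k * S k i) = \<nu> * (p i * dual_coeff p i)" if "i \<in> I" for i
  proof -
    have "(\<Sum>k\<in>I. p i * p k * S k i) = p i * fit p i"
      unfolding fit_def sum_distrib_left
      by (intro sum.cong) (auto simp: smoother_sym that)
    then show ?thesis using nu_pos by (simp add: dual_coeff_def) (simp add: right_diff_distrib)
  qed
  then have "(\<Sum>i\<in>I. p i * p i - (\<Sum>k\<in>I. p i * p k * S k i)) = \<nu> * resolvent_form p"
    unfolding resolvent_form_def sum_distrib_left by (intro sum.cong) auto
  then show ?thesis using nu_pos by (simp add: resolvent_trace_def)
qed

lemma resolvent_trace_add:
  "resolvent_trace (\<lambda>i j. A i j + B i j) = resolvent_trace A + resolvent_trace B"
  by (simp add: resolvent_trace_def distrib_right sum.distrib sum_subtractf add_divide_distrib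
      diff_divide_distrib)

lemma resolvent_trace_sum:
  "finite J \<Longrightarrow> resolvent_trace (\<lambda>i j. \<Sum>b\<in>J. A b i j) = (\<Sum>b\<in>J. resolvent_trace (A b))"
  by (induction J rule: finite_induct) (auto simp: resolvent_trace_add, simp add: resolvent_trace_def)

lemma resolvent_trace_cong:
  "(\<And>i j. i \<in> I \<Longrightarrow> j \<in> I \<Longrightarrow> A i j = B i j) \<Longrightarrow> resolvent_trace A = resolvent_trace B"
  by (simp add: resolvent_trace_def cong: sum.cong)

lemma resolvent_trace_sums:
  assumes "\<And>i j. i \<in> I \<Longrightarrow> j \<in> I \<Longrightarrow> (\<lambda>b. A b i j) sums B i j"
  shows "(\<lambda>b. resolvent_trace (A b)) sums resolvent_trace B"
  unfolding resolvent_trace_def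
  by (intro sums_divide sums_sum sums_diff sums_mult2 assms)

lemma resolvent_trace_tendsto:
  assumes "\<And>i j. i \<in> I \<Longrightarrow> j \<in> I \<Longrightarrow> ((\<lambda>m. A m i j) \<longlongrightarrow> B i j) F"
  shows "((\<lambda>m. resolvent_trace (A m)) \<longlongrightarrow> resolvent_trace B) F"
  unfolding resolvent_trace_def
  by (intro tendsto_intros assms) (use nu_pos in auto)

end

text \<open>
  A smoother is constructed by sequential conditioning: when a Gaussian process with covariance \<open>G\<close> is
  observed at the points \<open>1, \<dots>, t\<close> with noise of variance \<open>\<nu>\<close>, its conditional covariance is
  \<open>updated_kernel \<nu> G t\<close>. After all \<open>n\<close> points this is \<open>\<nu> S\<close>. The recursion is explicit, so the
  entries of \<open>S\<close> are visibly measurable functions of the entries of \<open>G\<close>.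
\<close>

primrec updated_kernel :: "real \<Rightarrow> (nat \<Rightarrow> nat \<Rightarrow> real) \<Rightarrow> nat \<Rightarrow> nat \<Rightarrow> nat \<Rightarrow> real" where
  "updated_kernel \<nu> G 0 i j = G i j"
| "updated_kernel \<nu> G (Suc t) i j = updated_kernel \<nu> G t i j
     - updated_kernel \<nu> G t i (Suc t) * updated_kernel \<nu> G t (Suc t) j
       / (\<nu> + updated_kernel \<nu> G t (Suc t) (Suc t))"

definition smoother_matrix :: "real \<Rightarrow> (nat \<Rightarrow> nat \<Rightarrow> real) \<Rightarrow> nat \<Rightarrow> nat \<Rightarrow> nat \<Rightarrow> real" where
  "smoother_matrix \<nu> G n i j = updated_kernel \<nu> G n i j / \<nu>"

lemma updated_kernel_sym:
  assumes "\<And>i j. i \<in> {1..n} \<Longrightarrow> j \<in> {1..n} \<Longrightarrow> G i j = G j i"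
  shows "t \<le> n \<Longrightarrow> i \<in> {1..n} \<Longrightarrow> j \<in> {1..n} \<Longrightarrow> updated_kernel \<nu> G t i j = updated_kernel \<nu> G t j i"
proof (induction t arbitrary: i j)
  case 0
  then show ?case using assms by simp
next
  case (Suc t)
  then have "updated_kernel \<nu> G t i j = updated_kernel \<nu> G t j i"
    "updated_kernel \<nu> G t i (Suc t) = updated_kernel \<nu> G t (Suc t) i"
    "updated_kernel \<nu> G t (Suc t) j = updated_kernel \<nu> G t j (Suc t)"
    by auto
  then show ?case by simp
qed

text \<open>
  The conditional variance at \<open>y\<close> is the mean squared error of the best linear predictor of the
  value at \<open>y\<close> from the noisy observations: a value of the quadratic form of \<open>G\<close> plus a noise part.
  Hence the denominators of the recursion are positive.
\<close>

lemma updated_kernel_diag_nonneg: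
  assumes nu: "0 < \<nu>"
    and psd: "\<And>c. 0 \<le> (\<Sum>i\<in>{1..n}. \<Sum>j\<in>{1..n}. c i * c j * G i j)"
    and t: "t \<le> n" and y: "y \<in> {1..n}"
    and eq: "\<And>i. i \<in> {1..n} \<Longrightarrow>
      updated_kernel \<nu> G t i y = G i y - (\<Sum>s\<in>{1..t}. G i s * updated_kernel \<nu> G t s y) / \<nu>"
  shows "0 \<le> updated_kernel \<nu> G t y y"
proof -
  \<comment> \<open>the weights of the predictor, and the prediction error as a combination of the points\<close>
  define u where "u s = updated_kernel \<nu> G t s y / \<nu>" for s
  define c where "c i = (if i = y then 1 else 0) - (if i \<in> {1..t} then u i else 0)" for i
  have sum_c: "(\<Sum>i\<in>{1..n}. c i * h i) = h y - (\<Sum>s\<in>{1..t}. u s * h s)" for h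
  proof -
    have "(\<Sum>i\<in>{1..n}. (if i \<in> {1..t} then u i * h i else 0)) = (\<Sum>s\<in>{1..t}. u s * h s)"
      using t by (intro sum.mono_neutral_cong_right) auto
    moreover have "(\<Sum>i\<in>{1..n}. (if i = y then h i else 0)) = h y"
      using y by simp
    moreover have "c i * h i = (if i = y then h i else 0) - (if i \<in> {1..t} then u i * h i else 0)" for i
      by (simp add: c_def left_diff_distrib)
    ultimately show ?thesis by (simp add: sum_subtractf)
  qed
  have row: "(\<Sum>j\<in>{1..n}. c j * G i j) = updated_kernel \<nu> G t i y" if "i \<in> {1..n}" for i
    using eq[OF that] unfolding sum_c by (simp add: u_def sum_divide_distrib mult.commute)
  have "(\<Sum>i\<in>{1..n}. \<Sum>j\<in>{1..n}. c i * c j * G i j) = (\<Sum>i\<in>{1..n}. c i * updated_kernel \<nu> G t i y)"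
    using row by (simp add: mult.assoc flip: sum_distrib_left)
  also have "\<dots> = updated_kernel \<nu> G t y y - (\<Sum>s\<in>{1..t}. u s * (\<nu> * u s))"
    unfolding sum_c using nu by (simp add: u_def)
  finally have "updated_kernel \<nu> G t y y = (\<Sum>i\<in>{1..n}. \<Sum>j\<in>{1..n}. c i * c j * G i j)
     + (\<Sum>s\<in>{1..t}. \<nu> * (u s)\<^sup>2)"
    by (simp add: power2_eq_square algebra_simps)
  then show ?thesis using psd[of c] nu by (simp add: sum_nonneg)
qed

lemma updated_kernel_eq:
  assumes nu: "0 < \<nu>"
    and psd: "\<And>c. 0 \<le> (\<Sum>i\<in>{1..n}. \<Sum>j\<in>{1..n}. c i * c j * G i j)"
  shows "t \<le> n \<Longrightarrow> i \<in> {1..n} \<Longrightarrow> y \<in> {1..n} \<Longrightarrow>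
    updated_kernel \<nu> G t i y = G i y - (\<Sum>s\<in>{1..t}. G i s * updated_kernel \<nu> G t s y) / \<nu>"
proof (induction t arbitrary: i y)
  case 0
  then show ?case by simp
next
  case (Suc t)
  let ?K = "updated_kernel \<nu> G t" and ?K' = "updated_kernel \<nu> G (Suc t)" and ?s = "Suc t"
  have IH: "?K i y = G i y - (\<Sum>s\<in>{1..t}. G i s * ?K s y) / \<nu>" if "i \<in> {1..n}" "y \<in> {1..n}" for i y
    using Suc that by auto
  have s: "?s \<in> {1..n}" using Suc.prems by auto
  define D where "D = \<nu> + ?K ?s ?s"
  have D: "D > 0"
  proof -
    have "0 \<le> ?K ?s ?s"
      using Suc.prems(1) by (intro updated_kernel_diag_nonneg[OF nu psd _ s] IH s) auto
    then show ?thesis using nu by (simp add: D_def)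
  qed
  have K': "?K' a b = ?K a b - ?K a ?s * ?K ?s b / D" for a b by (simp add: D_def)
  have last: "?K' ?s y = \<nu> * ?K ?s y / D"
  proof -
    have "?K' ?s y = (D - ?K ?s ?s) * ?K ?s y / D"
      unfolding K' using D by (simp add: field_simps)
    then show ?thesis by (simp add: D_def)
  qed
  have "(\<Sum>r\<in>{1..t}. G i r * ?K' r y)
      = (\<Sum>r\<in>{1..t}. G i r * ?K r y) - (\<Sum>r\<in>{1..t}. G i r * ?K r ?s) * ?K ?s y / D"
    unfolding K' by (simp add: right_diff_distrib sum_subtractf sum_distrib_right sum_divide_distrib mult.assoc)
  moreover have "(\<Sum>r\<in>{1..t}. G i r * ?K r y) = \<nu> * (G i y - ?K i y)"
    using IH[of i y] Suc.prems nu by (simp add: field_simps)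
  moreover have "(\<Sum>r\<in>{1..t}. G i r * ?K r ?s) = \<nu> * (G i ?s - ?K i ?s)"
    using IH[of i ?s] s Suc.prems nu by (simp add: field_simps)
  ultimately have "(\<Sum>r\<in>{1..Suc t}. G i r * ?K' r y)
      = \<nu> * (G i y - ?K i y) - \<nu> * (G i ?s - ?K i ?s) * ?K ?s y / D + G i ?s * (\<nu> * ?K ?s y / D)"
    by (simp del: updated_kernel.simps add: last)
  also have "\<dots> = \<nu> * (G i y - ?K' i y)"
    unfolding K' using D by (simp add: field_simps)
  finally show ?case using nu by (simp del: updated_kernel.simps)
qed

lemma ridge_smoother_smoother:
  assumes nu: "0 < \<nu>"
    and sym: "\<And>i j. i \<in> {1..n} \<Longrightarrow> j \<in> {1..n} \<Longrightarrow> G i j = G j i"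
    and psd: "\<And>c. 0 \<le> (\<Sum>i\<in>{1..n}. \<Sum>j\<in>{1..n}. c i * c j * G i j)"
  shows "ridge_smoother {1..n} G (smoother_matrix \<nu> G n) \<nu>"
proof
  fix i j assume ij: "i \<in> {1..n}" "j \<in> {1..n}"
  show "smoother_matrix \<nu> G n i j = smoother_matrix \<nu> G n j i"
    using updated_kernel_sym[of n G n i j \<nu>, OF sym] ij by (simp add: smoother_matrix_def)
  show "\<nu> * smoother_matrix \<nu> G n i j = G i j - (\<Sum>k\<in>{1..n}. G i k * smoother_matrix \<nu> G n k j)"
    using updated_kernel_eq[OF nu psd order.refl ij] nu
    by (simp add: smoother_matrix_def sum_divide_distrib)
qed (use assms in auto)

section \<open>Ridge regression with a linear and a kernel part\<close>

context rkhs
begin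

lemma sum_mem: "finite I \<Longrightarrow> (\<And>i. i \<in> I \<Longrightarrow> u i \<in> H) \<Longrightarrow> (\<lambda>x. \<Sum>i\<in>I. c i * u i x) \<in> H"
  by (induction I rule: finite_induct) (auto intro!: zero_mem add_mem scale_mem)

lemma ip_sum_left:
  "finite I \<Longrightarrow> (\<And>i. i \<in> I \<Longrightarrow> u i \<in> H) \<Longrightarrow> g \<in> H \<Longrightarrow>
    ip (\<lambda>x. \<Sum>i\<in>I. c i * u i x) g = (\<Sum>i\<in>I. c i * ip (u i) g)"
proof (induction I rule: finite_induct)
  case empty
  show ?case using ip_scale_left[OF zero_mem \<open>g \<in> H\<close>, of 0] by simp
next
  case (insert i I)
  then have "ip (\<lambda>x. c i * u i x + (\<Sum>i\<in>I. c i * u i x)) g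
      = ip (\<lambda>x. c i * u i x) g + ip (\<lambda>x. \<Sum>i\<in>I. c i * u i x) g"
    by (intro ip_add_left scale_mem sum_mem) auto
  with insert show ?case by (simp add: ip_scale_left)
qed

lemma diff_mem: "f \<in> H \<Longrightarrow> g \<in> H \<Longrightarrow> (\<lambda>x. f x - g x) \<in> H"
  using add_mem[of f "\<lambda>x. -1 * g x"] scale_mem[of g "-1"] by simp

lemma ip_diff:
  assumes "f \<in> H" "g \<in> H"
  shows "ip (\<lambda>x. f x - g x) (\<lambda>x. f x - g x) = ip f f - 2 * ip f g + ip g g"
proof -
  have left: "ip (\<lambda>x. f x - g x) h = ip f h - ip g h" if "h \<in> H" for h
    using ip_add_left[of f "\<lambda>x. -1 * g x" h] ip_scale_left[of g h "-1"] scale_mem[of g "-1"] assms that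
    by simp
  have fg: "(\<lambda>x. f x - g x) \<in> H" using assms by (rule diff_mem)
  have "ip f (\<lambda>x. f x - g x) = ip f f - ip g f" "ip g (\<lambda>x. f x - g x) = ip f g - ip g g"
    using left assms fg by (simp_all add: ip_commute[of _ "\<lambda>x. f x - g x"])
  then show ?thesis using left[OF fg] ip_commute[OF assms] by simp
qed

lemma rkhs_norm_square: "f \<in> H \<Longrightarrow> (rkhs_norm ip f)\<^sup>2 = ip f f"
  by (simp add: rkhs_norm_def ip_nonneg)

lemma kernel_commute: "x \<in> S \<Longrightarrow> y \<in> S \<Longrightarrow> K x y = K y x"
  using reproducing[OF section_mem[of x], of y] reproducing[OF section_mem[of y], of x]
    ip_commute[OF section_mem section_mem, of x y]
  by (simp add: kernel_section_def)

lemma ip_Cauchy_Schwarz: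
  assumes "f \<in> H" "g \<in> H"
  shows "(ip f g)\<^sup>2 \<le> ip f f * ip g g"
proof (cases "ip g g = 0")
  case True
  then have "g = (\<lambda>_. 0)" using assms ip_eq_zero by blast
  then have "ip f g = 0" using ip_scale_left[OF zero_mem assms(1), of 0] ip_commute assms by simp
  then show ?thesis using True by simp
next
  case False
  then have g: "0 < ip g g" using ip_nonneg[OF assms(2)] by simp
  define t where "t = ip f g / ip g g"
  have tg: "(\<lambda>x. t * g x) \<in> H" using assms by (intro scale_mem)
  have "ip f (\<lambda>x. t * g x) = t * ip f g" 
    using assms tg by (metis ip_commute ip_scale_left)
  moreover have "ip (\<lambda>x. t * g x) (\<lambda>x. t * g x) = t * (t * ip g g)" 
    using assms tg by (metis ip_commute ip_scale_left)
  ultimately have "0 \<le> ip f f - 2 * (t * ip f g) + t * (t * ip g g)"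
    using ip_diff[OF assms(1) tg] ip_nonneg[OF diff_mem[OF assms(1) tg]] by simp
  also have "\<dots> = ip f f - (ip f g)\<^sup>2 / ip g g"
    using g by (simp add: t_def power2_eq_square)
  finally show ?thesis using g by (simp add: field_simps)
qed

text \<open>
  The increment of \<open>f\<close> is its inner product with the difference of two kernel sections, and the bracket
  is the squared norm of that difference.
\<close>

lemma increment_le:
  assumes f: "f \<in> H" and x: "x \<in> S" and y: "y \<in> S"
  shows "(f y - f x)\<^sup>2 \<le> ip f f * (K y y - 2 * K y x + K x x)"
proof -
  let ?kx = "kernel_section S K x" and ?ky = "kernel_section S K y"
  have d: "(\<lambda>z. ?ky z - ?kx z) \<in> H" by (intro diff_mem section_mem x y)
  have "f y - f x = ip ?ky f - ip ?kx f"
    using reproducing[OF f x] reproducing[OF f y] ip_commute[OF f section_mem[OF x]]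
      ip_commute[OF f section_mem[OF y]] by simp
  also have "\<dots> = ip (\<lambda>z. ?ky z - ?kx z) f"
    using ip_add_left[of ?ky "\<lambda>z. -1 * ?kx z" f] ip_scale_left[of ?kx f "-1"]
      scale_mem[of ?kx "-1"] section_mem x y f by simp
  finally have "(f y - f x)\<^sup>2 \<le> ip (\<lambda>z. ?ky z - ?kx z) (\<lambda>z. ?ky z - ?kx z) * ip f f"
    using ip_Cauchy_Schwarz[OF d f] by simp
  also have "ip (\<lambda>z. ?ky z - ?kx z) (\<lambda>z. ?ky z - ?kx z) = K y y - 2 * K y x + K x x"
    using ip_diff[OF section_mem[OF y] section_mem[OF x]]
      reproducing[OF section_mem[OF y] y] reproducing[OF section_mem[OF y] x]
      reproducing[OF section_mem[OF x] x] kernel_commute[OF x y] x y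
    by (simp add: kernel_section_def)
  finally show ?thesis by (simp add: mult.commute)
qed

end

text \<open>
  Serves to make the members of \<open>H\<close> measurable.
\<close>

lemma rkhs_continuous_on:
  fixes S :: "'a::metric_space set"
  assumes "rkhs S K H ip" and K: "continuous_on (S \<times> S) (\<lambda>(x, y). K x y)" and f: "f \<in> H"
  shows "continuous_on S f"
  unfolding continuous_on_def
proof
  interpret rkhs S K H ip by fact
  fix x assume x: "x \<in> S"
  have K': "continuous_on (S \<times> S) (\<lambda>p. K (fst p) (snd p))"
    using K by (simp add: case_prod_unfold)
  have "continuous_on S (\<lambda>y. (y, y))" "continuous_on S (\<lambda>y. (y, x))"
    by (intro continuous_intros)+
  from continuous_on_compose2[OF K' this(1)] continuous_on_compose2[OF K' this(2)]
  have "continuous_on S (\<lambda>y. K y y)" "continuous_on S (\<lambda>y. K y x)"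
    using x by auto
  then have "((\<lambda>y. K y y) \<longlongrightarrow> K x x) (at x within S)" "((\<lambda>y. K y x) \<longlongrightarrow> K x x) (at x within S)"
    using x by (auto simp: continuous_on_def)
  then have "((\<lambda>y. ip f f * (K y y - 2 * K y x + K x x)) \<longlongrightarrow> ip f f * (K x x - 2 * K x x + K x x)) (at x within S)"
    by (intro tendsto_intros)
  then have lim: "((\<lambda>y. ip f f * (K y y - 2 * K y x + K x x)) \<longlongrightarrow> 0) (at x within S)" by simp
  have "((\<lambda>y. (f y - f x)\<^sup>2) \<longlongrightarrow> 0) (at x within S)"
  proof (rule tendsto_sandwich[OF _ _ tendsto_const lim])
    show "eventually (\<lambda>y. (f y - f x)\<^sup>2 \<le> ip f f * (K y y - 2 * K y x + K x x)) (at x within S)"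
      using increment_le[OF f x] by (auto simp: eventually_at_filter)
  qed auto
  then have "((\<lambda>y. sqrt ((f y - f x)\<^sup>2)) \<longlongrightarrow> sqrt 0) (at x within S)"
    by (rule tendsto_real_sqrt)
  then have "((\<lambda>y. f y - f x) \<longlongrightarrow> 0) (at x within S)"
    by (simp add: tendsto_rabs_zero_iff)
  then show "(f \<longlongrightarrow> f x) (at x within S)"
    using Lim_null by blast
qed

context rkhs
begin

definition kernel_expansion :: "'i set \<Rightarrow> ('i \<Rightarrow> real) \<Rightarrow> ('i \<Rightarrow> 'a) \<Rightarrow> 'a \<Rightarrow> real" where
  "kernel_expansion I c x = (\<lambda>z. \<Sum>i\<in>I. c i * kernel_section S K (x i) z)"

lemma kernel_expansion_apply: "z \<in> S \<Longrightarrow> kernel_expansion I c x z = (\<Sum>i\<in>I. c i * K z (x i))"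
  by (simp add: kernel_expansion_def kernel_section_def)

context
  fixes I :: "'i set" and x :: "'i \<Rightarrow> 'a"
  assumes I: "finite I" and x: "\<And>i. i \<in> I \<Longrightarrow> x i \<in> S"
begin

lemma kernel_expansion_mem: "kernel_expansion I c x \<in> H"
  unfolding kernel_expansion_def by (intro sum_mem I section_mem x)

lemma ip_kernel_expansion:
  assumes g: "g \<in> H"
  shows "ip g (kernel_expansion I c x) = (\<Sum>i\<in>I. c i * g (x i))"
proof -
  have "ip g (kernel_expansion I c x) = ip (kernel_expansion I c x) g"
    using g kernel_expansion_mem by (rule ip_commute)
  also have "\<dots> = (\<Sum>i\<in>I. c i * ip (kernel_section S K (x i)) g)"
    unfolding kernel_expansion_def by (intro ip_sum_left I section_mem x g)
  also have "\<dots> = (\<Sum>i\<in>I. c i * g (x i))"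
    using x by (intro sum.cong refl) (simp add: reproducing[OF g] ip_commute[OF _ g] section_mem)
  finally show ?thesis .
qed

lemma ip_kernel_expansion_self:
  "ip (kernel_expansion I c x) (kernel_expansion I c x)
    = (\<Sum>i\<in>I. \<Sum>j\<in>I. c i * c j * K (x i) (x j))"
  unfolding ip_kernel_expansion[OF kernel_expansion_mem]
  using x by (simp add: kernel_expansion_apply sum_distrib_left mult.assoc cong: sum.cong)

lemma kernel_form_nonneg: "0 \<le> (\<Sum>i\<in>I. \<Sum>j\<in>I. c i * c j * K (x i) (x j))"
  unfolding ip_kernel_expansion_self[symmetric] by (rule ip_nonneg) (rule kernel_expansion_mem)

end

end

definition ridge_gram ::
  "real \<Rightarrow> real \<Rightarrow> ('v::real_inner \<Rightarrow> 'v \<Rightarrow> real) \<Rightarrow> ('i \<Rightarrow> 'v) \<Rightarrow> 'i \<Rightarrow> 'i \<Rightarrow> real" where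
  "ridge_gram mu lam K x i j = x i \<bullet> x j / mu + K (x i) (x j) / lam"

lemma linear_gram_form:
  fixes x :: "'i \<Rightarrow> 'v::real_inner"
  shows "(\<Sum>i\<in>I. \<Sum>j\<in>I. c i * c j * (x i \<bullet> x j)) = (norm (\<Sum>i\<in>I. c i *\<^sub>R x i))\<^sup>2"
  by (simp add: power2_norm_eq_inner inner_sum_left inner_sum_right sum_distrib_left mult_ac inner_commute)

lemma ridge_gram_form:
  "(\<Sum>i\<in>I. \<Sum>j\<in>I. c i * c j * ridge_gram mu lam K x i j)
    = (norm (\<Sum>i\<in>I. c i *\<^sub>R x i))\<^sup>2 / mu
      + (\<Sum>i\<in>I. \<Sum>j\<in>I. c i * c j * K (x i) (x j)) / lam"
  unfolding linear_gram_form[symmetric] ridge_gram_def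
  by (simp add: distrib_left sum.distrib sum_divide_distrib)

context
  fixes S :: "(real ^ 'd) set" and K H ip and mu lam :: real and x :: "nat \<Rightarrow> real ^ 'd" and n :: nat
  assumes rkhs: "rkhs S K H ip" and mu: "0 < mu" and lam: "0 < lam" and n: "n \<ge> 1"
    and x: "\<And>i. i \<in> {1..n} \<Longrightarrow> x i \<in> S"
begin

interpretation rkhs S K H ip by (rule rkhs)

lemma ridge_smoother_ridge_gram:
  "ridge_smoother {1..n} (ridge_gram mu lam K x) (smoother_matrix n (ridge_gram mu lam K x) n) n"
proof (rule ridge_smoother_smoother)
  fix i j assume "i \<in> {1..n}" "j \<in> {1..n}"
  then show "ridge_gram mu lam K x i j = ridge_gram mu lam K x j i"
    using kernel_commute x by (simp add: ridge_gram_def inner_commute)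
next
  fix c
  show "0 \<le> (\<Sum>i\<in>{1..n}. \<Sum>j\<in>{1..n}. c i * c j * ridge_gram mu lam K x i j)"
    unfolding ridge_gram_form using kernel_form_nonneg[of "{1..n}" x c] x mu lam by simp
qed (use n in simp)

interpretation ridge_smoother "{1..n}" "ridge_gram mu lam K x" "smoother_matrix n (ridge_gram mu lam K x) n" n
  by (rule ridge_smoother_ridge_gram)

text \<open>
  The combination \<open>\<Sum>\<^sub>i c\<^sub>i (X\<^sub>i \<bullet> \<alpha> + g X\<^sub>i)\<close> of values is the inner product of \<open>(\<alpha>, g)\<close>, with
  respect to the penalty, with the pair \<open>(\<Sum>\<^sub>i c\<^sub>i X\<^sub>i / mu, \<Sum>\<^sub>i c\<^sub>i K(\<cdot>, X\<^sub>i) / lam)\<close>, whose squared norm is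
  \<open>c\<^sup>T G c\<close>. The identity expands the squared distance between the two pairs.
\<close>

lemma penalty_square:
  assumes g: "g \<in> H"
  shows "mu * (norm \<alpha>)\<^sup>2 + lam * ip g g - 2 * (\<Sum>i\<in>{1..n}. c i * (x i \<bullet> \<alpha> + g (x i)))
      + (\<Sum>i\<in>{1..n}. \<Sum>j\<in>{1..n}. c i * c j * ridge_gram mu lam K x i j)
    = mu * (norm (\<alpha> - (\<Sum>i\<in>{1..n}. c i *\<^sub>R x i) /\<^sub>R mu))\<^sup>2
      + lam * (let g0 = kernel_expansion {1..n} (\<lambda>i. c i / lam) x in
          ip (\<lambda>z. g z - g0 z) (\<lambda>z. g z - g0 z))"
proof -
  let ?v = "\<Sum>i\<in>{1..n}. c i *\<^sub>R x i" and ?g0 = "kernel_expansion {1..n} (\<lambda>i. c i / lam) x"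
  have fin: "finite {1..n}" by simp
  have g0: "?g0 \<in> H" by (rule kernel_expansion_mem[OF fin x])
  have v: "?v \<bullet> \<alpha> = (\<Sum>i\<in>{1..n}. c i * (x i \<bullet> \<alpha>))"
    by (simp add: inner_sum_left)
  have "mu * (norm (\<alpha> - ?v /\<^sub>R mu))\<^sup>2
      = mu * (norm \<alpha>)\<^sup>2 - 2 * (\<Sum>i\<in>{1..n}. c i * (x i \<bullet> \<alpha>)) + (norm ?v)\<^sup>2 / mu"
    unfolding v[symmetric] using mu
    by (simp add: power2_norm_eq_inner inner_diff_left inner_diff_right inner_commute[of \<alpha> ?v] del: One_nat_def)
      (simp add: field_simps)
  moreover have "lam * ip (\<lambda>z. g z - ?g0 z) (\<lambda>z. g z - ?g0 z)
      = lam * ip g g - 2 * (\<Sum>i\<in>{1..n}. c i * g (x i))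
        + (\<Sum>i\<in>{1..n}. \<Sum>j\<in>{1..n}. c i * c j * K (x i) (x j)) / lam"
  proof -
    define T where "T = (\<Sum>i\<in>{1..n}. \<Sum>j\<in>{1..n}. c i * c j * K (x i) (x j))"
    define U where "U = (\<Sum>i\<in>{1..n}. c i * g (x i))"
    have "ip ?g0 ?g0 = (\<Sum>i\<in>{1..n}. \<Sum>j\<in>{1..n}. c i / lam * (c j / lam) * K (x i) (x j))"
      by (rule ip_kernel_expansion_self) (use x in auto)
    then have "ip ?g0 ?g0 = T / lam / lam" by (simp add: T_def sum_divide_distrib)
    moreover have "ip g ?g0 = (\<Sum>i\<in>{1..n}. c i / lam * g (x i))"
      by (rule ip_kernel_expansion) (use x g in auto)
    then have "ip g ?g0 = U / lam" by (simp add: U_def sum_divide_distrib)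
    ultimately show ?thesis
      unfolding ip_diff[OF g g0] T_def[symmetric] U_def[symmetric]
      using lam by (simp add: field_simps)
  qed
  ultimately show ?thesis
    unfolding ridge_gram_form Let_def
    by (simp add: distrib_left sum.distrib)
qed

lemma ridge_objective_decomposition:
  assumes g: "g \<in> H"
  shows "ridge_objective n x y mu lam ip (\<alpha>, g)
    = (\<Sum>i\<in>{1..n}. (x i \<bullet> \<alpha> + g (x i) - fit y i)\<^sup>2) / n
      + (\<Sum>i\<in>{1..n}. (y i - fit y i)\<^sup>2) / n + (\<Sum>i\<in>{1..n}. dual_coeff y i * fit y i)
      + (mu * (norm (\<alpha> - (\<Sum>i\<in>{1..n}. dual_coeff y i *\<^sub>R x i) /\<^sub>R mu))\<^sup>2
      + lam * (let g0 = kernel_expansion {1..n} (\<lambda>i. dual_coeff y i / lam) x in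
          ip (\<lambda>z. g z - g0 z) (\<lambda>z. g z - g0 z)))"
  unfolding penalty_square[OF g, symmetric] gram_form_dual_coeff
  using objective_decomposition[of y "\<lambda>i. x i \<bullet> \<alpha> + g (x i)" "mu * (norm \<alpha>)\<^sup>2 + lam * ip g g"]
  by (simp add: ridge_objective_def rkhs_norm_square[OF g] diff_diff_eq)

lemma square_penalty_nonneg:
  assumes "g \<in> H"
  shows "0 \<le> mu * (norm (\<alpha> - \<alpha>0))\<^sup>2
      + lam * (let g0 = kernel_expansion {1..n} c x in ip (\<lambda>z. g z - g0 z) (\<lambda>z. g z - g0 z))"
  using ip_nonneg[OF diff_mem[OF assms kernel_expansion_mem[of "{1..n}" x c]]] x mu lam
  by (simp add: Let_def)

text \<open>
  The pair built from the dual coefficients of \<open>y\<close> makes the penalty square vanish and has the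
  values \<open>S y\<close>, so the objective of a minimizer leaves no room for the sum of squared differences
  between its values and \<open>S y\<close>.
\<close>

lemma ridge_minimizer_fit:
  assumes min: "is_arg_min (ridge_objective n x y mu lam ip) (\<lambda>(\<alpha>, g). g \<in> H) (\<alpha>, g)"
    and i: "i \<in> {1..n}"
  shows "x i \<bullet> \<alpha> + g (x i) = fit y i"
proof -
  define \<alpha>0 where "\<alpha>0 = (\<Sum>i\<in>{1..n}. dual_coeff y i *\<^sub>R x i) /\<^sub>R mu"
  define g0 where "g0 = kernel_expansion {1..n} (\<lambda>i. dual_coeff y i / lam) x"
  have g: "g \<in> H" using min by (simp add: is_arg_min_def)
  have g0: "g0 \<in> H" unfolding g0_def by (rule kernel_expansion_mem) (use x in auto)
  have fit0: "x j \<bullet> \<alpha>0 + g0 (x j) = fit y j" if j: "j \<in> {1..n}" for j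
    unfolding gram_dual_coeff[OF j, symmetric] \<alpha>0_def g0_def
    by (simp add: kernel_expansion_apply[OF x[OF j]] inner_sum_right ridge_gram_def distrib_right distrib_left
        sum.distrib sum_divide_distrib sum_distrib_left divide_inverse mult_ac)
  have "ip (\<lambda>z. 0) (\<lambda>z. 0) = 0"
    using ip_scale_left[OF zero_mem zero_mem, of 0] by simp
  then have "ridge_objective n x y mu lam ip (\<alpha>0, g0)
      = (\<Sum>i\<in>{1..n}. (y i - fit y i)\<^sup>2) / n + (\<Sum>i\<in>{1..n}. dual_coeff y i * fit y i)"
    unfolding ridge_objective_decomposition[OF g0]
    by (simp add: Let_def fit0 flip: \<alpha>0_def g0_def)
  moreover have "ridge_objective n x y mu lam ip (\<alpha>, g) \<le> ridge_objective n x y mu lam ip (\<alpha>0, g0)"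
    using min g0 by (auto simp: is_arg_min_def not_less)
  ultimately have "(\<Sum>i\<in>{1..n}. (x i \<bullet> \<alpha> + g (x i) - fit y i)\<^sup>2) / n \<le> 0"
    using square_penalty_nonneg[OF g, of \<alpha> \<alpha>0 "\<lambda>i. dual_coeff y i / lam"]
    unfolding ridge_objective_decomposition[OF g] \<alpha>0_def by linarith
  then have "(\<Sum>i\<in>{1..n}. (x i \<bullet> \<alpha> + g (x i) - fit y i)\<^sup>2) \<le> 0"
    using n by (simp add: divide_le_0_iff)
  then have "(\<Sum>i\<in>{1..n}. (x i \<bullet> \<alpha> + g (x i) - fit y i)\<^sup>2) = 0"
    by (simp add: sum_nonneg order.antisym)
  then show ?thesis using i by (subst (asm) sum_nonneg_eq_0_iff) auto
qed

text \<open>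
  The decomposition of the objective with \<open>f\<close> as responses: the left side is one of its nonnegative
  terms.
\<close>

lemma ridge_bias_le:
  assumes g: "g \<in> H"
  shows "(\<Sum>i\<in>{1..n}. (fit f i - f i)\<^sup>2) / n
    \<le> (\<Sum>i\<in>{1..n}. (x i \<bullet> \<alpha> + g (x i) - f i)\<^sup>2) / n + mu * (norm \<alpha>)\<^sup>2 + lam * (rkhs_norm ip g)\<^sup>2"
proof -
  have "(\<Sum>i\<in>{1..n}. (f i - fit f i)\<^sup>2) / n \<le> ridge_objective n x f mu lam ip (\<alpha>, g)"
    unfolding ridge_objective_decomposition[OF g]
    using square_penalty_nonneg[OF g, of \<alpha> "(\<Sum>i\<in>{1..n}. dual_coeff f i *\<^sub>R x i) /\<^sub>R mu"
        "\<lambda>i. dual_coeff f i / lam"] dual_coeff_fit_nonneg[of f]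
      divide_nonneg_nonneg[OF sum_nonneg[of "{1..n}" "\<lambda>i. (x i \<bullet> \<alpha> + g (x i) - fit f i)\<^sup>2"], of "real n"]
    by simp
  then show ?thesis
    by (simp add: ridge_objective_def power2_commute[of "fit f _"] power2_commute[of _ "f _"] diff_diff_eq)
qed

end

section \<open>Eigenbases of symmetric matrices and their characteristic polynomial\<close>

lemma linear_coeff_zero_if_le_square:
  fixes a b :: real
  assumes "\<And>s. s * a \<le> s\<^sup>2 * b"
  shows "a = 0"
proof (rule ccontr)
  assume a: "a \<noteq> 0"
  define s where "s = a / (1 + \<bar>b\<bar>)"
  have p: "1 + \<bar>b\<bar> > 0" by simp
  have "s\<^sup>2 * b \<le> s\<^sup>2 * \<bar>b\<bar>" by (simp add: mult_left_mono)
  moreover have "s * a = s\<^sup>2 * (1 + \<bar>b\<bar>)" using p by (simp add: s_def power2_eq_square)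
  moreover have "s\<^sup>2 * (1 + \<bar>b\<bar>) = s\<^sup>2 + s\<^sup>2 * \<bar>b\<bar>" by (simp add: distrib_left)
  ultimately have "s\<^sup>2 \<le> 0" using assms[of s] by linarith
  then have "s = 0" by simp
  then show False using a p by (simp add: s_def)
qed

text \<open>
  A maximizer \<open>v\<close> of the Rayleigh quotient on the unit sphere of \<open>T\<close> is an eigenvector: comparison with
  \<open>v + s w\<close> for \<open>w\<close> orthogonal to \<open>v\<close> shows that the term of first order in \<open>s\<close>, a multiple of
  \<open>w \<bullet> f v\<close>, vanishes.
\<close>

lemma symmetric_operator_eigenvector:
  fixes f :: "'a::euclidean_space \<Rightarrow> 'a"
  assumes f: "linear f" and sym: "\<And>x y. f x \<bullet> y = x \<bullet> f y"
    and T: "subspace T" "f ` T \<subseteq> T" "T \<noteq> {0}"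
  shows "\<exists>v\<in>T. \<exists>l. norm v = 1 \<and> f v = l *\<^sub>R v"
proof -
  let ?C = "sphere 0 1 \<inter> T"
  obtain z where z: "z \<in> T" "z \<noteq> 0" using T subspace_0 by blast
  have "z /\<^sub>R norm z \<in> ?C" using z T(1) by (simp add: subspace_scale)
  then have ne: "?C \<noteq> {}" by blast
  have "compact ?C" using T(1) by (intro compact_Int_closed compact_sphere closed_subspace)
  moreover have "continuous_on ?C (\<lambda>x. x \<bullet> f x)"
    using f by (intro continuous_intros linear_continuous_on) (simp add: linear_conv_bounded_linear)
  ultimately obtain v where v: "v \<in> ?C" and vmax: "\<And>x. x \<in> ?C \<Longrightarrow> x \<bullet> f x \<le> v \<bullet> f v"
    using continuous_attains_sup[OF _ ne, of "\<lambda>x. x \<bullet> f x"] by blast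
  define l where "l = v \<bullet> f v"
  have v1: "norm v = 1" and vT: "v \<in> T" using v by auto
  have bound: "x \<bullet> f x \<le> l * (norm x)\<^sup>2" if "x \<in> T" for x
  proof (cases "x = 0")
    case False
    then have "(x /\<^sub>R norm x) \<bullet> f (x /\<^sub>R norm x) \<le> l"
      unfolding l_def using that T(1) by (intro vmax) (simp add: subspace_scale)
    then show ?thesis using False
      by (simp add: linear_cmul[OF f] field_simps power2_eq_square)
  qed (simp add: linear_0[OF f])
  have orth: "w \<bullet> f v = 0" if w: "w \<in> T" "w \<bullet> v = 0" for w
  proof -
    have "s * (2 * (w \<bullet> f v)) \<le> s\<^sup>2 * (l * (norm w)\<^sup>2 - w \<bullet> f w)" for s
    proof -
      have "v + s *\<^sub>R w \<in> T" using w vT T(1) by (simp add: subspace_add subspace_scale)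
      then have "(v + s *\<^sub>R w) \<bullet> f (v + s *\<^sub>R w) \<le> l * (norm (v + s *\<^sub>R w))\<^sup>2" by (rule bound)
      moreover have "(norm (v + s *\<^sub>R w))\<^sup>2 = 1 + s\<^sup>2 * (norm w)\<^sup>2"
        using v1 w by (simp add: power2_norm_eq_inner inner_add_left inner_add_right norm_eq_1
            inner_commute) (simp add: power2_eq_square)
      moreover have "(v + s *\<^sub>R w) \<bullet> f (v + s *\<^sub>R w) = l + 2 * s * (w \<bullet> f v) + s\<^sup>2 * (w \<bullet> f w)"
        using sym[of v w] by (simp add: linear_add[OF f] linear_cmul[OF f] inner_add_left inner_add_right
            l_def power2_eq_square inner_commute algebra_simps)
      ultimately show ?thesis by (simp add: algebra_simps)
    qed
    then show ?thesis using linear_coeff_zero_if_le_square by fastforce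
  qed
  let ?w = "f v - l *\<^sub>R v"
  have wT: "?w \<in> T" using T vT by (auto intro!: subspace_diff subspace_scale)
  have wv: "?w \<bullet> v = 0" using v1 by (simp add: inner_diff_left inner_commute[of "f v"] flip: l_def) (simp add: norm_eq_1)
  have "?w \<bullet> ?w = ?w \<bullet> f v - l * (?w \<bullet> v)" by (simp add: inner_diff_right)
  then have "?w = 0" using orth[OF wT wv] wv by simp
  then show ?thesis using v1 vT by auto
qed

text \<open>
  Split off a unit eigenvector; by symmetry its orthogonal complement in \<open>T\<close> is invariant again.
\<close>

lemma symmetric_operator_eigenbasis:
  fixes f :: "'a::euclidean_space \<Rightarrow> 'a"
  assumes f: "linear f" and sym: "\<And>x y. f x \<bullet> y = x \<bullet> f y"
  shows "subspace T \<Longrightarrow> f ` T \<subseteq> T \<Longrightarrow>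
    \<exists>B\<subseteq>T. pairwise orthogonal B \<and> span B = T \<and> (\<forall>b\<in>B. norm b = 1 \<and> (\<exists>l. f b = l *\<^sub>R b))"
proof (induction "dim T" arbitrary: T rule: less_induct)
  case less
  show ?case
  proof (cases "T = {0}")
    case True
    then show ?thesis by (intro exI[of _ "{}"]) auto
  next
    case False
    obtain v l where v: "v \<in> T" "norm v = 1" "f v = l *\<^sub>R v"
      using symmetric_operator_eigenvector[OF f sym less.prems False] by blast
    let ?T = "T \<inter> {x. v \<bullet> x = 0}"
    have sub: "subspace ?T"
      by (intro subspace_inter less.prems(1) subspace_hyperplane)
    have inv: "f ` ?T \<subseteq> ?T"
      using less.prems(2) v sym[of v] by (auto simp flip: sym)
    have "v \<notin> ?T" using v by (simp add: norm_eq_1)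
    then have "?T \<subset> T" using v by blast
    then have "dim ?T < dim T"
      using sub less.prems(1) by (intro dim_psubset) (metis span_eq_iff)
    then obtain B where B: "B \<subseteq> ?T" "pairwise orthogonal B" "span B = ?T"
      "\<forall>b\<in>B. norm b = 1 \<and> (\<exists>l. f b = l *\<^sub>R b)"
      using less.hyps[OF _ sub inv] by blast
    have "span (insert v B) = T"
    proof
      show "span (insert v B) \<subseteq> T"
        using v B by (intro span_minimal less.prems(1)) auto
      show "T \<subseteq> span (insert v B)"
      proof
        fix x assume x: "x \<in> T"
        have "x - (v \<bullet> x) *\<^sub>R v \<in> ?T"
          using x v less.prems(1)
          by (auto simp: inner_diff_right norm_eq_1 intro!: subspace_diff subspace_scale)
        then have "x - (v \<bullet> x) *\<^sub>R v \<in> span B" using B by simp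
        then show "x \<in> span (insert v B)" by (auto simp: span_breakdown_eq)
      qed
    qed
    moreover have "pairwise orthogonal (insert v B)"
      using B by (auto simp: pairwise_insert orthogonal_def inner_commute)
    ultimately show ?thesis
      using B v by (intro exI[of _ "insert v B"]) auto
  qed
qed

text \<open>
  Indexing the eigenvectors by the index type of the matrix makes them the columns of an orthogonal
  matrix \<open>P\<close> with \<open>(t I - A) P = P D\<close> for a diagonal \<open>D\<close>, which yields the characteristic polynomial.
\<close>

lemma symmetric_matrix_diagonalization:
  fixes A :: "real ^ 'd ^ 'd"
  assumes "transpose A = A"
  obtains u :: "'d \<Rightarrow> real ^ 'd" and l :: "'d \<Rightarrow> real"
  where "\<And>j k. u j \<bullet> u k = (if j = k then 1 else 0)" "\<And>k. A *v u k = l k *\<^sub>R u k"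
    "\<And>t. det (mat t - A) = (\<Prod>k\<in>UNIV. t - l k)"
proof -
  have sym: "(A *v x) \<bullet> y = x \<bullet> (A *v y)" for x y
    using assms by (metis dot_lmul_matrix inner_commute transpose_matrix_vector)
  have "\<exists>B\<subseteq>UNIV. pairwise orthogonal B \<and> span B = UNIV \<and>
      (\<forall>b\<in>B. norm b = 1 \<and> (\<exists>l. A *v b = l *\<^sub>R b))"
    by (rule symmetric_operator_eigenbasis) (auto simp: sym matrix_vector_mul_linear)
  then obtain B where B: "pairwise orthogonal B" "span B = (UNIV :: (real ^ 'd) set)"
    "\<And>b. b \<in> B \<Longrightarrow> norm b = 1" "\<And>b. b \<in> B \<Longrightarrow> \<exists>l. A *v b = l *\<^sub>R b" by blast
  have "0 \<notin> B" using B(3) by force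
  then have ind: "independent B" using B(1) by (intro pairwise_orthogonal_independent)
  have finB: "finite B" using ind by (rule independent_imp_finite)
  have "card B = CARD('d)"
    using dim_eq_card[of B UNIV] B(2) ind by simp
  then obtain u where u: "bij_betw u (UNIV :: 'd set) B"
    using finB by (metis finite_class.finite_UNIV bij_betw_iff_card)
  then have uB: "u k \<in> B" for k by (auto simp: bij_betw_def)
  define l where "l k = (SOME l. A *v u k = l *\<^sub>R u k)" for k
  have l: "A *v u k = l k *\<^sub>R u k" for k
    unfolding l_def by (rule someI_ex) (rule B(4)[OF uB])
  have on: "u j \<bullet> u k = (if j = k then 1 else 0)" for j k
  proof (cases "j = k")
    case True
    then show ?thesis using B(3)[OF uB, of k] by (simp add: norm_eq_1)
  next
    case False
    then have "u j \<noteq> u k" using u by (auto simp: bij_betw_def inj_on_def)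
    then show ?thesis using B(1) uB False by (auto simp: pairwise_def orthogonal_def)
  qed
  define P :: "real ^ 'd ^ 'd" where "P = (\<chi> i k. u k $ i)"
  have "transpose P ** P = mat 1"
    using on by (simp add: vec_eq_iff matrix_matrix_mult_def transpose_def P_def mat_def inner_vec_def)
  then have "det (transpose P) * det P = 1" by (metis det_mul det_I)
  then have detP: "det P \<noteq> 0" by auto
  have "det (mat t - A) = (\<Prod>k\<in>UNIV. t - l k)" for t
  proof -
    define D :: "real ^ 'd ^ 'd" where "D = (\<chi> i j. if i = j then t - l i else 0)"
    have AP: "(\<Sum>k\<in>UNIV. A $ i $ k * u j $ k) = l j * u j $ i" for i j
      using arg_cong[OF l[of j], of "\<lambda>v. v $ i"] by (simp add: matrix_vector_mult_def)
    have "((mat t - A) ** P) $ i $ j = (P ** D) $ i $ j" for i j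
    proof -
      have "((mat t - A) ** P) $ i $ j = (\<Sum>k\<in>UNIV. (if i = k then t * u j $ k else 0)) - (\<Sum>k\<in>UNIV. A $ i $ k * u j $ k)"
        by (simp add: matrix_matrix_mult_def P_def mat_def left_diff_distrib sum_subtractf
            if_distrib[of "\<lambda>x. x * _"] cong: if_cong)
      also have "\<dots> = (t - l j) * u j $ i" by (simp add: AP left_diff_distrib)
      also have "\<dots> = (P ** D) $ i $ j"
        by (simp add: matrix_matrix_mult_def P_def D_def if_distrib[of "\<lambda>x. _ * x"] cong: if_cong)
      finally show ?thesis .
    qed
    then have "(mat t - A) ** P = P ** D" by (simp add: vec_eq_iff)
    then have "det (mat t - A) * det P = det P * det D" by (metis det_mul)
    then have "det (mat t - A) = det D" using detP by simp
    also have "\<dots> = (\<Prod>k\<in>UNIV. D $ k $ k)" by (rule det_diagonal) (simp add: D_def)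
    finally show ?thesis by (simp add: D_def)
  qed
  with on l show ?thesis using that by blast
qed

text \<open>
  Both sums are the logarithmic derivative at \<open>s\<close> of the same polynomial.
\<close>

lemma sum_inverse_eq_if_prod_eq:
  fixes a :: "'i \<Rightarrow> real" and b :: "'j \<Rightarrow> real"
  assumes fin: "finite I" "finite J"
    and eq: "\<And>t. (\<Prod>i\<in>I. t - a i) = (\<Prod>j\<in>J. t - b j)"
    and s: "\<And>i. i \<in> I \<Longrightarrow> s \<noteq> a i" "\<And>j. j \<in> J \<Longrightarrow> s \<noteq> b j"
  shows "(\<Sum>i\<in>I. 1 / (s - a i)) = (\<Sum>j\<in>J. 1 / (s - b j))"
proof -
  have D: "((\<lambda>t. \<Prod>k\<in>X. t - c k) has_real_derivative (\<Prod>k\<in>X. s - c k) * (\<Sum>k\<in>X. 1 / (s - c k))) (at s)"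
    if "\<And>k. k \<in> X \<Longrightarrow> s \<noteq> c k" for X and c :: "'k \<Rightarrow> real"
  proof -
    have "((\<lambda>t. \<Prod>k\<in>X. t - c k) has_field_derivative (\<Prod>k\<in>X. s - c k) * (\<Sum>k\<in>X. 1 / (s - c k))) (at s)"
      using that by (intro has_field_derivative_prod') (auto intro!: derivative_eq_intros)
    then show ?thesis .
  qed
  have "(\<Prod>i\<in>I. s - a i) * (\<Sum>i\<in>I. 1 / (s - a i)) = (\<Prod>j\<in>J. s - b j) * (\<Sum>j\<in>J. 1 / (s - b j))"
    using D[of I a] D[of J b] s DERIV_unique unfolding eq by blast
  moreover have "(\<Prod>i\<in>I. s - a i) \<noteq> 0" using fin s by simp
  ultimately show ?thesis using eq[of s] by simp
qed

text \<open>
  The numbers \<open>\<tau>\<close> are tied to the eigenvalues of an eigenbasis by the characteristic polynomial only.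
  As \<open>l / (l + mu) = 1 - mu / (l + mu)\<close>, the logarithmic derivative at \<open>- mu\<close> suffices to compare
  the two sums, without matching the eigenvalues one by one.
\<close>

lemma ridge_dimension_eq:
  fixes l :: "'d::finite \<Rightarrow> real"
  assumes eq: "\<And>t. (\<Prod>k\<in>UNIV. t - l k) = (\<Prod>i = 1..CARD('d). t - \<tau> i)"
    and l: "\<And>k. 0 \<le> l k" and tau: "\<And>i. i \<in> {1..CARD('d)} \<Longrightarrow> 0 \<le> \<tau> i" and mu: "0 < mu"
  shows "(\<Sum>k\<in>UNIV. l k / (l k + mu)) = (\<Sum>i = 1..CARD('d). \<tau> i / (\<tau> i + mu))"
proof -
  have ratio: "(\<Sum>k\<in>X. c k / (c k + mu)) = card X + mu * (\<Sum>k\<in>X. 1 / (- mu - c k))"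
    if "\<And>k. k \<in> X \<Longrightarrow> 0 \<le> c k" for X and c :: "'k \<Rightarrow> real"
  proof -
    have "c k / (c k + mu) = 1 + mu * (1 / (- mu - c k))" if "k \<in> X" for k
    proof -
      have "c k + mu > 0" using \<open>\<And>k. k \<in> X \<Longrightarrow> 0 \<le> c k\<close>[OF that] mu by simp
      moreover have "- mu - c k = - (c k + mu)" by simp
      ultimately show ?thesis by (simp only: divide_minus_right) (simp add: field_simps)
    qed
    then show ?thesis by (simp add: sum.distrib sum_distrib_left)
  qed
  have ne: "- mu \<noteq> l k" "i \<in> {1..CARD('d)} \<Longrightarrow> - mu \<noteq> \<tau> i" for k i
    using l[of k] tau[of i] mu by linarith+
  have "(\<Sum>k\<in>UNIV. 1 / (- mu - l k)) = (\<Sum>i = 1..CARD('d). 1 / (- mu - \<tau> i))"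
    by (rule sum_inverse_eq_if_prod_eq) (use eq ne in auto)
  then show ?thesis using ratio[of UNIV l] ratio[of "{1..CARD('d)}" \<tau>] l tau by simp
qed

section \<open>Averages of the kernel over dyadic cells\<close>

lemma L2_measurable: "f \<in> L2 \<rho> \<Longrightarrow> f \<in> borel_measurable \<rho>"
  and L2_integrable_square: "f \<in> L2 \<rho> \<Longrightarrow> integrable \<rho> (\<lambda>x. (f x)\<^sup>2)"
  by (auto simp: L2_def)

lemma abs_mult_le_sum_squares: "\<bar>a * b\<bar> \<le> a\<^sup>2 + (b::real)\<^sup>2"
  using sum_squares_bound[of "\<bar>a\<bar>" "\<bar>b\<bar>"] mult_nonneg_nonneg[of "\<bar>a\<bar>" "\<bar>b\<bar>"]
  unfolding abs_mult power2_abs by linarith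

lemma L2_inner_integrable:
  assumes "f \<in> L2 \<rho>" "g \<in> L2 \<rho>"
  shows "integrable \<rho> (\<lambda>x. f x * g x)"
proof (rule Bochner_Integration.integrable_bound)
  show "integrable \<rho> (\<lambda>x. (f x)\<^sup>2 + (g x)\<^sup>2)"
    using assms by (simp add: L2_def)
  show "(\<lambda>x. f x * g x) \<in> borel_measurable \<rho>"
    by (intro borel_measurable_times assms[THEN L2_measurable])
  show "AE x in \<rho>. norm (f x * g x) \<le> norm ((f x)\<^sup>2 + (g x)\<^sup>2)"
    using abs_mult_le_sum_squares by simp
qed

lemma L2_add:
  assumes "f \<in> L2 \<rho>" "g \<in> L2 \<rho>"
  shows "(\<lambda>x. f x + g x) \<in> L2 \<rho>"
proof -
  have "integrable \<rho> (\<lambda>x. (f x)\<^sup>2 + 2 * (f x * g x) + (g x)\<^sup>2)"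
    using assms L2_inner_integrable[OF assms] by (auto simp: L2_def)
  also have "(\<lambda>x. (f x)\<^sup>2 + 2 * (f x * g x) + (g x)\<^sup>2) = (\<lambda>x. (f x + g x)\<^sup>2)"
    by (simp add: power2_sum fun_eq_iff)
  finally show ?thesis using assms[THEN L2_measurable] by (simp add: L2_def borel_measurable_add)
qed

lemma L2_scale: "f \<in> L2 \<rho> \<Longrightarrow> (\<lambda>x. c * f x) \<in> L2 \<rho>"
  by (simp add: L2_def power_mult_distrib borel_measurable_times)

lemma L2_sum: "finite I \<Longrightarrow> (\<And>i. i \<in> I \<Longrightarrow> u i \<in> L2 \<rho>) \<Longrightarrow> (\<lambda>x. \<Sum>i\<in>I. u i x) \<in> L2 \<rho>"
proof (induction I rule: finite_induct)
  case empty
  show ?case by (simp add: L2_def)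
qed (simp add: L2_add)

lemma L2_Cauchy_Schwarz:
  assumes f: "f \<in> L2 \<rho>" and g: "g \<in> L2 \<rho>"
  shows "(L2_inner \<rho> f g)\<^sup>2 \<le> (\<integral>x. (f x)\<^sup>2 \<partial>\<rho>) * (\<integral>x. (g x)\<^sup>2 \<partial>\<rho>)"
proof -
  let ?F = "\<integral>x. (f x)\<^sup>2 \<partial>\<rho>" and ?G = "\<integral>x. (g x)\<^sup>2 \<partial>\<rho>" and ?c = "L2_inner \<rho> f g"
  have int: "integrable \<rho> (\<lambda>x. (f x)\<^sup>2)" "integrable \<rho> (\<lambda>x. (g x)\<^sup>2)" "integrable \<rho> (\<lambda>x. f x * g x)"
    using f g L2_inner_integrable[OF f g] by (auto simp: L2_def)
  have quad: "0 \<le> s\<^sup>2 * ?F - 2 * s * t * ?c + t\<^sup>2 * ?G" for s t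
  proof -
    have "0 \<le> (\<integral>x. (s * f x - t * g x)\<^sup>2 \<partial>\<rho>)" by simp
    also have "\<dots> = (\<integral>x. s\<^sup>2 * (f x)\<^sup>2 - 2 * s * t * (f x * g x) + t\<^sup>2 * (g x)\<^sup>2 \<partial>\<rho>)"
      by (intro Bochner_Integration.integral_cong) (auto simp: power2_eq_square algebra_simps)
    finally show ?thesis using int by (simp add: L2_inner_def)
  qed
  have F: "0 \<le> ?F" by simp
  show ?thesis
  proof (cases "?F = 0")
    case True
    have le: "?c * s \<le> ?G / 2" for s
      using quad[of s 1] True by (simp add: mult_ac)
    have "?c = 0"
    proof (rule ccontr)
      assume "?c \<noteq> 0"
      then have "?G + 1 \<le> ?G / 2" using le[of "(?G + 1) / ?c"] by simp
      moreover have "0 \<le> ?G" by simp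
      ultimately show False by linarith
    qed
    then show ?thesis using True by simp
  next
    case False
    \<comment> \<open>for t = ?F the form is smallest at s = ?c\<close>
    then have "0 \<le> ?F * (?F * ?G - ?c\<^sup>2)"
      using quad[of ?c ?F] by (simp add: power2_eq_square algebra_simps)
    then show ?thesis using False F by (simp add: zero_le_mult_iff)
  qed
qed

lemma L2_sums_inner:
  assumes h: "h \<in> L2 \<rho>" and sums: "L2_sums \<rho> u g"
  shows "(\<lambda>j. L2_inner \<rho> h (u j)) sums L2_inner \<rho> h g"
proof -
  have u: "\<And>j. u j \<in> L2 \<rho>" and g: "g \<in> L2 \<rho>"
    and lim: "(\<lambda>N. \<integral>x. (g x - (\<Sum>j<N. u j x))\<^sup>2 \<partial>\<rho>) \<longlonglongrightarrow> 0"
    using sums by (auto simp: L2_sums_def)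
  let ?d = "\<lambda>N x. g x - (\<Sum>j<N. u j x)"
  have d: "?d N \<in> L2 \<rho>" for N
    using L2_add[OF g L2_scale[of _ _ "-1", OF L2_sum[of "{..<N}" u]]] u by simp
  have "L2_inner \<rho> h (?d N) = L2_inner \<rho> h g - (\<Sum>j<N. L2_inner \<rho> h (u j))" for N
    using L2_inner_integrable[OF h g] L2_inner_integrable[OF h u]
    by (simp add: L2_inner_def right_diff_distrib sum_distrib_left)
  moreover have "(\<lambda>N. L2_inner \<rho> h (?d N)) \<longlonglongrightarrow> 0"
  proof -
    have "(\<lambda>N. (L2_inner \<rho> h (?d N))\<^sup>2) \<longlonglongrightarrow> 0"
    proof (rule tendsto_sandwich[OF _ _ tendsto_const])
      show "(\<lambda>N. (\<integral>x. (h x)\<^sup>2 \<partial>\<rho>) * (\<integral>x. (?d N x)\<^sup>2 \<partial>\<rho>)) \<longlonglongrightarrow> 0"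
        using tendsto_mult_left[OF lim, of "\<integral>x. (h x)\<^sup>2 \<partial>\<rho>"] by simp
    qed (use L2_Cauchy_Schwarz[OF h d] in auto)
    from tendsto_real_sqrt[OF this] show ?thesis by (simp add: tendsto_rabs_zero_iff)
  qed
  ultimately have "(\<lambda>N. L2_inner \<rho> h g - (\<Sum>j<N. L2_inner \<rho> h (u j))) \<longlonglongrightarrow> 0" by simp
  from tendsto_diff[OF tendsto_const[of "L2_inner \<rho> h g"] this] show ?thesis
    by (simp add: sums_def)
qed

text \<open>
  Points with the same index lie in the same half-open dyadic cube of side \<open>1 / 2 ^ m\<close>.
\<close>

definition cell_index :: "nat \<Rightarrow> real ^ 'd \<Rightarrow> int ^ 'd" where
  "cell_index m x = (\<chi> i. \<lfloor>2 ^ m * x $ i\<rfloor>)"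

definition cell :: "(real ^ 'd) measure \<Rightarrow> nat \<Rightarrow> real ^ 'd \<Rightarrow> (real ^ 'd) set" where
  "cell \<rho> m x = {y \<in> space \<rho>. cell_index m y = cell_index m x}"

text \<open>
  The density of \<open>\<rho>\<close> conditioned on the cell of \<open>x\<close>; it is \<open>0\<close> on a cell of mass \<open>0\<close>, because
  \<open>a / 0 = 0\<close>.
\<close>

definition cell_density :: "(real ^ 'd) measure \<Rightarrow> nat \<Rightarrow> real ^ 'd \<Rightarrow> real ^ 'd \<Rightarrow> real" where
  "cell_density \<rho> m x y = indicator (cell \<rho> m x) y / measure \<rho> (cell \<rho> m x)"

definition cell_average :: "(real ^ 'd) measure \<Rightarrow> nat \<Rightarrow> (real ^ 'd \<Rightarrow> real) \<Rightarrow> real ^ 'd \<Rightarrow> real" where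
  "cell_average \<rho> m h x = L2_inner \<rho> (cell_density \<rho> m x) h"

lemma same_cell_dist_le:
  fixes x y :: "real ^ 'd"
  assumes "cell_index m y = cell_index m x"
  shows "dist y x \<le> CARD('d) * (1 / 2) ^ m"
proof -
  have "\<bar>(y - x) $ i\<bar> \<le> (1 / 2) ^ m" for i
  proof -
    have "\<lfloor>2 ^ m * y $ i\<rfloor> = \<lfloor>2 ^ m * x $ i\<rfloor>"
      using assms by (simp add: cell_index_def vec_eq_iff)
    then have "\<bar>2 ^ m * y $ i - 2 ^ m * x $ i\<bar> \<le> 1" by linarith
    then have "2 ^ m * \<bar>(y - x) $ i\<bar> \<le> 1"
      by (simp add: abs_mult flip: right_diff_distrib)
    then show ?thesis by (simp add: field_simps)
  qed
  then have "(\<Sum>i\<in>UNIV. \<bar>(y - x) $ i\<bar>) \<le> (\<Sum>i\<in>(UNIV :: 'd set). (1 / 2) ^ m)"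
    by (intro sum_mono)
  then show ?thesis using norm_le_l1_cart[of "y - x"] by (simp add: dist_norm)
qed

lemma eventually_cell_subset_ball:
  fixes x :: "real ^ 'd"
  assumes "0 < e"
  shows "eventually (\<lambda>m. \<forall>y\<in>cell \<rho> m x. dist y x < e) sequentially"
proof -
  have "(\<lambda>m. real CARD('d) * (1 / 2) ^ m) \<longlonglongrightarrow> real CARD('d) * 0"
    by (intro tendsto_intros LIMSEQ_power_zero) auto
  then have "eventually (\<lambda>m. CARD('d) * (1 / 2) ^ m < e) sequentially"
    using assms by (intro order_tendstoD(2)) auto
  then show ?thesis
    by eventually_elim (auto simp: cell_def dest!: same_cell_dist_le)
qed

context
  fixes \<rho> :: "(real ^ 'd) measure" and S :: "(real ^ 'd) set"
  assumes fin: "finite_measure \<rho>" and sets: "sets \<rho> = sets (restrict_space borel S)"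
begin

interpretation finite_measure \<rho> by (rule fin)

lemma space_eq: "space \<rho> = S"
  using sets_eq_imp_space_eq[OF sets] by (simp add: space_restrict_space)

lemma borel_measurable_restrict: "f \<in> borel_measurable (restrict_space borel S) \<Longrightarrow> f \<in> borel_measurable \<rho>"
  using measurable_cong_sets[OF sets refl] by blast

lemma measurable_cell_index: "cell_index m \<in> measurable \<rho> (count_space UNIV)"
proof -
  have comp: "(\<lambda>x. x $ i) \<in> borel_measurable \<rho>" for i
    by (intro borel_measurable_restrict measurable_restrict_space1) (intro borel_measurable_continuous_onI continuous_intros)
  have "cell_index m -` {c} \<inter> space \<rho> = {x \<in> space \<rho>. \<forall>i. \<lfloor>2 ^ m * x $ i\<rfloor> = c $ i}" for c
    by (auto simp: cell_index_def vec_eq_iff)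
  moreover have "{x \<in> space \<rho>. \<forall>i. \<lfloor>2 ^ m * x $ i\<rfloor> = c $ i} \<in> sets \<rho>" for c
    using comp by measurable
  ultimately show ?thesis
    by (subst measurable_count_space_eq2_countable) auto
qed

lemma sets_cell: "cell \<rho> m x \<in> sets \<rho>"
proof -
  have "cell \<rho> m x = cell_index m -` {cell_index m x} \<inter> space \<rho>" by (auto simp: cell_def)
  then show ?thesis using measurable_sets[OF measurable_cell_index] by simp
qed

text \<open>
  Each level has only countably many cells, so those of mass \<open>0\<close> form a null set.
\<close>

lemma AE_cell_pos: "AE x in \<rho>. \<forall>m. 0 < measure \<rho> (cell \<rho> m x)"
proof (subst AE_all_countable, intro allI)
  fix m
  let ?C = "\<lambda>c. cell_index m -` {c} \<inter> space \<rho>"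
  have "AE x in \<rho>. \<forall>c. x \<in> ?C c \<longrightarrow> 0 < measure \<rho> (?C c)"
  proof (subst AE_all_countable, intro allI)
    fix c
    have C: "?C c \<in> sets \<rho>" using measurable_sets[OF measurable_cell_index] by simp
    show "AE x in \<rho>. x \<in> ?C c \<longrightarrow> 0 < measure \<rho> (?C c)"
    proof (cases "measure \<rho> (?C c) = 0")
      case True
      then have "?C c \<in> null_sets \<rho>" using C by (auto simp: null_sets_def emeasure_eq_measure)
      then have "AE x in \<rho>. x \<notin> ?C c" by (rule AE_not_in)
      then show ?thesis by eventually_elim auto
    next
      case False
      then show ?thesis by (simp add: zero_less_measure_iff)
    qed
  qed
  with AE_space show "AE x in \<rho>. 0 < measure \<rho> (cell \<rho> m x)"
  proof eventually_elim
    case (elim x)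
    moreover have "cell \<rho> m x = ?C (cell_index m x)" by (auto simp: cell_def)
    ultimately show ?case by simp
  qed
qed

lemma cell_density_L2: "cell_density \<rho> m x \<in> L2 \<rho>"
proof -
  have "(cell_density \<rho> m x y)\<^sup>2 = indicator (cell \<rho> m x) y * (1 / measure \<rho> (cell \<rho> m x))\<^sup>2" for y
    by (auto simp: cell_density_def indicator_def)
  moreover have "cell_density \<rho> m x \<in> borel_measurable \<rho>"
    unfolding cell_density_def using sets_cell by simp
  ultimately show ?thesis
    using sets_cell by (simp add: L2_def emeasure_finite less_top[symmetric])
qed

lemma integral_cell_density_mult:
  "(\<integral>y. cell_density \<rho> m x y * c \<partial>\<rho>) = (if measure \<rho> (cell \<rho> m x) = 0 then 0 else c)"
  "integrable \<rho> (\<lambda>y. cell_density \<rho> m x y * c)"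
  using sets_cell by (auto simp: cell_density_def less_top[symmetric] Int_absorb1[OF sets.sets_into_space])

lemma cell_density_average_approx:
  assumes pos: "0 < measure \<rho> (cell \<rho> m x)" and g: "g \<in> borel_measurable \<rho>"
    and close: "\<And>y. y \<in> cell \<rho> m x \<Longrightarrow> \<bar>g y - a\<bar> \<le> e"
  shows "\<bar>(\<integral>y. cell_density \<rho> m x y * g y \<partial>\<rho>) - a\<bar> \<le> e"
proof -
  let ?d = "cell_density \<rho> m x"
  have d0: "0 \<le> ?d y" for y by (simp add: cell_density_def)
  have le: "\<bar>?d y * (g y - a)\<bar> \<le> ?d y * e" for y
    using close[of y] d0[of y] by (cases "y \<in> cell \<rho> m x") (auto simp: abs_mult cell_density_def divide_right_mono)
  have int: "integrable \<rho> (\<lambda>y. ?d y * (g y - a))"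
    using le by (intro Bochner_Integration.integrable_bound[OF integral_cell_density_mult(2)[of m x e]])
      (auto intro!: borel_measurable_times L2_measurable[OF cell_density_L2] borel_measurable_diff g
        intro: order_trans[OF le abs_ge_self])
  have "(\<integral>y. ?d y * g y \<partial>\<rho>) = (\<integral>y. ?d y * (g y - a) + ?d y * a \<partial>\<rho>)"
    by (intro Bochner_Integration.integral_cong) (auto simp: algebra_simps)
  also have "\<dots> = (\<integral>y. ?d y * (g y - a) \<partial>\<rho>) + a"
    using int integral_cell_density_mult[of m x a] pos by simp
  finally have "\<bar>(\<integral>y. ?d y * g y \<partial>\<rho>) - a\<bar> = \<bar>\<integral>y. ?d y * (g y - a) \<partial>\<rho>\<bar>" by simp
  also have "\<dots> \<le> (\<integral>y. \<bar>?d y * (g y - a)\<bar> \<partial>\<rho>)" by (rule integral_abs_bound)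
  also have "\<dots> \<le> (\<integral>y. ?d y * e \<partial>\<rho>)"
    using int le by (intro integral_mono integrable_abs integral_cell_density_mult(2)) auto
  also have "\<dots> = e" using integral_cell_density_mult(1)[of m x e] pos by simp
  finally show ?thesis .
qed

lemma cell_average_measurable: "cell_average \<rho> m h \<in> borel_measurable \<rho>"
proof -
  \<comment> \<open>the average factors through the cell index, which takes countably many values\<close>
  define A where "A c = {y \<in> space \<rho>. cell_index m y = c}" for c
  define G where "G c = L2_inner \<rho> (\<lambda>y. indicator (A c) y / measure \<rho> (A c)) h" for c
  have "cell_average \<rho> m h = (\<lambda>x. G (cell_index m x))"
    by (simp add: fun_eq_iff cell_average_def G_def A_def cell_def cell_density_def[abs_def])
  then show ?thesis
    using measurable_compose[OF measurable_cell_index, of G borel] by simp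
qed

text \<open>
  Cauchy-Schwarz against the cell density. The form multiplied by the mass of the cell also covers
  cells of mass \<open>0\<close>.
\<close>

lemma cell_average_square_le:
  assumes h: "h \<in> L2 \<rho>"
  shows "measure \<rho> (cell \<rho> m x) * (cell_average \<rho> m h x)\<^sup>2 \<le> (\<integral>y. indicator (cell \<rho> m x) y * (h y)\<^sup>2 \<partial>\<rho>)"
proof (cases "measure \<rho> (cell \<rho> m x) = 0")
  case False
  let ?C = "cell \<rho> m x" and ?d = "cell_density \<rho> m x"
  have p: "0 < measure \<rho> ?C" using False by (simp add: zero_less_measure_iff)
  let ?h = "\<lambda>y. indicator ?C y * h y"
  have sq: "(?h y)\<^sup>2 = indicator ?C y * (h y)\<^sup>2" for y by (simp add: indicator_def)
  have "integrable \<rho> (\<lambda>y. indicator ?C y * (h y)\<^sup>2)"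
    using integrable_mult_indicator[OF sets_cell L2_integrable_square[OF h]] by simp
  then have hC: "?h \<in> L2 \<rho>"
    using L2_measurable[OF h] sets_cell by (simp add: L2_def sq)
  have "cell_average \<rho> m h x = L2_inner \<rho> ?d ?h"
    unfolding cell_average_def L2_inner_def
    by (intro Bochner_Integration.integral_cong) (auto simp: cell_density_def indicator_def)
  then have "(cell_average \<rho> m h x)\<^sup>2 \<le> (\<integral>y. (?d y)\<^sup>2 \<partial>\<rho>) * (\<integral>y. indicator ?C y * (h y)\<^sup>2 \<partial>\<rho>)"
    using L2_Cauchy_Schwarz[OF cell_density_L2 hC] by (simp add: sq)
  also have "(\<integral>y. (?d y)\<^sup>2 \<partial>\<rho>) = (\<integral>y. ?d y * (1 / measure \<rho> ?C) \<partial>\<rho>)"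
    by (intro Bochner_Integration.integral_cong) (auto simp: cell_density_def indicator_def power2_eq_square)
  also have "\<dots> = 1 / measure \<rho> ?C"
    using integral_cell_density_mult(1)[of m x "1 / measure \<rho> ?C"] p by simp
  finally show ?thesis using p by (simp add: field_simps)
qed simp

lemma nn_integral_split_cells:
  assumes f: "f \<in> borel_measurable \<rho>"
  shows "(\<integral>\<^sup>+x. f x \<partial>\<rho>)
    = (\<integral>\<^sup>+c. \<integral>\<^sup>+x. f x * indicator (cell_index m -` {c} \<inter> space \<rho>) x \<partial>\<rho> \<partial>count_space UNIV)"
proof -
  let ?C = "\<lambda>c. cell_index m -` {c} \<inter> space \<rho>"
  have "(\<integral>\<^sup>+x. f x \<partial>\<rho>) = (\<integral>\<^sup>+x. \<integral>\<^sup>+c. f x * indicator (?C c) x \<partial>count_space UNIV \<partial>\<rho>)"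
  proof (rule nn_integral_cong)
    fix x assume "x \<in> space \<rho>"
    then have "(\<integral>\<^sup>+c. f x * indicator (?C c) x \<partial>count_space UNIV)
        = (\<integral>\<^sup>+c. f x * indicator {cell_index m x} c \<partial>count_space UNIV)"
      by (intro nn_integral_cong) (auto simp: indicator_def)
    then show "f x = (\<integral>\<^sup>+c. f x * indicator (?C c) x \<partial>count_space UNIV)"
      by (simp add: nn_integral_cmult)
  qed
  also have "\<dots> = (\<integral>\<^sup>+c. \<integral>\<^sup>+x. f x * indicator (?C c) x \<partial>\<rho> \<partial>count_space UNIV)"
    using f measurable_sets[OF measurable_cell_index]
    by (intro nn_integral_count_space_nn_integral) auto
  finally show ?thesis .
qed

lemma nn_integral_cell_average_square_le:
  assumes h: "h \<in> L2 \<rho>"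
  shows "(\<integral>\<^sup>+x. ennreal ((cell_average \<rho> m h x)\<^sup>2) \<partial>\<rho>) \<le> (\<integral>\<^sup>+x. ennreal ((h x)\<^sup>2) \<partial>\<rho>)"
proof -
  let ?C = "\<lambda>c. cell_index m -` {c} \<inter> space \<rho>"
  have C: "?C c \<in> sets \<rho>" for c using measurable_sets[OF measurable_cell_index] by simp
  have hC: "integrable \<rho> (\<lambda>y. indicator (?C c) y * (h y)\<^sup>2)" for c
    using integrable_mult_indicator[OF C L2_integrable_square[OF h]] by simp
  have cell: "(\<integral>\<^sup>+x. ennreal ((cell_average \<rho> m h x)\<^sup>2) * indicator (?C c) x \<partial>\<rho>)
      \<le> (\<integral>\<^sup>+x. ennreal ((h x)\<^sup>2) * indicator (?C c) x \<partial>\<rho>)" for c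
  proof (cases "?C c = {}")
    case False
    then obtain z where z: "z \<in> space \<rho>" "cell_index m z = c" by auto
    have Cz: "cell \<rho> m x = ?C c" if "x \<in> ?C c" for x using that by (auto simp: cell_def)
    have avg: "cell_average \<rho> m h x = cell_average \<rho> m h z" if "x \<in> ?C c" for x
      using Cz[OF that] Cz[of z] z by (simp add: cell_average_def cell_density_def[abs_def])
    have "(\<integral>\<^sup>+x. ennreal ((cell_average \<rho> m h x)\<^sup>2) * indicator (?C c) x \<partial>\<rho>)
        = (\<integral>\<^sup>+x. ennreal ((cell_average \<rho> m h z)\<^sup>2) * indicator (?C c) x \<partial>\<rho>)"
      by (intro nn_integral_cong) (auto simp: indicator_def avg)
    also have "\<dots> = ennreal (measure \<rho> (?C c) * (cell_average \<rho> m h z)\<^sup>2)"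
      using C by (simp add: nn_integral_cmult_indicator emeasure_eq_measure ennreal_mult mult.commute)
    also have "\<dots> \<le> ennreal (\<integral>y. indicator (?C c) y * (h y)\<^sup>2 \<partial>\<rho>)"
      using cell_average_square_le[OF h, of m z] Cz[of z] z by (intro ennreal_leI) auto
    also have "\<dots> = (\<integral>\<^sup>+y. ennreal (indicator (?C c) y * (h y)\<^sup>2) \<partial>\<rho>)"
      by (intro nn_integral_eq_integral[symmetric] hC) auto
    also have "\<dots> = (\<integral>\<^sup>+x. ennreal ((h x)\<^sup>2) * indicator (?C c) x \<partial>\<rho>)"
      by (intro nn_integral_cong) (auto simp: indicator_def)
    finally show ?thesis .
  qed simp
  show ?thesis
    using L2_measurable[OF h] cell_average_measurable[of m h]
    by (subst (1 2) nn_integral_split_cells[where m = m]) (auto intro!: nn_integral_mono cell)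
qed

text \<open>
  The kernel is averaged over the cell of \<open>x'\<close> inside the operator and over the cell of \<open>x\<close> outside;
  once both cells are small, all the values of \<open>K\<close> involved are close to \<open>K x x'\<close>.
\<close>

lemma kernel_cell_average_tendsto:
  assumes K: "continuous_on (S \<times> S) (\<lambda>(x, y). K x y)" and x: "x \<in> S" "x' \<in> S"
    and op: "\<And>m. kernel_operator \<rho> K (cell_density \<rho> m x') \<in> borel_measurable \<rho>"
    and pos: "\<And>m. 0 < measure \<rho> (cell \<rho> m x)" "\<And>m. 0 < measure \<rho> (cell \<rho> m x')"
  shows "(\<lambda>m. cell_average \<rho> m (kernel_operator \<rho> K (cell_density \<rho> m x')) x) \<longlonglongrightarrow> K x x'"
proof (rule LIMSEQ_I)
  fix e :: real assume e: "0 < e"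
  obtain d where d: "0 < d"
    and Kd: "\<And>y z. y \<in> S \<Longrightarrow> z \<in> S \<Longrightarrow> dist (y, z) (x, x') < d \<Longrightarrow> \<bar>K y z - K x x'\<bar> < e / 2"
    using K[unfolded continuous_on_iff, rule_format, of "(x, x')" "e / 2"] x e
    by (auto simp: dist_real_def)
  have "eventually (\<lambda>m. \<forall>y\<in>cell \<rho> m x. dist y x < d / 2) sequentially"
    "eventually (\<lambda>m. \<forall>y\<in>cell \<rho> m x'. dist y x' < d / 2) sequentially"
    by (rule eventually_cell_subset_ball, use d in simp)+
  then have "eventually (\<lambda>m. norm (cell_average \<rho> m (kernel_operator \<rho> K (cell_density \<rho> m x')) x - K x x') < e) sequentially"
  proof eventually_elim
    case (elim m)
    have close: "\<bar>K y z - K x x'\<bar> \<le> e / 2" if "y \<in> cell \<rho> m x" "z \<in> cell \<rho> m x'" for y z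
    proof -
      have "dist (y, z) (x, x') \<le> dist y x + dist z x'"
        by (simp add: dist_Pair_Pair sqrt_sum_squares_le_sum)
      also have "\<dots> < d" using elim that by force
      finally show ?thesis using Kd[of y z] that by (auto simp: cell_def space_eq)
    qed
    have "\<bar>kernel_operator \<rho> K (cell_density \<rho> m x') y - K x x'\<bar> \<le> e / 2" if y: "y \<in> cell \<rho> m x" for y
    proof -
      have "continuous_on S (\<lambda>z. (y, z))" by (intro continuous_intros)
      from continuous_on_compose2[OF K this] y have "continuous_on S (K y)"
        by (auto simp: cell_def space_eq)
      then have "K y \<in> borel_measurable \<rho>"
        by (intro borel_measurable_restrict borel_measurable_continuous_on_restrict)
      from cell_density_average_approx[OF pos(2) this close[OF y]]
      show ?thesis by (simp add: kernel_operator_def mult.commute)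
    qed
    from cell_density_average_approx[OF pos(1) op this]
    have "\<bar>cell_average \<rho> m (kernel_operator \<rho> K (cell_density \<rho> m x')) x - K x x'\<bar> \<le> e / 2"
      by (simp add: cell_average_def L2_inner_def)
    then show ?case using e by simp
  qed
  then show "\<exists>N. \<forall>m\<ge>N. norm (cell_average \<rho> m (kernel_operator \<rho> K (cell_density \<rho> m x')) x - K x x') < e"
    by (simp add: eventually_sequentially)
qed

text \<open>
  Pairing the \<open>L2\<close> expansion with the density of a cell turns it into a convergent series of numbers,
  one for every pair of points.
\<close>

lemma kernel_cell_average_sums:
  assumes "kernel_eigen_decomposition \<rho> K eigval \<phi>"
  shows "(\<lambda>j. eigval j * cell_average \<rho> m (\<phi> j) x * cell_average \<rho> m (\<phi> j) x')
    sums cell_average \<rho> m (kernel_operator \<rho> K (cell_density \<rho> m x')) x"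
proof -
  have "L2_sums \<rho> (\<lambda>j y. eigval j * L2_inner \<rho> (\<phi> j) (cell_density \<rho> m x') * \<phi> j y)
      (kernel_operator \<rho> K (cell_density \<rho> m x'))"
    using assms cell_density_L2 by (auto simp: kernel_eigen_decomposition_def)
  from L2_sums_inner[OF cell_density_L2[of m x] this]
  have "(\<lambda>j. L2_inner \<rho> (cell_density \<rho> m x) (\<lambda>y. eigval j * L2_inner \<rho> (\<phi> j) (cell_density \<rho> m x') * \<phi> j y))
    sums cell_average \<rho> m (kernel_operator \<rho> K (cell_density \<rho> m x')) x"
    by (simp add: cell_average_def)
  moreover have "L2_inner \<rho> (cell_density \<rho> m x) (\<lambda>y. eigval j * L2_inner \<rho> (\<phi> j) (cell_density \<rho> m x') * \<phi> j y)
      = eigval j * cell_average \<rho> m (\<phi> j) x * cell_average \<rho> m (\<phi> j) x'" for j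
  proof -
    have "L2_inner \<rho> (\<phi> j) (cell_density \<rho> m x') = cell_average \<rho> m (\<phi> j) x'"
      by (simp add: cell_average_def L2_inner_def mult.commute)
    moreover have "L2_inner \<rho> (cell_density \<rho> m x) (\<lambda>y. c * \<phi> j y) = c * cell_average \<rho> m (\<phi> j) x" for c
      unfolding L2_inner_def cell_average_def mult.left_commute[of "cell_density \<rho> m x _"]
      by simp
    ultimately show ?thesis by simp
  qed
  ultimately show ?thesis by simp
qed

end

section \<open>Noise that is centered given the design\<close>

lemma (in prob_space) finite_measure_subalgebra_vimage:
  assumes "X \<in> measurable M N"
  shows "finite_measure_subalgebra M (vimage_algebra (space M) X N)"
proof
  show "subalgebra M (vimage_algebra (space M) X N)"
    using measurable_space[OF assms]
    by (auto simp: subalgebra_def sets_vimage_algebra2 Pi_iff intro!: measurable_sets[OF assms])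
qed

text \<open>
  By independence the joint law of \<open>V\<close> and \<open>Z\<close> is a product. For fixed \<open>z\<close> the factor \<open>h (u V, z)\<close> is
  a function of \<open>u V\<close>, given which \<open>\<eta> V\<close> has mean \<open>0\<close>; so the inner integral in Fubini's theorem
  vanishes for almost every \<open>z\<close>.
\<close>

lemma (in prob_space) expectation_mult_centered_eq_0:
  assumes indep: "indep_var A V B Z"
    and u: "u \<in> measurable A C" and \<eta>: "\<eta> \<in> borel_measurable A" and h: "h \<in> borel_measurable (C \<Otimes>\<^sub>M B)"
    and centered: "AE \<omega> in M. real_cond_exp M (vimage_algebra (space M) (\<lambda>\<omega>. u (V \<omega>)) C) (\<lambda>\<omega>. \<eta> (V \<omega>)) \<omega> = 0"
    and int: "integrable M (\<lambda>\<omega>. h (u (V \<omega>), Z \<omega>) * \<eta> (V \<omega>))"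
  shows "(\<integral>\<omega>. h (u (V \<omega>), Z \<omega>) * \<eta> (V \<omega>) \<partial>M) = 0"
proof -
  have V: "V \<in> measurable M A" and Z: "Z \<in> measurable M B"
    and joint: "distr M A V \<Otimes>\<^sub>M distr M B Z = distr M (A \<Otimes>\<^sub>M B) (\<lambda>\<omega>. (V \<omega>, Z \<omega>))"
    using indep unfolding indep_var_distribution_eq by auto
  interpret V: prob_space "distr M A V" by (rule prob_space_distr) fact
  interpret Z: prob_space "distr M B Z" by (rule prob_space_distr) fact
  interpret VZ: pair_prob_space "distr M A V" "distr M B Z" ..
  define g where "g v z = h (u v, z) * \<eta> v" for v z
  have g: "case_prod g \<in> borel_measurable (A \<Otimes>\<^sub>M B)"
    unfolding g_def using u \<eta> h by measurable
  have VZm: "(\<lambda>\<omega>. (V \<omega>, Z \<omega>)) \<in> measurable M (A \<Otimes>\<^sub>M B)" using V Z by measurable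
  have int_g: "integrable (distr M A V \<Otimes>\<^sub>M distr M B Z) (case_prod g)"
    unfolding joint using int g VZm by (subst integrable_distr_eq) (auto simp: g_def)
  let ?F = "vimage_algebra (space M) (\<lambda>\<omega>. u (V \<omega>)) C"
  have uV: "(\<lambda>\<omega>. u (V \<omega>)) \<in> measurable M C" using u V by measurable
  interpret F: finite_measure_subalgebra M ?F by (rule finite_measure_subalgebra_vimage[OF uV])
  have inner: "(\<integral>v. g v z \<partial>distr M A V) = 0" if z: "z \<in> space B" and "integrable (distr M A V) (\<lambda>v. g v z)" for z
  proof -
    have gz: "(\<lambda>v. g v z) \<in> borel_measurable A"
      using g z by measurable
    have int_z: "integrable M (\<lambda>\<omega>. h (u (V \<omega>), z) * \<eta> (V \<omega>))"
      using that(2) gz V by (subst (asm) integrable_distr_eq) (auto simp: g_def)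
    have "(\<lambda>c. h (c, z)) \<in> borel_measurable C" using h z by measurable
    moreover have "(\<lambda>\<omega>. u (V \<omega>)) \<in> measurable ?F C"
      using measurable_space[OF uV] by (intro measurable_vimage_algebra1) auto
    ultimately have hz: "(\<lambda>\<omega>. h (u (V \<omega>), z)) \<in> borel_measurable ?F"
      by measurable
    have eV: "(\<lambda>\<omega>. \<eta> (V \<omega>)) \<in> borel_measurable M" using \<eta> V by measurable
    have "(\<integral>v. g v z \<partial>distr M A V) = (\<integral>\<omega>. h (u (V \<omega>), z) * \<eta> (V \<omega>) \<partial>M)"
      using gz V by (subst integral_distr) (auto simp: g_def)
    also have "\<dots> = (\<integral>\<omega>. h (u (V \<omega>), z) * real_cond_exp M ?F (\<lambda>\<omega>. \<eta> (V \<omega>)) \<omega> \<partial>M)"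
      by (rule F.real_cond_exp_intg(2)[OF int_z hz eV, symmetric])
    also have "\<dots> = (\<integral>\<omega>. 0 \<partial>M)"
      using centered hz by (intro integral_cong_AE)
        (auto intro!: borel_measurable_times measurable_from_subalg[OF F.subalg])
    finally show ?thesis by simp
  qed
  have "(\<integral>\<omega>. h (u (V \<omega>), Z \<omega>) * \<eta> (V \<omega>) \<partial>M) = (\<integral>p. case_prod g p \<partial>distr M (A \<Otimes>\<^sub>M B) (\<lambda>\<omega>. (V \<omega>, Z \<omega>)))"
    using g VZm by (subst integral_distr) (auto simp: g_def)
  also have "\<dots> = (\<integral>z. (\<integral>v. g v z \<partial>distr M A V) \<partial>distr M B Z)"
    unfolding joint[symmetric] by (rule VZ.integral_snd[OF int_g, symmetric])
  also have "\<dots> = (\<integral>z. 0 \<partial>distr M B Z)"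
  proof (rule integral_cong_AE)
    show "AE z in distr M B Z. (\<integral>v. g v z \<partial>distr M A V) = 0"
      using VZ.AE_integrable_snd[OF int_g] AE_space by eventually_elim (use inner in auto)
    show "(\<lambda>z. \<integral>v. g v z \<partial>distr M A V) \<in> borel_measurable (distr M B Z)"
      using g by measurable
  qed simp
  finally show ?thesis by simp
qed

locale regression_sample = prob_space M for M :: "'w measure" +
  fixes N :: "'a measure" and I :: "'i set" and X :: "'i \<Rightarrow> 'w \<Rightarrow> 'a" and Y :: "'i \<Rightarrow> 'w \<Rightarrow> real"
    and f :: "'a \<Rightarrow> real" and \<sigma> :: real
  assumes finite_I: "finite I"
    and X: "\<And>i. i \<in> I \<Longrightarrow> X i \<in> measurable M N"
    and Y: "\<And>i. i \<in> I \<Longrightarrow> Y i \<in> borel_measurable M"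
    and indep: "indep_vars (\<lambda>_. N \<Otimes>\<^sub>M borel) (\<lambda>i \<omega>. (X i \<omega>, Y i \<omega>)) I"
    and f: "f \<in> borel_measurable N"
    and noise_square_integrable: "\<And>i. i \<in> I \<Longrightarrow> integrable M (\<lambda>\<omega>. (Y i \<omega> - f (X i \<omega>))\<^sup>2)"
    and noise_mean: "\<And>i. i \<in> I \<Longrightarrow>
           AE \<omega> in M. real_cond_exp M (vimage_algebra (space M) (X i) N) (\<lambda>\<omega>'. Y i \<omega>' - f (X i \<omega>')) \<omega> = 0"
    and noise_variance: "\<And>i. i \<in> I \<Longrightarrow>
           AE \<omega> in M. real_cond_exp M (vimage_algebra (space M) (X i) N) (\<lambda>\<omega>'. (Y i \<omega>' - f (X i \<omega>'))\<^sup>2) \<omega> = \<sigma>\<^sup>2"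
begin

definition design :: "'w \<Rightarrow> 'i \<Rightarrow> 'a" where
  "design \<omega> = (\<lambda>i\<in>I. X i \<omega>)"

definition noise :: "'i \<Rightarrow> 'w \<Rightarrow> real" where
  "noise i \<omega> = Y i \<omega> - f (X i \<omega>)"

lemma design_measurable: "design \<in> measurable M (PiM I (\<lambda>_. N))"
  unfolding design_def using X by (rule measurable_restrict)

lemma noise_measurable: "i \<in> I \<Longrightarrow> noise i \<in> borel_measurable M"
  unfolding noise_def[abs_def] using Y measurable_compose[OF X f] by simp

text \<open>
  The whole design is a function of \<open>X j\<close> and of the observations other than \<open>j\<close>, which are
  independent of observation \<open>j\<close>. The factor \<open>w\<close> admits the noise of another observation.
\<close>

lemma expectation_design_mult_centered:
  assumes j: "j \<in> I" and \<eta>: "\<eta> \<in> borel_measurable (N \<Otimes>\<^sub>M borel)"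
    and c: "c \<in> borel_measurable (PiM I (\<lambda>_. N))"
    and w: "w \<in> borel_measurable (PiM (I - {j}) (\<lambda>_. N \<Otimes>\<^sub>M borel))"
    and centered: "AE \<omega> in M. real_cond_exp M (vimage_algebra (space M) (X j) N) (\<lambda>\<omega>. \<eta> (X j \<omega>, Y j \<omega>)) \<omega> = 0"
    and int: "integrable M (\<lambda>\<omega>. c (design \<omega>) * w (\<lambda>i\<in>I - {j}. (X i \<omega>, Y i \<omega>)) * \<eta> (X j \<omega>, Y j \<omega>))"
  shows "(\<integral>\<omega>. c (design \<omega>) * w (\<lambda>i\<in>I - {j}. (X i \<omega>, Y i \<omega>)) * \<eta> (X j \<omega>, Y j \<omega>) \<partial>M) = 0"
proof -
  let ?Z = "\<lambda>\<omega>. \<lambda>i\<in>I - {j}. (X i \<omega>, Y i \<omega>)" and ?B = "PiM (I - {j}) (\<lambda>_. N \<Otimes>\<^sub>M borel)"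
  have ind: "indep_var (PiM {j} (\<lambda>_. N \<Otimes>\<^sub>M borel)) (\<lambda>\<omega>. \<lambda>i\<in>{j}. (X i \<omega>, Y i \<omega>)) ?B ?Z"
    using j by (intro indep_var_restrict[OF indep]) auto
  have pj: "(\<lambda>p. p j) \<in> measurable (PiM {j} (\<lambda>_. N \<Otimes>\<^sub>M borel)) (N \<Otimes>\<^sub>M borel)"
    by (rule measurable_component_singleton) simp
  \<comment> \<open>assembles the design from X j and the other observations\<close>
  define join where "join p = (\<lambda>i\<in>I. if i = j then fst p else fst (snd p i))" for p :: "'a \<times> ('i \<Rightarrow> 'a \<times> real)"
  have join: "join \<in> measurable (N \<Otimes>\<^sub>M ?B) (PiM I (\<lambda>_. N))"
    unfolding join_def
  proof (rule measurable_restrict)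
    fix i assume "i \<in> I"
    show "(\<lambda>p. if i = j then fst p else fst (snd p i)) \<in> measurable (N \<Otimes>\<^sub>M ?B) N"
    proof (cases "i = j")
      case False
      with \<open>i \<in> I\<close> have i: "i \<in> I - {j}" by simp
      have "(\<lambda>z. z i) \<in> measurable ?B (N \<Otimes>\<^sub>M borel)" using i by (rule measurable_component_singleton)
      then have "(\<lambda>p. fst (snd p i)) \<in> measurable (N \<Otimes>\<^sub>M ?B) N" by measurable
      then show ?thesis using False by simp
    qed simp
  qed
  have join_eq: "join (X j \<omega>, ?Z \<omega>) = design \<omega>" for \<omega>
    by (auto simp: join_def design_def restrict_def)
  have h: "(\<lambda>p. c (join p) * w (snd p)) \<in> borel_measurable (N \<Otimes>\<^sub>M ?B)"
    using measurable_compose[OF join c] w by measurable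
  show ?thesis
    using expectation_mult_centered_eq_0[OF ind measurable_compose[OF pj measurable_fst]
        measurable_compose[OF pj \<eta>] h] centered int
    by (simp add: join_eq)
qed

context
  fixes b :: "('i \<Rightarrow> 'a) \<Rightarrow> real" and s :: "'i \<Rightarrow> ('i \<Rightarrow> 'a) \<Rightarrow> real"
  assumes b: "b \<in> borel_measurable (PiM I (\<lambda>_. N))"
    and s: "\<And>j. j \<in> I \<Longrightarrow> s j \<in> borel_measurable (PiM I (\<lambda>_. N))"
    and s_le: "\<And>j \<omega>. j \<in> I \<Longrightarrow> \<omega> \<in> space M \<Longrightarrow> \<bar>s j (design \<omega>)\<bar> \<le> 1"
    and b_int: "integrable M (\<lambda>\<omega>. (b (design \<omega>))\<^sup>2)"
begin

lemma offset_measurable: "(\<lambda>\<omega>. b (design \<omega>)) \<in> borel_measurable M"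
  by (rule measurable_compose[OF design_measurable b])

lemma weight_measurable: "j \<in> I \<Longrightarrow> (\<lambda>\<omega>. s j (design \<omega>)) \<in> borel_measurable M"
  by (rule measurable_compose[OF design_measurable s])

lemma cross_integrable:
  assumes j: "j \<in> I"
  shows "integrable M (\<lambda>\<omega>. b (design \<omega>) * s j (design \<omega>) * noise j \<omega>)"
proof (rule Bochner_Integration.integrable_bound)
  show "integrable M (\<lambda>\<omega>. (b (design \<omega>))\<^sup>2 + (noise j \<omega>)\<^sup>2)"
    using b_int noise_square_integrable[OF j] by (simp add: noise_def)
  show "AE \<omega> in M. norm (b (design \<omega>) * s j (design \<omega>) * noise j \<omega>) \<le> norm ((b (design \<omega>))\<^sup>2 + (noise j \<omega>)\<^sup>2)"
  proof (rule AE_I2)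
    fix \<omega> assume "\<omega> \<in> space M"
    then have "\<bar>s j (design \<omega>)\<bar> * \<bar>b (design \<omega>) * noise j \<omega>\<bar> \<le> 1 * ((b (design \<omega>))\<^sup>2 + (noise j \<omega>)\<^sup>2)"
      using s_le[OF j] by (intro mult_mono abs_mult_le_sum_squares) auto
    then show "norm (b (design \<omega>) * s j (design \<omega>) * noise j \<omega>) \<le> norm ((b (design \<omega>))\<^sup>2 + (noise j \<omega>)\<^sup>2)"
      by (simp add: abs_mult mult_ac)
  qed
qed (use offset_measurable weight_measurable noise_measurable j in measurable)

lemma noise_product_integrable:
  assumes j: "j \<in> I" and k: "k \<in> I"
  shows "integrable M (\<lambda>\<omega>. s j (design \<omega>) * s k (design \<omega>) * (noise j \<omega> * noise k \<omega>))"
proof (rule Bochner_Integration.integrable_bound)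
  show "integrable M (\<lambda>\<omega>. (noise j \<omega>)\<^sup>2 + (noise k \<omega>)\<^sup>2)"
    using noise_square_integrable j k by (simp add: noise_def)
  show "AE \<omega> in M. norm (s j (design \<omega>) * s k (design \<omega>) * (noise j \<omega> * noise k \<omega>))
      \<le> norm ((noise j \<omega>)\<^sup>2 + (noise k \<omega>)\<^sup>2)"
  proof (rule AE_I2)
    fix \<omega> assume \<omega>: "\<omega> \<in> space M"
    have "\<bar>s j (design \<omega>)\<bar> * \<bar>s k (design \<omega>)\<bar> \<le> 1 * 1"
      using s_le[OF j \<omega>] s_le[OF k \<omega>] by (intro mult_mono) auto
    then have "\<bar>s j (design \<omega>)\<bar> * \<bar>s k (design \<omega>)\<bar> * \<bar>noise j \<omega> * noise k \<omega>\<bar>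
        \<le> 1 * ((noise j \<omega>)\<^sup>2 + (noise k \<omega>)\<^sup>2)"
      by (intro mult_mono abs_mult_le_sum_squares) auto
    then show "norm (s j (design \<omega>) * s k (design \<omega>) * (noise j \<omega> * noise k \<omega>))
        \<le> norm ((noise j \<omega>)\<^sup>2 + (noise k \<omega>)\<^sup>2)"
      by (simp add: abs_mult mult_ac)
  qed
qed (use weight_measurable noise_measurable j k in measurable)

lemma expectation_cross:
  assumes j: "j \<in> I"
  shows "(\<integral>\<omega>. b (design \<omega>) * s j (design \<omega>) * noise j \<omega> \<partial>M) = 0"
proof -
  have \<eta>: "(\<lambda>p. snd p - f (fst p)) \<in> borel_measurable (N \<Otimes>\<^sub>M borel)" using f by measurable
  have c: "(\<lambda>x. b x * s j x) \<in> borel_measurable (PiM I (\<lambda>_. N))" using b s[OF j] by measurable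
  show ?thesis
    using expectation_design_mult_centered[OF j \<eta> c, of "\<lambda>_. 1"] noise_mean[OF j] cross_integrable[OF j]
    by (simp add: noise_def)
qed

lemma expectation_noise_product:
  assumes j: "j \<in> I" and k: "k \<in> I" and "j \<noteq> k"
  shows "(\<integral>\<omega>. s j (design \<omega>) * s k (design \<omega>) * (noise j \<omega> * noise k \<omega>) \<partial>M) = 0"
proof -
  have \<eta>: "(\<lambda>p. snd p - f (fst p)) \<in> borel_measurable (N \<Otimes>\<^sub>M borel)" using f by measurable
  have c: "(\<lambda>x. s j x * s k x) \<in> borel_measurable (PiM I (\<lambda>_. N))" using s[OF j] s[OF k] by measurable
  have kj: "k \<in> I - {j}" using assms by simp
  have "(\<lambda>z. z k) \<in> measurable (PiM (I - {j}) (\<lambda>_. N \<Otimes>\<^sub>M borel)) (N \<Otimes>\<^sub>M borel)"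
    using kj by (rule measurable_component_singleton)
  then have w: "(\<lambda>z. snd (z k) - f (fst (z k))) \<in> borel_measurable (PiM (I - {j}) (\<lambda>_. N \<Otimes>\<^sub>M borel))"
    using \<eta> by (rule measurable_compose)
  have "(\<integral>\<omega>. s j (design \<omega>) * s k (design \<omega>) * noise k \<omega> * noise j \<omega> \<partial>M) = 0"
    using expectation_design_mult_centered[OF j \<eta> c w] noise_mean[OF j] noise_product_integrable[OF j k] kj
    by (simp add: noise_def mult_ac)
  then show ?thesis by (simp add: mult_ac)
qed

lemma expectation_noise_square:
  assumes j: "j \<in> I"
  shows "(\<integral>\<omega>. s j (design \<omega>) * s j (design \<omega>) * (noise j \<omega> * noise j \<omega>) \<partial>M)
    = \<sigma>\<^sup>2 * (\<integral>\<omega>. (s j (design \<omega>))\<^sup>2 \<partial>M)"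
proof -
  have \<eta>: "(\<lambda>p. (snd p - f (fst p))\<^sup>2 - \<sigma>\<^sup>2) \<in> borel_measurable (N \<Otimes>\<^sub>M borel)" using f by measurable
  have c: "(\<lambda>x. s j x * s j x) \<in> borel_measurable (PiM I (\<lambda>_. N))" using s[OF j] by measurable
  let ?F = "vimage_algebra (space M) (X j) N"
  interpret F: finite_measure_subalgebra M ?F by (rule finite_measure_subalgebra_vimage[OF X[OF j]])
  have centered: "AE \<omega> in M. real_cond_exp M ?F (\<lambda>\<omega>. (Y j \<omega> - f (X j \<omega>))\<^sup>2 - \<sigma>\<^sup>2) \<omega> = 0"
  proof -
    have "AE \<omega> in M. real_cond_exp M ?F (\<lambda>\<omega>. (Y j \<omega> - f (X j \<omega>))\<^sup>2 - \<sigma>\<^sup>2) \<omega>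
        = real_cond_exp M ?F (\<lambda>\<omega>. (Y j \<omega> - f (X j \<omega>))\<^sup>2) \<omega> - real_cond_exp M ?F (\<lambda>\<omega>. \<sigma>\<^sup>2) \<omega>"
      by (rule F.real_cond_exp_diff) (use noise_square_integrable[OF j] in auto)
    moreover have "AE \<omega> in M. real_cond_exp M ?F (\<lambda>\<omega>. \<sigma>\<^sup>2) \<omega> = \<sigma>\<^sup>2"
      by (rule F.real_cond_exp_F_meas) auto
    ultimately show ?thesis
      using noise_variance[OF j] by eventually_elim simp
  qed
  have s2: "integrable M (\<lambda>\<omega>. (s j (design \<omega>))\<^sup>2)"
    using s_le[OF j] weight_measurable[OF j] by (intro integrable_const_bound[where B = 1] AE_I2) (auto simp: abs_square_le_1)
  have n2: "integrable M (\<lambda>\<omega>. s j (design \<omega>) * s j (design \<omega>) * (noise j \<omega> * noise j \<omega>))"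
    by (rule noise_product_integrable[OF j j])
  have "(\<integral>\<omega>. s j (design \<omega>) * s j (design \<omega>) * (noise j \<omega> * noise j \<omega>) - \<sigma>\<^sup>2 * (s j (design \<omega>))\<^sup>2 \<partial>M)
      = (\<integral>\<omega>. s j (design \<omega>) * s j (design \<omega>) * ((noise j \<omega>)\<^sup>2 - \<sigma>\<^sup>2) \<partial>M)"
    by (intro Bochner_Integration.integral_cong) (auto simp: power2_eq_square algebra_simps)
  also have "\<dots> = 0"
  proof -
    have "integrable M (\<lambda>\<omega>. s j (design \<omega>) * s j (design \<omega>) * (noise j \<omega> * noise j \<omega>) - \<sigma>\<^sup>2 * (s j (design \<omega>))\<^sup>2)"
      using s2 n2 by simp
    then have "integrable M (\<lambda>\<omega>. s j (design \<omega>) * s j (design \<omega>) * ((noise j \<omega>)\<^sup>2 - \<sigma>\<^sup>2))"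
      by (simp add: power2_eq_square right_diff_distrib mult_ac)
    then show ?thesis
      using expectation_design_mult_centered[OF j \<eta> c, of "\<lambda>_. 1"] centered by (simp add: noise_def)
  qed
  finally show ?thesis using s2 n2 by simp
qed

text \<open>
  Expanding the square leaves, besides the offset, only the diagonal noise terms: a noise variable
  times a function of the design, or times another noise variable, has expectation \<open>0\<close>.
\<close>

lemma expectation_linear_smoother_square:
  "integrable M (\<lambda>\<omega>. (b (design \<omega>) + (\<Sum>j\<in>I. s j (design \<omega>) * noise j \<omega>))\<^sup>2)"
  "(\<integral>\<omega>. (b (design \<omega>) + (\<Sum>j\<in>I. s j (design \<omega>) * noise j \<omega>))\<^sup>2 \<partial>M)
    = (\<integral>\<omega>. (b (design \<omega>))\<^sup>2 \<partial>M) + \<sigma>\<^sup>2 * (\<Sum>j\<in>I. \<integral>\<omega>. (s j (design \<omega>))\<^sup>2 \<partial>M)"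
proof -
  let ?b = "\<lambda>\<omega>. b (design \<omega>)" and ?s = "\<lambda>j \<omega>. s j (design \<omega>)"
  have expand: "(?b \<omega> + (\<Sum>j\<in>I. ?s j \<omega> * noise j \<omega>))\<^sup>2 = (?b \<omega>)\<^sup>2 + 2 * (\<Sum>j\<in>I. ?b \<omega> * ?s j \<omega> * noise j \<omega>)
      + (\<Sum>j\<in>I. \<Sum>k\<in>I. ?s j \<omega> * ?s k \<omega> * (noise j \<omega> * noise k \<omega>))" for \<omega>
    by (simp add: power2_sum power2_eq_square[of "\<Sum>j\<in>I. _ j"] sum_product sum_distrib_left mult_ac)
  show "integrable M (\<lambda>\<omega>. (?b \<omega> + (\<Sum>j\<in>I. ?s j \<omega> * noise j \<omega>))\<^sup>2)"
    unfolding expand using b_int cross_integrable noise_product_integrable by simp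
  have "(\<integral>\<omega>. (?b \<omega> + (\<Sum>j\<in>I. ?s j \<omega> * noise j \<omega>))\<^sup>2 \<partial>M) = (\<integral>\<omega>. (?b \<omega>)\<^sup>2 \<partial>M)
      + 2 * (\<Sum>j\<in>I. \<integral>\<omega>. ?b \<omega> * ?s j \<omega> * noise j \<omega> \<partial>M)
      + (\<Sum>j\<in>I. \<Sum>k\<in>I. \<integral>\<omega>. ?s j \<omega> * ?s k \<omega> * (noise j \<omega> * noise k \<omega>) \<partial>M)"
    unfolding expand using b_int cross_integrable noise_product_integrable by simp
  also have "(\<Sum>j\<in>I. \<integral>\<omega>. ?b \<omega> * ?s j \<omega> * noise j \<omega> \<partial>M) = 0"
    by (simp add: expectation_cross)
  also have "(\<Sum>j\<in>I. \<Sum>k\<in>I. \<integral>\<omega>. ?s j \<omega> * ?s k \<omega> * (noise j \<omega> * noise k \<omega>) \<partial>M)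
      = (\<Sum>j\<in>I. \<Sum>k\<in>I. if k = j then \<sigma>\<^sup>2 * (\<integral>\<omega>. (?s j \<omega>)\<^sup>2 \<partial>M) else 0)"
    using expectation_noise_product expectation_noise_square by (intro sum.cong refl) auto
  also have "\<dots> = \<sigma>\<^sup>2 * (\<Sum>j\<in>I. \<integral>\<omega>. (?s j \<omega>)\<^sup>2 \<partial>M)"
    using finite_I by (simp add: sum_distrib_left)
  finally show "(\<integral>\<omega>. (?b \<omega> + (\<Sum>j\<in>I. ?s j \<omega> * noise j \<omega>))\<^sup>2 \<partial>M)
    = (\<integral>\<omega>. (?b \<omega>)\<^sup>2 \<partial>M) + \<sigma>\<^sup>2 * (\<Sum>j\<in>I. \<integral>\<omega>. (?s j \<omega>)\<^sup>2 \<partial>M)" by simp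
qed

end

end

section \<open>The trace of the smoother on a fixed design\<close>

text \<open>
  An orthonormal family indexed by the coordinates is complete, as a one-sided inverse of a square
  matrix is two-sided.
\<close>

lemma orthonormal_system_inner:
  fixes u :: "'d::finite \<Rightarrow> real ^ 'd"
  assumes on: "\<And>j k. u j \<bullet> u k = (if j = k then 1 else 0)"
  shows "x \<bullet> y = (\<Sum>k\<in>UNIV. (x \<bullet> u k) * (y \<bullet> u k))"
proof -
  define P :: "real ^ 'd ^ 'd" where "P = (\<chi> k i. u k $ i)"
  have "P ** transpose P = mat 1"
    using on by (simp add: vec_eq_iff matrix_matrix_mult_def transpose_def P_def mat_def inner_vec_def)
  then have 1: "transpose P ** P = mat 1" by (simp add: matrix_left_right_inverse)
  have Pv: "(P *v v) $ k = v \<bullet> u k" for v k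
    by (simp add: P_def matrix_vector_mult_def inner_vec_def mult.commute)
  have "x \<bullet> y = x \<bullet> (transpose P *v (P *v y))"
    by (simp add: matrix_vector_mul_assoc 1)
  also have "\<dots> = (P *v x) \<bullet> (P *v y)"
    by (simp add: dot_lmul_matrix flip: vector_transpose_matrix)
  also have "\<dots> = (\<Sum>k\<in>UNIV. (x \<bullet> u k) * (y \<bullet> u k))"
    by (simp add: inner_vec_def[of "P *v x"] Pv)
  finally show ?thesis .
qed

lemma suminf_ennreal_of_sums:
  assumes "f sums s" "\<And>j. 0 \<le> f j"
  shows "(\<Sum>j. ennreal (f j)) = ennreal s"
  using assms by (metis suminf_ennreal2 sums_summable sums_unique)

lemma ennreal_add_le: "ennreal (a + b) \<le> ennreal a + ennreal b"
  by (cases "0 \<le> a"; cases "0 \<le> b") (auto simp: ennreal_neg intro!: ennreal_leI simp flip: ennreal_plus)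

lemma quadratic_form_perturbation:
  fixes A B :: "'i \<Rightarrow> 'i \<Rightarrow> real"
  assumes "finite I" and close: "\<And>i j. i \<in> I \<Longrightarrow> j \<in> I \<Longrightarrow> \<bar>A i j - B i j\<bar> \<le> e" and e: "0 \<le> e"
  shows "(\<Sum>i\<in>I. \<Sum>j\<in>I. u i * u j * A i j) \<le> (\<Sum>i\<in>I. \<Sum>j\<in>I. u i * u j * B i j) + e * real (card I) * (\<Sum>i\<in>I. (u i)\<^sup>2)"
proof -
  have "u i * u j * A i j \<le> u i * u j * B i j + e * (\<bar>u i\<bar> * \<bar>u j\<bar>)" if "i \<in> I" "j \<in> I" for i j
  proof -
    have "u i * u j * (A i j - B i j) \<le> \<bar>u i\<bar> * \<bar>u j\<bar> * \<bar>A i j - B i j\<bar>"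
      using abs_ge_self[of "u i * u j * (A i j - B i j)"] by (simp add: abs_mult)
    also have "\<dots> \<le> \<bar>u i\<bar> * \<bar>u j\<bar> * e" using close[OF that] by (intro mult_left_mono) auto
    finally show ?thesis by (simp add: algebra_simps)
  qed
  then have "(\<Sum>i\<in>I. \<Sum>j\<in>I. u i * u j * A i j) \<le> (\<Sum>i\<in>I. \<Sum>j\<in>I. u i * u j * B i j + e * (\<bar>u i\<bar> * \<bar>u j\<bar>))"
    by (intro sum_mono) auto
  also have "\<dots> = (\<Sum>i\<in>I. \<Sum>j\<in>I. u i * u j * B i j) + e * (\<Sum>i\<in>I. \<bar>u i\<bar>)\<^sup>2"
    unfolding power2_eq_square sum_product by (simp add: sum.distrib sum_distrib_left)
  also have "(\<Sum>i\<in>I. \<bar>u i\<bar>)\<^sup>2 \<le> card I * (\<Sum>i\<in>I. (u i)\<^sup>2)"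
    using Cauchy_Schwarz_ineq_sum[of "\<lambda>_. 1" "\<lambda>i. \<bar>u i\<bar>" I] by simp
  finally show ?thesis using e by (simp add: mult_left_mono mult.assoc)
qed

context
  fixes S :: "(real ^ 'd) set" and K H ip and mu lam :: real and x :: "nat \<Rightarrow> real ^ 'd" and n :: nat
  assumes rkhs: "rkhs S K H ip" and mu: "0 < mu" and lam: "0 < lam" and n: "n \<ge> 1"
    and x: "\<And>i. i \<in> {1..n} \<Longrightarrow> x i \<in> S"
begin

interpretation rkhs S K H ip by (rule rkhs)

interpretation ridge_smoother "{1..n}" "ridge_gram mu lam K x" "smoother_matrix n (ridge_gram mu lam K x) n" n
  by (rule ridge_smoother_ridge_gram[OF rkhs mu lam n x])

text \<open>
  The linear kernel is the sum of the rank one kernels \<open>(x \<bullet> u k) * (y \<bullet> u k)\<close>, each dominated by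
  the Gram matrix.
\<close>

lemma linear_resolvent_trace_le:
  fixes u :: "'d \<Rightarrow> real ^ 'd"
  assumes on: "\<And>j k. u j \<bullet> u k = (if j = k then 1 else 0)"
  defines "a \<equiv> \<lambda>k. (\<Sum>i\<in>{1..n}. (x i \<bullet> u k)\<^sup>2) / n / mu"
  shows "resolvent_trace (\<lambda>i j. x i \<bullet> x j / mu) \<le> (\<Sum>k\<in>UNIV. a k / (1 + a k))"
proof -
  define p where "p k i = x i \<bullet> u k / sqrt mu" for k i
  have "resolvent_trace (\<lambda>i j. x i \<bullet> x j / mu) = resolvent_trace (\<lambda>i j. \<Sum>k\<in>UNIV. p k i * p k j)"
    using mu by (intro resolvent_trace_cong)
      (subst orthonormal_system_inner[OF on], simp add: p_def sum_divide_distrib)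
  also have "\<dots> = (\<Sum>k\<in>UNIV. resolvent_form (p k))"
    by (simp add: resolvent_trace_sum resolvent_trace_rank_one)
  also have "\<dots> \<le> (\<Sum>k\<in>UNIV. a k / (1 + a k))"
  proof (rule sum_mono)
    fix k
    have "(\<Sum>i\<in>{1..n}. (p k i)\<^sup>2) / n = a k"
      using mu by (simp add: a_def p_def power_divide sum_divide_distrib divide_divide_eq_left mult.commute)
    moreover have "(\<Sum>i\<in>{1..n}. p k i * c i)\<^sup>2 \<le> (\<Sum>i\<in>{1..n}. \<Sum>j\<in>{1..n}. c i * c j * ridge_gram mu lam K x i j)" for c
    proof -
      let ?v = "\<Sum>i\<in>{1..n}. c i *\<^sub>R x i"
      have "(\<Sum>i\<in>{1..n}. p k i * c i) = (?v \<bullet> u k) / sqrt mu"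
        by (simp add: inner_sum_left p_def sum_divide_distrib mult.commute)
      then have "(\<Sum>i\<in>{1..n}. p k i * c i)\<^sup>2 = (?v \<bullet> u k)\<^sup>2 / mu"
        using mu by (simp add: power_divide)
      also have "\<dots> \<le> (norm ?v)\<^sup>2 / mu"
        using Cauchy_Schwarz_ineq[of ?v "u k"] on[of k k] mu
        by (intro divide_right_mono) (auto simp: power2_norm_eq_inner)
      also have "\<dots> \<le> (\<Sum>i\<in>{1..n}. \<Sum>j\<in>{1..n}. c i * c j * ridge_gram mu lam K x i j)"
        using kernel_form_nonneg[of "{1..n}" x c] x lam unfolding ridge_gram_form by simp
      finally show ?thesis .
    qed
    ultimately show "resolvent_form (p k) \<le> a k / (1 + a k)"
      using resolvent_form_le_ratio[of "p k"] by simp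
  qed
  finally show ?thesis .
qed

text \<open>
  A rank one summand \<open>q q\<^sup>T\<close> of the approximating matrix \<open>A m / lam\<close> need not be dominated by \<open>G\<close>. But
  once every entry of \<open>A m\<close> is within \<open>lam\<close> of the kernel matrix, the two quadratic forms, divided
  by \<open>lam\<close>, differ by at most \<open>n \<bar>u\<bar>\<^sup>2\<close>, which is exactly the room left by \<open>resolvent_form_le_1\<close>
  with \<open>\<nu> = n\<close>.
\<close>

lemma kernel_resolvent_trace_le:
  assumes eig: "\<And>j. 0 \<le> eigval j"
    and sums: "\<And>m i i'. i \<in> {1..n} \<Longrightarrow> i' \<in> {1..n} \<Longrightarrow> (\<lambda>j. eigval j * p m j i * p m j i') sums A m i i'"
    and lim: "\<And>i i'. i \<in> {1..n} \<Longrightarrow> i' \<in> {1..n} \<Longrightarrow> (\<lambda>m. A m i i') \<longlonglongrightarrow> K (x i) (x i')"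
  shows "ennreal (resolvent_trace (\<lambda>i j. K (x i) (x j) / lam))
    \<le> liminf (\<lambda>m. \<Sum>j. min 1 (ennreal (eigval j / lam * ((\<Sum>i\<in>{1..n}. (p m j i)\<^sup>2) / n))))"
proof -
  \<comment> \<open>the features of the approximating matrix\<close>
  define q where "q m j i = sqrt (eigval j / lam) * p m j i" for m j i
  have qq: "q m j i * q m j i' = eigval j * p m j i * p m j i' / lam" for m j i i'
  proof -
    have "sqrt (eigval j / lam) * sqrt (eigval j / lam) = eigval j / lam"
      using eig[of j] lam by simp
    then have "q m j i * q m j i' = eigval j / lam * (p m j i * p m j i')"
      unfolding q_def by (metis (no_types, lifting) mult.assoc mult.commute)
    then show ?thesis by simp
  qed
  have q_sums: "(\<lambda>j. q m j i * q m j i') sums (A m i i' / lam)" if "i \<in> {1..n}" "i' \<in> {1..n}" for m i i'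
    unfolding qq by (intro sums_divide sums that)
  have rf_sums: "(\<lambda>j. resolvent_form (q m j)) sums resolvent_trace (\<lambda>i i'. A m i i' / lam)" for m
    unfolding resolvent_trace_rank_one[symmetric] by (rule resolvent_trace_sums) (rule q_sums)
  have T: "(\<lambda>m. resolvent_trace (\<lambda>i i'. A m i i' / lam)) \<longlonglongrightarrow> resolvent_trace (\<lambda>i j. K (x i) (x j) / lam)"
    using lam by (intro resolvent_trace_tendsto tendsto_divide lim tendsto_const) auto
  have "eventually (\<lambda>m. \<bar>A m i i' - K (x i) (x i')\<bar> \<le> lam) sequentially" if "i \<in> {1..n}" "i' \<in> {1..n}" for i i'
    using tendstoD[OF lim[OF that] lam] by eventually_elim (simp add: dist_real_def)
  then have "eventually (\<lambda>m. \<forall>i\<in>{1..n}. \<forall>i'\<in>{1..n}. \<bar>A m i i' - K (x i) (x i')\<bar> \<le> lam) sequentially"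
    by (intro eventually_ball_finite ballI) auto
  then have "eventually (\<lambda>m. ennreal (resolvent_trace (\<lambda>i i'. A m i i' / lam))
     \<le> (\<Sum>j. min 1 (ennreal (eigval j / lam * ((\<Sum>i\<in>{1..n}. (p m j i)\<^sup>2) / n))))) sequentially"
  proof eventually_elim
    case (elim m)
    have "resolvent_form (q m j) \<le> 1" for j
    proof (rule resolvent_form_le_1)
      fix c
      have "(\<Sum>i\<in>{1..n}. q m j i * c i)\<^sup>2 = (\<Sum>i\<in>{1..n}. \<Sum>i'\<in>{1..n}. c i * c i' * (q m j i * q m j i'))" for j
        by (simp add: power2_eq_square sum_product mult_ac)
      moreover have "(\<lambda>j. \<Sum>i\<in>{1..n}. \<Sum>i'\<in>{1..n}. c i * c i' * (q m j i * q m j i')) sums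
          (\<Sum>i\<in>{1..n}. \<Sum>i'\<in>{1..n}. c i * c i' * (A m i i' / lam))"
        by (intro sums_sum sums_mult q_sums)
      ultimately have sq: "(\<lambda>j. (\<Sum>i\<in>{1..n}. q m j i * c i)\<^sup>2) sums
          (\<Sum>i\<in>{1..n}. \<Sum>i'\<in>{1..n}. c i * c i' * (A m i i' / lam))" by simp
      have "(\<Sum>i\<in>{1..n}. q m j i * c i)\<^sup>2 \<le> (\<Sum>i\<in>{1..n}. \<Sum>i'\<in>{1..n}. c i * c i' * (A m i i' / lam))"
        using sum_le_suminf[OF sums_summable[OF sq], of "{j}"] sums_unique[OF sq] by simp
      also have "\<dots> \<le> (\<Sum>i\<in>{1..n}. \<Sum>i'\<in>{1..n}. c i * c i' * (K (x i) (x i') / lam))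
          + 1 * real (card {1..n}) * (\<Sum>i\<in>{1..n}. (c i)\<^sup>2)"
      proof (rule quadratic_form_perturbation)
        fix i j assume "i \<in> {1..n}" "j \<in> {1..n}"
        then have "\<bar>A m i j - K (x i) (x j)\<bar> / lam \<le> 1" using elim lam by (simp add: field_simps)
        then show "\<bar>A m i j / lam - K (x i) (x j) / lam\<bar> \<le> 1"
          using lam by (simp add: abs_divide flip: diff_divide_distrib)
      qed auto
      also have "(\<Sum>i\<in>{1..n}. \<Sum>i'\<in>{1..n}. c i * c i' * (K (x i) (x i') / lam))
          \<le> (\<Sum>i\<in>{1..n}. \<Sum>j\<in>{1..n}. c i * c j * ridge_gram mu lam K x i j)"
        unfolding ridge_gram_form using mu by (simp add: sum_divide_distrib)
      finally show "(\<Sum>i\<in>{1..n}. q m j i * c i)\<^sup>2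
          \<le> (\<Sum>i\<in>{1..n}. \<Sum>j\<in>{1..n}. c i * c j * ridge_gram mu lam K x i j) + real n * (\<Sum>i\<in>{1..n}. (c i)\<^sup>2)"
        by simp
    qed
    moreover have "resolvent_form (q m j) \<le> eigval j / lam * ((\<Sum>i\<in>{1..n}. (p m j i)\<^sup>2) / n)" for j
    proof -
      have "(\<Sum>i\<in>{1..n}. (q m j i)\<^sup>2) / n = eigval j / lam * ((\<Sum>i\<in>{1..n}. (p m j i)\<^sup>2) / n)"
        unfolding q_def power_mult_distrib sum_distrib_left[symmetric] using eig[of j] lam by simp
      then show ?thesis using resolvent_form_le_energy[of "q m j"] by simp
    qed
    ultimately have "ennreal (resolvent_form (q m j)) \<le> min 1 (ennreal (eigval j / lam * ((\<Sum>i\<in>{1..n}. (p m j i)\<^sup>2) / n)))" for j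
      by (metis ennreal_leI ennreal_1 min.bounded_iff)
    then have "(\<Sum>j. ennreal (resolvent_form (q m j)))
        \<le> (\<Sum>j. min 1 (ennreal (eigval j / lam * ((\<Sum>i\<in>{1..n}. (p m j i)\<^sup>2) / n))))"
      by (intro suminf_le) auto
    then show ?case
      by (simp add: suminf_ennreal_of_sums[OF rf_sums resolvent_form_nonneg])
  qed
  from Liminf_mono[OF this] show ?thesis
    using lim_imp_Liminf[OF _ tendsto_ennrealI[OF T]] by simp
qed

lemma smoother_trace_le:
  fixes u :: "'d \<Rightarrow> real ^ 'd"
  assumes on: "\<And>j k. u j \<bullet> u k = (if j = k then 1 else 0)"
    and eig: "\<And>j. 0 \<le> eigval j"
    and sums: "\<And>m i i'. i \<in> {1..n} \<Longrightarrow> i' \<in> {1..n} \<Longrightarrow> (\<lambda>j. eigval j * p m j i * p m j i') sums A m i i'"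
    and lim: "\<And>i i'. i \<in> {1..n} \<Longrightarrow> i' \<in> {1..n} \<Longrightarrow> (\<lambda>m. A m i i') \<longlonglongrightarrow> K (x i) (x i')"
  defines "a \<equiv> \<lambda>k. (\<Sum>i\<in>{1..n}. (x i \<bullet> u k)\<^sup>2) / n / mu"
  shows "ennreal (\<Sum>i\<in>{1..n}. smoother_matrix n (ridge_gram mu lam K x) n i i)
    \<le> ennreal (\<Sum>k\<in>UNIV. a k / (1 + a k))
      + liminf (\<lambda>m. \<Sum>j. min 1 (ennreal (eigval j / lam * ((\<Sum>i\<in>{1..n}. (p m j i)\<^sup>2) / n))))"
proof -
  have "resolvent_trace (ridge_gram mu lam K x) = resolvent_trace (\<lambda>i j. x i \<bullet> x j / mu + K (x i) (x j) / lam)"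
    by (rule resolvent_trace_cong) (simp add: ridge_gram_def)
  then have eq: "(\<Sum>i\<in>{1..n}. smoother_matrix n (ridge_gram mu lam K x) n i i)
      = resolvent_trace (\<lambda>i j. x i \<bullet> x j / mu) + resolvent_trace (\<lambda>i j. K (x i) (x j) / lam)"
    by (rule trans[OF resolvent_trace_gram[symmetric] trans[OF _ resolvent_trace_add]])
  have "ennreal (\<Sum>i\<in>{1..n}. smoother_matrix n (ridge_gram mu lam K x) n i i)
      \<le> ennreal (resolvent_trace (\<lambda>i j. x i \<bullet> x j / mu)) + ennreal (resolvent_trace (\<lambda>i j. K (x i) (x j) / lam))"
    unfolding eq by (rule ennreal_add_le)
  also have "\<dots> \<le> ennreal (\<Sum>k\<in>UNIV. a k / (1 + a k))
      + liminf (\<lambda>m. \<Sum>j. min 1 (ennreal (eigval j / lam * ((\<Sum>i\<in>{1..n}. (p m j i)\<^sup>2) / n))))"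
    using ennreal_leI[OF linear_resolvent_trace_le[OF on]]
      kernel_resolvent_trace_le[of eigval p A, OF eig sums lim]
    unfolding a_def by (rule add_mono)
  finally show ?thesis .
qed

end

section \<open>The expected trace of the smoother\<close>

lemma second_moment_quadratic:
  fixes \<rho> :: "(real ^ 'd) measure"
  assumes m: "\<And>i. (\<lambda>x. x $ i) \<in> borel_measurable \<rho>" and int: "integrable \<rho> (\<lambda>x. (norm x)\<^sup>2)"
  shows "integrable \<rho> (\<lambda>x. (x \<bullet> u)\<^sup>2)" "(\<integral>x. (x \<bullet> u)\<^sup>2 \<partial>\<rho>) = u \<bullet> (second_moment_matrix \<rho> *v u)"
proof -
  have ij: "integrable \<rho> (\<lambda>x. x $ i * x $ j)" for i j
  proof (rule Bochner_Integration.integrable_bound[OF int])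
    show "(\<lambda>x. x $ i * x $ j) \<in> borel_measurable \<rho>" using m by measurable
    have "\<bar>x $ i\<bar> * \<bar>x $ j\<bar> \<le> norm x * norm x" for x :: "real ^ 'd"
      by (intro mult_mono component_le_norm_cart) auto
    then show "AE x in \<rho>. norm (x $ i * x $ j) \<le> norm ((norm x)\<^sup>2)"
      by (simp add: abs_mult power2_eq_square)
  qed
  have expand: "(x \<bullet> u)\<^sup>2 = (\<Sum>i\<in>UNIV. \<Sum>j\<in>UNIV. u $ i * u $ j * (x $ i * x $ j))" for x :: "real ^ 'd"
    by (simp add: inner_vec_def power2_eq_square sum_product mult_ac)
  show "integrable \<rho> (\<lambda>x. (x \<bullet> u)\<^sup>2)" unfolding expand using ij by simp
  show "(\<integral>x. (x \<bullet> u)\<^sup>2 \<partial>\<rho>) = u \<bullet> (second_moment_matrix \<rho> *v u)"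
  proof -
    have "(\<integral>x. (x \<bullet> u)\<^sup>2 \<partial>\<rho>) = (\<Sum>i\<in>UNIV. \<Sum>j\<in>UNIV. u $ i * u $ j * (\<integral>x. x $ i * x $ j \<partial>\<rho>))"
      unfolding expand using ij by simp
    also have "\<dots> = u \<bullet> (second_moment_matrix \<rho> *v u)"
      by (simp add: inner_vec_def matrix_vector_mult_def second_moment_matrix_def sum_distrib_left mult_ac)
    finally show ?thesis .
  qed
qed

text \<open>
  The tangent at \<open>t\<close> of a concave function; the gap is \<open>(a - t)\<^sup>2 / ((1 + a) * (1 + t)\<^sup>2)\<close>.
\<close>

lemma ratio_le_tangent:
  fixes a t :: real
  assumes "0 \<le> a" "0 \<le> t"
  shows "a / (1 + a) \<le> t / (1 + t) + (a - t) / (1 + t)\<^sup>2"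
proof -
  have "t / (1 + t) + (a - t) / (1 + t)\<^sup>2 - a / (1 + a) = (a - t)\<^sup>2 / ((1 + a) * (1 + t)\<^sup>2)"
  proof -
    have "1 + a \<noteq> 0" "1 + t \<noteq> 0" using assms by auto
    then show ?thesis by (simp add: divide_simps) (simp add: power2_eq_square algebra_simps)
  qed
  moreover have "0 \<le> (a - t)\<^sup>2 / ((1 + a) * (1 + t)\<^sup>2)" using assms by simp
  ultimately show ?thesis by linarith
qed

text \<open>
  Jensen's inequality for \<open>a / (1 + a)\<close>, by the tangent at the mean.
\<close>

lemma (in prob_space) expectation_ratio_le:
  assumes int: "integrable M a" and a: "\<And>\<omega>. 0 \<le> a \<omega>"
  shows "(\<integral>\<^sup>+\<omega>. ennreal (a \<omega> / (1 + a \<omega>)) \<partial>M) \<le> ennreal (expectation a / (1 + expectation a))"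
proof -
  let ?t = "expectation a"
  have t: "0 \<le> ?t" using a by simp
  let ?g = "\<lambda>\<omega>. ?t / (1 + ?t) + (a \<omega> - ?t) / (1 + ?t)\<^sup>2"
  have g: "a \<omega> / (1 + a \<omega>) \<le> ?g \<omega>" for \<omega> by (rule ratio_le_tangent[OF a t])
  have g0: "0 \<le> ?g \<omega>" for \<omega>
  proof -
    have "0 \<le> a \<omega> / (1 + a \<omega>)" using a[of \<omega>] by simp
    then show ?thesis using g[of \<omega>] by (rule order_trans)
  qed
  have "(\<integral>\<^sup>+\<omega>. ennreal (a \<omega> / (1 + a \<omega>)) \<partial>M) \<le> (\<integral>\<^sup>+\<omega>. ennreal (?g \<omega>) \<partial>M)"
    by (intro nn_integral_mono ennreal_leI g)
  also have "\<dots> = ennreal (\<integral>\<omega>. ?g \<omega> \<partial>M)"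
    using int g0 by (intro nn_integral_eq_integral) auto
  also have "(\<integral>\<omega>. ?g \<omega> \<partial>M) = ?t / (1 + ?t)"
    using int by (simp add: prob_space)
  finally show ?thesis .
qed

text \<open>
  The smoother involves the design points with index in \<open>{1..n}\<close> only, so it may be evaluated at a
  design that is restricted to these indices.
\<close>

lemma smoother_cong:
  assumes "\<And>i j. i \<in> {1..n} \<Longrightarrow> j \<in> {1..n} \<Longrightarrow> G i j = G' i j" and "i \<in> {1..n}" "j \<in> {1..n}"
  shows "smoother_matrix \<nu> G n i j = smoother_matrix \<nu> G' n i j"
proof -
  have "t \<le> n \<Longrightarrow> i \<in> {1..n} \<Longrightarrow> j \<in> {1..n} \<Longrightarrow> updated_kernel \<nu> G t i j = updated_kernel \<nu> G' t i j" for t i j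
  proof (induction t arbitrary: i j)
    case (Suc t)
    then have "Suc t \<in> {1..n}" "t \<le> n" by auto
    then show ?case using Suc.prems(2,3) by (simp add: Suc.IH)
  qed (use assms in simp)
  then show ?thesis using assms by (simp add: smoother_matrix_def)
qed

lemma smoother_measurable:
  assumes "\<And>i j. i \<in> {1..n} \<Longrightarrow> j \<in> {1..n} \<Longrightarrow> (\<lambda>\<omega>. G \<omega> i j) \<in> borel_measurable M"
    and "i \<in> {1..n}" "j \<in> {1..n}"
  shows "(\<lambda>\<omega>. smoother_matrix \<nu> (G \<omega>) n i j) \<in> borel_measurable M"
proof -
  have "t \<le> n \<Longrightarrow> i \<in> {1..n} \<Longrightarrow> j \<in> {1..n} \<Longrightarrow> (\<lambda>\<omega>. updated_kernel \<nu> (G \<omega>) t i j) \<in> borel_measurable M" for t i j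
  proof (induction t arbitrary: i j)
    case (Suc t)
    then have "Suc t \<in> {1..n}" "t \<le> n" by auto
    then have "(\<lambda>\<omega>. updated_kernel \<nu> (G \<omega>) t i j) \<in> borel_measurable M"
      "(\<lambda>\<omega>. updated_kernel \<nu> (G \<omega>) t i (Suc t)) \<in> borel_measurable M"
      "(\<lambda>\<omega>. updated_kernel \<nu> (G \<omega>) t (Suc t) j) \<in> borel_measurable M"
      "(\<lambda>\<omega>. updated_kernel \<nu> (G \<omega>) t (Suc t) (Suc t)) \<in> borel_measurable M"
      using Suc by auto
    then show ?case by simp
  qed (use assms in simp)
  then show ?thesis using assms by (simp add: smoother_matrix_def)
qed

lemma continuous_kernel_measurable:
  fixes K :: "real ^ 'd \<Rightarrow> real ^ 'd \<Rightarrow> real"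
  assumes K: "continuous_on (S \<times> S) (\<lambda>(x, y). K x y)"
    and f: "f \<in> measurable M (restrict_space borel S)" and g: "g \<in> measurable M (restrict_space borel S)"
  shows "(\<lambda>\<omega>. K (f \<omega>) (g \<omega>)) \<in> borel_measurable M"
proof -
  have "f \<in> borel_measurable M" "g \<in> borel_measurable M" "f \<in> space M \<rightarrow> S" "g \<in> space M \<rightarrow> S"
    using f g by (auto simp: measurable_restrict_space2_iff)
  then have "(\<lambda>\<omega>. (f \<omega>, g \<omega>)) \<in> measurable M (restrict_space borel (S \<times> S))"
    by (intro measurable_restrict_space2 borel_measurable_Pair) auto
  from measurable_compose[OF this borel_measurable_continuous_on_restrict[OF K]]
  show ?thesis by simp
qed

lemma ridge_gram_measurable:
  fixes K :: "real ^ 'd \<Rightarrow> real ^ 'd \<Rightarrow> real"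
  assumes K: "continuous_on (S \<times> S) (\<lambda>(x, y). K x y)"
    and X: "\<And>i. i \<in> I \<Longrightarrow> (\<lambda>\<omega>. X \<omega> i) \<in> measurable M (restrict_space borel S)" and ij: "i \<in> I" "j \<in> I"
  shows "(\<lambda>\<omega>. ridge_gram mu lam K (X \<omega>) i j) \<in> borel_measurable M"
proof -
  have "(\<lambda>\<omega>. X \<omega> i) \<in> borel_measurable M" "(\<lambda>\<omega>. X \<omega> j) \<in> borel_measurable M"
    using X ij by (auto simp: measurable_restrict_space2_iff)
  then show ?thesis
    unfolding ridge_gram_def using continuous_kernel_measurable[OF K X X] ij by measurable
qed

text \<open>
  Dividing \<open>min lam (eigval j)\<close> by \<open>lam\<close> produces the bound on the resolvent form of one
  eigenfunction.
\<close>

lemma kernel_complexity_square: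
  assumes "0 < lam" "\<And>j. 0 \<le> eigval j"
  shows "(kernel_complexity n eigval lam)\<^sup>2 / ennreal lam
    = ennreal (1 / real n) * (\<Sum>j. min 1 (ennreal (eigval j / lam)))"
proof -
  have sq: "(ennreal_sqrt z)\<^sup>2 = z" for z
    by (cases z) (auto simp: ennreal_sqrt_def power2_eq_square simp flip: ennreal_mult)
  have "ennreal (min lam (eigval j)) / ennreal lam = min 1 (ennreal (eigval j / lam))" for j
  proof -
    have "ennreal (min lam (eigval j)) / ennreal lam = ennreal (min lam (eigval j) / lam)"
      using assms by (intro divide_ennreal) auto
    also have "min lam (eigval j) / lam = min 1 (eigval j / lam)"
      using assms(1) by (simp add: min_def field_simps)
    also have "ennreal \<dots> = min 1 (ennreal (eigval j / lam))"
      using ennreal_leI[of 1 "eigval j / lam"] ennreal_leI[of "eigval j / lam" 1] by (auto simp: min_def)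
    finally show ?thesis .
  qed
  then have "(\<Sum>j. ennreal (min lam (eigval j))) / ennreal lam = (\<Sum>j. min 1 (ennreal (eigval j / lam)))"
    by (simp flip: ennreal_suminf_divide)
  then show ?thesis
    unfolding kernel_complexity_def sq by (simp flip: ennreal_times_divide)
qed

lemma (in prob_space) nn_integral_min_1_le:
  assumes "g \<in> borel_measurable M"
  shows "(\<integral>\<^sup>+\<omega>. min 1 (g \<omega>) \<partial>M) \<le> min 1 (\<integral>\<^sup>+\<omega>. g \<omega> \<partial>M)"
proof (rule min.boundedI)
  have "(\<integral>\<^sup>+\<omega>. min 1 (g \<omega>) \<partial>M) \<le> (\<integral>\<^sup>+\<omega>. 1 \<partial>M)" by (intro nn_integral_mono) auto
  then show "(\<integral>\<^sup>+\<omega>. min 1 (g \<omega>) \<partial>M) \<le> 1" by (simp add: emeasure_space_1)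
  show "(\<integral>\<^sup>+\<omega>. min 1 (g \<omega>) \<partial>M) \<le> (\<integral>\<^sup>+\<omega>. g \<omega> \<partial>M)" by (intro nn_integral_mono) auto
qed

context
  fixes \<X> :: "(real ^ 'd) set" and M :: "'w measure" and \<rho> :: "(real ^ 'd) measure" and n :: nat
    and X :: "nat \<Rightarrow> 'w \<Rightarrow> real ^ 'd" and K H ip and \<tau> eigval :: "nat \<Rightarrow> real" and \<phi> and mu lam :: real
  assumes n: "n \<ge> 1" and prob: "prob_space M"
    and X: "\<And>i. i \<in> {1..n} \<Longrightarrow> X i \<in> measurable M (restrict_space borel \<X>)"
    and distr: "\<And>i. i \<in> {1..n} \<Longrightarrow> distr M (restrict_space borel \<X>) (X i) = \<rho>"
    and moment: "integrable \<rho> (\<lambda>x. (norm x)\<^sup>2)"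
    and tau: "ordered_eigenvalues (second_moment_matrix \<rho>) \<tau>" "\<And>i. i \<in> {1..CARD('d)} \<Longrightarrow> 0 \<le> \<tau> i"
    and K: "continuous_on (\<X> \<times> \<X>) (\<lambda>(x, y). K x y)"
    and rkhs: "rkhs \<X> K H ip"
    and eig: "kernel_eigen_decomposition \<rho> K eigval \<phi>"
    and mu: "0 < mu" and lam: "0 < lam"
begin

interpretation prob_space M by (rule prob)

lemma sets_law: "sets \<rho> = sets (restrict_space borel \<X>)"
  using distr[of 1] n by auto

lemma finite_law: "finite_measure \<rho>"
  using prob_space_distr[OF X[of 1]] distr[of 1] n by (auto intro: prob_space.finite_measure)

lemma eigval_nonneg: "0 \<le> eigval j"
  using eig by (simp add: kernel_eigen_decomposition_def)

lemma eigenfunction_L2: "\<phi> j \<in> L2 \<rho>"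
  using eig by (simp add: kernel_eigen_decomposition_def L2_orthonormal_basis_def)

lemma nn_integral_eigenfunction_square: "(\<integral>\<^sup>+x. ennreal ((\<phi> j x)\<^sup>2) \<partial>\<rho>) = 1"
proof -
  have "L2_inner \<rho> (\<phi> j) (\<phi> j) = 1"
    using eig by (simp add: kernel_eigen_decomposition_def L2_orthonormal_basis_def)
  then have "(\<integral>x. (\<phi> j x)\<^sup>2 \<partial>\<rho>) = 1" by (simp add: L2_inner_def power2_eq_square)
  then show ?thesis
    using nn_integral_eq_integral[OF L2_integrable_square[OF eigenfunction_L2[of j]]] by simp
qed

lemma nn_integral_design_point:
  assumes "i \<in> {1..n}" "g \<in> borel_measurable \<rho>"
  shows "(\<integral>\<^sup>+\<omega>. g (X i \<omega>) \<partial>M) = (\<integral>\<^sup>+x. g x \<partial>\<rho>)"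
proof -
  have "g \<in> borel_measurable (restrict_space borel \<X>)"
    using assms(2) measurable_cong_sets[OF sets_law refl] by blast
  then show ?thesis
    using nn_integral_distr[OF X[OF assms(1)], of g] distr[OF assms(1)] assms(2) by simp
qed

lemma cell_average_design_measurable:
  "i \<in> {1..n} \<Longrightarrow> (\<lambda>\<omega>. cell_average \<rho> m h (X i \<omega>)) \<in> borel_measurable M"
  using measurable_compose[OF X, of i "cell_average \<rho> m h"]
    cell_average_measurable[OF finite_law sets_law, of m h] measurable_cong_sets[OF sets_law refl]
  by blast

text \<open>
  Averaging over cells does not increase the \<open>L2\<close> norm of an eigenfunction, so the energy of feature
  \<open>j\<close> has mean at most \<open>eigval j / lam\<close>; the minimum with \<open>1\<close> passes through the expectation by
  concavity.
\<close>

lemma expected_kernel_energy_le: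
  "(\<integral>\<^sup>+\<omega>. (\<Sum>j. min 1 (ennreal (eigval j / lam * ((\<Sum>i\<in>{1..n}. (cell_average \<rho> m (\<phi> j) (X i \<omega>))\<^sup>2) / n)))) \<partial>M)
    \<le> (\<Sum>j. min 1 (ennreal (eigval j / lam)))"
proof -
  have avg: "(\<lambda>x. cell_average \<rho> m (\<phi> j) x) \<in> borel_measurable \<rho>" for j
    using cell_average_measurable[OF finite_law sets_law] by simp
  note avgX = cell_average_design_measurable
  let ?e = "\<lambda>j \<omega>. eigval j / lam * ((\<Sum>i\<in>{1..n}. (cell_average \<rho> m (\<phi> j) (X i \<omega>))\<^sup>2) / n)"
  have e: "?e j \<in> borel_measurable M" for j
    using avgX by (intro borel_measurable_times borel_measurable_divide borel_measurable_sum borel_measurable_power) auto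
  have le: "(\<integral>\<^sup>+\<omega>. ennreal (?e j \<omega>) \<partial>M) \<le> ennreal (eigval j / lam)" for j
  proof -
    have "ennreal (?e j \<omega>) = ennreal (eigval j / lam / n) * (\<Sum>i\<in>{1..n}. ennreal ((cell_average \<rho> m (\<phi> j) (X i \<omega>))\<^sup>2))" for \<omega>
      using eigval_nonneg[of j] lam by (simp add: sum_nonneg flip: ennreal_mult)
    moreover have "(\<integral>\<^sup>+\<omega>. (\<Sum>i\<in>{1..n}. ennreal ((cell_average \<rho> m (\<phi> j) (X i \<omega>))\<^sup>2)) \<partial>M)
        = (\<Sum>i\<in>{1..n}. \<integral>\<^sup>+\<omega>. ennreal ((cell_average \<rho> m (\<phi> j) (X i \<omega>))\<^sup>2) \<partial>M)"
      using avgX by (intro nn_integral_sum) measurable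
    moreover have "(\<lambda>\<omega>. \<Sum>i\<in>{1..n}. ennreal ((cell_average \<rho> m (\<phi> j) (X i \<omega>))\<^sup>2)) \<in> borel_measurable M"
      using avgX by (intro borel_measurable_sum) measurable
    ultimately have "(\<integral>\<^sup>+\<omega>. ennreal (?e j \<omega>) \<partial>M)
        = ennreal (eigval j / lam / n) * (\<Sum>i\<in>{1..n}. \<integral>\<^sup>+\<omega>. ennreal ((cell_average \<rho> m (\<phi> j) (X i \<omega>))\<^sup>2) \<partial>M)"
      by (simp only: nn_integral_cmult)
    also have "\<dots> \<le> ennreal (eigval j / lam / n) * (\<Sum>i\<in>{1..n}. 1)"
    proof (intro mult_left_mono sum_mono)
      fix i assume i: "i \<in> {1..n}"
      have "(\<integral>\<^sup>+\<omega>. ennreal ((cell_average \<rho> m (\<phi> j) (X i \<omega>))\<^sup>2) \<partial>M)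
          = (\<integral>\<^sup>+x. ennreal ((cell_average \<rho> m (\<phi> j) x)\<^sup>2) \<partial>\<rho>)"
        using avg[of j] by (intro nn_integral_design_point[OF i, of "\<lambda>x. ennreal ((cell_average \<rho> m (\<phi> j) x)\<^sup>2)"]) measurable
      also have "\<dots> \<le> 1"
        using nn_integral_cell_average_square_le[OF finite_law sets_law eigenfunction_L2[of j], of m]
        by (simp add: nn_integral_eigenfunction_square)
      finally show "(\<integral>\<^sup>+\<omega>. ennreal ((cell_average \<rho> m (\<phi> j) (X i \<omega>))\<^sup>2) \<partial>M) \<le> 1" .
    qed simp
    also have "\<dots> = ennreal (eigval j / lam)"
      using n lam eigval_nonneg[of j] by (simp add: ennreal_of_nat_eq_real_of_nat flip: ennreal_mult)
    finally show ?thesis .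
  qed
  have "(\<integral>\<^sup>+\<omega>. min 1 (ennreal (?e j \<omega>)) \<partial>M) \<le> min 1 (ennreal (eigval j / lam))" for j
    by (rule order_trans[OF nn_integral_min_1_le min.mono[OF order_refl le]]) (use e[of j] in auto)
  then show ?thesis
    using e by (subst nn_integral_suminf) (auto intro!: suminf_le)
qed

lemma design_coordinate_measurable: "(\<lambda>x. x $ i) \<in> borel_measurable \<rho>"
proof -
  have "(\<lambda>x. x $ i) \<in> borel_measurable (restrict_space borel \<X>)"
    by (intro measurable_restrict_space1) (intro borel_measurable_continuous_onI continuous_intros)
  then show ?thesis using measurable_cong_sets[OF sets_law refl] by blast
qed

lemma expected_linear_energy:
  fixes u :: "real ^ 'd"
  defines "a \<equiv> \<lambda>\<omega>. (\<Sum>i\<in>{1..n}. (X i \<omega> \<bullet> u)\<^sup>2) / n / mu"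
  shows "integrable M a" "expectation a = (u \<bullet> (second_moment_matrix \<rho> *v u)) / mu"
proof -
  let ?q = "u \<bullet> (second_moment_matrix \<rho> *v u)"
  have "(\<lambda>x. (x \<bullet> u)\<^sup>2) \<in> borel_measurable (restrict_space borel \<X>)"
    by (intro measurable_restrict_space1) measurable
  then have *: "integrable M (\<lambda>\<omega>. (X i \<omega> \<bullet> u)\<^sup>2)" "(\<integral>\<omega>. (X i \<omega> \<bullet> u)\<^sup>2 \<partial>M) = ?q" if "i \<in> {1..n}" for i
    using second_moment_quadratic[OF design_coordinate_measurable moment, of u]
      integrable_distr_eq[OF X[OF that], of "\<lambda>x. (x \<bullet> u)\<^sup>2"] integral_distr[OF X[OF that], of "\<lambda>x. (x \<bullet> u)\<^sup>2"]
      distr[OF that] by auto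
  then show "integrable M a"
    unfolding a_def by (intro integrable_divide Bochner_Integration.integrable_sum)
  show "expectation a = ?q / mu" unfolding a_def using * n by simp
qed

text \<open>
  The trace bound on a fixed design holds almost surely, namely when all cells of the design points
  have positive mass. Fatou's lemma then moves the expectation inside the lower limit over the cell
  sizes, where the bound no longer depends on the cell size.
\<close>

lemma expected_smoother_trace_le:
  "(\<integral>\<^sup>+\<omega>. ennreal (\<Sum>i\<in>{1..n}. smoother_matrix n (ridge_gram mu lam K (\<lambda>i. X i \<omega>)) n i i) \<partial>M)
    \<le> ennreal (\<Sum>i = 1..CARD('d). \<tau> i / (\<tau> i + mu)) + (\<Sum>j. min 1 (ennreal (eigval j / lam)))"
proof -
  have "transpose (second_moment_matrix \<rho>) = second_moment_matrix \<rho>"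
    by (simp add: transpose_def second_moment_matrix_def vec_eq_iff mult.commute)
  then obtain u :: "'d \<Rightarrow> real ^ 'd" and l where on: "\<And>j k. u j \<bullet> u k = (if j = k then 1 else 0)"
    and ul: "\<And>k. second_moment_matrix \<rho> *v u k = l k *\<^sub>R u k"
    and char: "\<And>t. det (mat t - second_moment_matrix \<rho>) = (\<Prod>k\<in>UNIV. t - l k)"
    by (rule symmetric_matrix_diagonalization) blast
  have l: "u k \<bullet> (second_moment_matrix \<rho> *v u k) = l k" for k by (simp add: ul on)
  have l0: "0 \<le> l k" for k
    unfolding l[symmetric] second_moment_quadratic(2)[OF design_coordinate_measurable moment, symmetric] by simp
  define a where "a k \<omega> = (\<Sum>i\<in>{1..n}. (X i \<omega> \<bullet> u k)\<^sup>2) / n / mu" for k \<omega>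
  have a_int: "integrable M (a k)" and a_exp: "expectation (a k) = l k / mu" for k
    using expected_linear_energy[of "u k"] by (auto simp: a_def[abs_def] l)
  have a0: "0 \<le> a k \<omega>" for k \<omega> using mu by (simp add: a_def sum_nonneg)
  define E where "E m \<omega> = (\<Sum>j. min 1 (ennreal (eigval j / lam * ((\<Sum>i\<in>{1..n}. (cell_average \<rho> m (\<phi> j) (X i \<omega>))\<^sup>2) / n))))" for m \<omega>
  note avgX = cell_average_design_measurable
  have E_meas: "E m \<in> borel_measurable M" for m
  proof -
    have "(\<lambda>\<omega>. eigval j / lam * ((\<Sum>i\<in>{1..n}. (cell_average \<rho> m (\<phi> j) (X i \<omega>))\<^sup>2) / n)) \<in> borel_measurable M" for j
      using avgX by (intro borel_measurable_times borel_measurable_divide borel_measurable_sum borel_measurable_power) auto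
    then show ?thesis unfolding E_def[abs_def] by measurable
  qed
  have a_meas: "(\<lambda>\<omega>. a k \<omega> / (1 + a k \<omega>)) \<in> borel_measurable M" for k
    using borel_measurable_integrable[OF a_int[of k]] by measurable
  have pos: "AE \<omega> in M. \<forall>m. 0 < measure \<rho> (cell \<rho> m (X i \<omega>))" if "i \<in> {1..n}" for i
  proof -
    have "AE x in distr M (restrict_space borel \<X>) (X i). \<forall>m. 0 < measure \<rho> (cell \<rho> m x)"
      unfolding distr[OF that] by (rule AE_cell_pos[OF finite_law sets_law])
    then show ?thesis by (rule AE_distrD[OF X[OF that]])
  qed
  have "AE \<omega> in M. \<forall>i\<in>{1..n}. \<forall>m. 0 < measure \<rho> (cell \<rho> m (X i \<omega>))"
    using pos by (intro AE_finite_allI) auto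
  with AE_space have "AE \<omega> in M. ennreal (\<Sum>i\<in>{1..n}. smoother_matrix n (ridge_gram mu lam K (\<lambda>i. X i \<omega>)) n i i)
      \<le> ennreal (\<Sum>k\<in>UNIV. a k \<omega> / (1 + a k \<omega>)) + liminf (\<lambda>m. E m \<omega>)"
  proof eventually_elim
    case (elim \<omega>)
    have x: "X i \<omega> \<in> \<X>" if "i \<in> {1..n}" for i
      using measurable_space[OF X[OF that] elim(1)] by (simp add: space_restrict_space)
    have op: "kernel_operator \<rho> K (cell_density \<rho> m y) \<in> borel_measurable \<rho>" for m y
      using eig cell_density_L2[OF finite_law sets_law, of m y]
      by (auto simp: kernel_eigen_decomposition_def L2_sums_def intro: L2_measurable)
    show ?case
      unfolding a_def E_def
    proof (rule smoother_trace_le[where p = "\<lambda>m j i. cell_average \<rho> m (\<phi> j) (X i \<omega>)", OF rkhs mu lam n x on eigval_nonneg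
          kernel_cell_average_sums[OF finite_law sets_law eig]])
      fix i i' assume "i \<in> {1..n}" "i' \<in> {1..n}"
      then show "(\<lambda>m. cell_average \<rho> m (kernel_operator \<rho> K (cell_density \<rho> m (X i' \<omega>))) (X i \<omega>)) \<longlonglongrightarrow> K (X i \<omega>) (X i' \<omega>)"
        using elim(2) by (intro kernel_cell_average_tendsto[OF finite_law sets_law K] x op) auto
    qed
  qed
  then have "(\<integral>\<^sup>+\<omega>. ennreal (\<Sum>i\<in>{1..n}. smoother_matrix n (ridge_gram mu lam K (\<lambda>i. X i \<omega>)) n i i) \<partial>M)
      \<le> (\<integral>\<^sup>+\<omega>. ennreal (\<Sum>k\<in>UNIV. a k \<omega> / (1 + a k \<omega>)) + liminf (\<lambda>m. E m \<omega>) \<partial>M)"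
    by (rule nn_integral_mono_AE)
  also have "\<dots> = (\<integral>\<^sup>+\<omega>. (\<Sum>k\<in>UNIV. ennreal (a k \<omega> / (1 + a k \<omega>))) \<partial>M) + (\<integral>\<^sup>+\<omega>. liminf (\<lambda>m. E m \<omega>) \<partial>M)"
    using a_meas E_meas a0 by (subst nn_integral_add) (auto simp: sum_ennreal)
  also have "(\<integral>\<^sup>+\<omega>. (\<Sum>k\<in>UNIV. ennreal (a k \<omega> / (1 + a k \<omega>))) \<partial>M) = (\<Sum>k\<in>UNIV. \<integral>\<^sup>+\<omega>. ennreal (a k \<omega> / (1 + a k \<omega>)) \<partial>M)"
    using a_meas by (intro nn_integral_sum) auto
  also have "\<dots> \<le> (\<Sum>k\<in>UNIV. ennreal (l k / (l k + mu)))"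
  proof (rule sum_mono)
    fix k
    have eq: "l k / mu / (1 + l k / mu) = l k / (l k + mu)"
    proof -
      have "l k + mu \<noteq> 0" using l0[of k] mu by simp
      then show ?thesis using mu by (simp add: field_simps)
    qed
    show "(\<integral>\<^sup>+\<omega>. ennreal (a k \<omega> / (1 + a k \<omega>)) \<partial>M) \<le> ennreal (l k / (l k + mu))"
      using expectation_ratio_le[OF a_int[of k] a0] unfolding a_exp eq .
  qed
  also have "\<dots> = ennreal (\<Sum>k\<in>UNIV. l k / (l k + mu))"
    using l0 mu by (intro sum_ennreal) (simp add: add_nonneg_pos less_imp_le)
  also have "(\<Sum>k\<in>UNIV. l k / (l k + mu)) = (\<Sum>i = 1..CARD('d). \<tau> i / (\<tau> i + mu))"
    using tau(1) by (intro ridge_dimension_eq[OF _ l0 tau(2) mu]) (simp_all add: ordered_eigenvalues_def flip: char)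
  also have "(\<integral>\<^sup>+\<omega>. liminf (\<lambda>m. E m \<omega>) \<partial>M) \<le> liminf (\<lambda>m. \<integral>\<^sup>+\<omega>. E m \<omega> \<partial>M)"
    by (rule nn_integral_liminf) (rule E_meas)
  also have "\<dots> \<le> liminf (\<lambda>m. \<Sum>j. min 1 (ennreal (eigval j / lam)))"
    unfolding E_def by (intro Liminf_mono always_eventually allI expected_kernel_energy_le)
  also have "\<dots> = (\<Sum>j. min 1 (ennreal (eigval j / lam)))"
    by (simp add: Liminf_const)
  finally show ?thesis by (simp add: add_mono)
qed

end

section \<open>The risk bound\<close>

theorem theorem5:
  fixes \<X> :: "(real ^ 'd) set"
    and M :: "'w measure"
    and \<rho> :: "(real ^ 'd) measure"
    and n :: nat
    and X :: "nat \<Rightarrow> 'w \<Rightarrow> real ^ 'd"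
    and Y :: "nat \<Rightarrow> 'w \<Rightarrow> real"
    and fstar :: "real ^ 'd \<Rightarrow> real"
    and \<sigma> :: real
    and \<tau> :: "nat \<Rightarrow> real"
    and K :: "real ^ 'd \<Rightarrow> real ^ 'd \<Rightarrow> real"
    and H :: "(real ^ 'd \<Rightarrow> real) set"
    and ip :: "(real ^ 'd \<Rightarrow> real) \<Rightarrow> (real ^ 'd \<Rightarrow> real) \<Rightarrow> real"
    and eigval :: "nat \<Rightarrow> real"
    and \<phi> :: "nat \<Rightarrow> real ^ 'd \<Rightarrow> real"
    and mu lam :: real
    and alpha_hat :: "'w \<Rightarrow> real ^ 'd"
    and g_hat :: "'w \<Rightarrow> real ^ 'd \<Rightarrow> real"
  assumes "n \<ge> 1"
    and "prob_space M"
    and "\<And>i. i \<in> {1..n} \<Longrightarrow> X i \<in> measurable M (restrict_space borel \<X>)"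
    and "\<And>i. i \<in> {1..n} \<Longrightarrow> Y i \<in> borel_measurable M"
    and "prob_space.indep_vars M (\<lambda>_. restrict_space borel \<X> \<Otimes>\<^sub>M borel)
           (\<lambda>i \<omega>. (X i \<omega>, Y i \<omega>)) {1..n}"
    and "\<And>i. i \<in> {1..n} \<Longrightarrow> distr M (restrict_space borel \<X>) (X i) = \<rho>"
    and "integrable \<rho> (\<lambda>x. (norm x)\<^sup>2)"
    and "fstar \<in> borel_measurable (restrict_space borel \<X>)"
    and "\<And>i. i \<in> {1..n} \<Longrightarrow> integrable M (\<lambda>\<omega>. (Y i \<omega> - fstar (X i \<omega>))\<^sup>2)"
    and "\<And>i. i \<in> {1..n} \<Longrightarrow>
           AE \<omega> in M. real_cond_exp M (vimage_algebra (space M) (X i) (restrict_space borel \<X>))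
             (\<lambda>\<omega>'. Y i \<omega>' - fstar (X i \<omega>')) \<omega> = 0"
    and "\<And>i. i \<in> {1..n} \<Longrightarrow>
           AE \<omega> in M. real_cond_exp M (vimage_algebra (space M) (X i) (restrict_space borel \<X>))
             (\<lambda>\<omega>'. (Y i \<omega>' - fstar (X i \<omega>'))\<^sup>2) \<omega> = \<sigma>\<^sup>2"
    and "ordered_eigenvalues (second_moment_matrix \<rho>) \<tau>"
    and "\<And>i. i \<in> {1..CARD('d)} \<Longrightarrow> 0 \<le> \<tau> i"
    and "symmetric_kernel_on \<X> K"
    and "psd_kernel_on \<X> K"
    and "continuous_on (\<X> \<times> \<X>) (\<lambda>(x, y). K x y)"
    and "rkhs \<X> K H ip"
    and "kernel_eigen_decomposition \<rho> K eigval \<phi>"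
    and "mu > 0"
    and "lam > 0"
    and "\<And>\<omega>. \<omega> \<in> space M \<Longrightarrow>
           is_arg_min (ridge_objective n (\<lambda>i. X i \<omega>) (\<lambda>i. Y i \<omega>) mu lam ip)
             (\<lambda>(\<alpha>, g). g \<in> H) (alpha_hat \<omega>, g_hat \<omega>)"
  shows "risk M n X (\<lambda>\<omega> x. x \<bullet> alpha_hat \<omega> + g_hat \<omega> x - fstar x)
    \<le> (INF (\<alpha>, f) \<in> UNIV \<times> H.
          risk M n X (\<lambda>_ x. x \<bullet> \<alpha> + f x - fstar x)
            + ennreal (mu * (norm \<alpha>)\<^sup>2) + ennreal (lam * (rkhs_norm ip f)\<^sup>2))
      + ennreal (\<sigma>\<^sup>2)
        * (ennreal ((1 / real n) * (\<Sum>i = 1..CARD('d). \<tau> i / (\<tau> i + mu)))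
           + (kernel_complexity n eigval lam)\<^sup>2 / ennreal lam)"
proof -
  let ?N = "restrict_space borel \<X>" and ?I = "{1..n}"
  note n = assms(1) and X = assms(3) and Y = assms(4) and K = assms(16) and rkhs = assms(17)
    and eig = assms(18) and mu = assms(19) and lam = assms(20)
  interpret sample: regression_sample M ?N ?I X Y fstar \<sigma>
    using assms(2-5,8-11) by (intro regression_sample.intro regression_sample_axioms.intro) auto
  interpret rkhs \<X> K H ip by (rule rkhs)
  let ?D = sample.design
  define S where "S x i j = smoother_matrix n (ridge_gram mu lam K x) n i j" for x i j
  \<comment> \<open>bias of the smoother at design point i; both b and S are functions of the whole design\<close>
  define b where "b i x = (\<Sum>j\<in>?I. S x i j * fstar (x j)) - fstar (x i)" for i x
  define B where "B = ennreal (\<Sum>i = 1..CARD('d). \<tau> i / (\<tau> i + mu)) + (\<Sum>j. min 1 (ennreal (eigval j / lam)))"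
  have D: "?D \<omega> i = X i \<omega>" if "i \<in> ?I" for i \<omega> using that by (simp add: sample.design_def)
  have XS: "X i \<omega> \<in> \<X>" if "i \<in> ?I" "\<omega> \<in> space M" for i \<omega>
    using measurable_space[OF X[OF that(1)] that(2)] by (simp add: space_restrict_space)
  have SX: "S (\<lambda>i. X i \<omega>) i j = S (?D \<omega>) i j" if "i \<in> ?I" "j \<in> ?I" for i j \<omega>
    unfolding S_def using that by (intro smoother_cong) (simp_all add: ridge_gram_def D)
  have smoother_S: "ridge_smoother ?I (ridge_gram mu lam K (?D \<omega>)) (S (?D \<omega>)) n" if "\<omega> \<in> space M" for \<omega>
    unfolding S_def[abs_def] using XS[OF _ that] by (intro ridge_smoother_ridge_gram[OF rkhs mu lam n]) (simp add: D)
  have S_meas: "(\<lambda>x. S x i j) \<in> borel_measurable (PiM ?I (\<lambda>_. ?N))" if "i \<in> ?I" "j \<in> ?I" for i j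
    unfolding S_def using that
    by (intro smoother_measurable ridge_gram_measurable[OF K, where I = ?I]) (auto intro: measurable_component_singleton)
  have f_meas: "(\<lambda>x. fstar (x i)) \<in> borel_measurable (PiM ?I (\<lambda>_. ?N))" if "i \<in> ?I" for i
    by (rule measurable_compose[OF measurable_component_singleton[OF that] assms(8)])
  have b_meas: "b i \<in> borel_measurable (PiM ?I (\<lambda>_. ?N))" if "i \<in> ?I" for i
    unfolding b_def[abs_def] using that S_meas f_meas
    by (intro borel_measurable_diff borel_measurable_sum borel_measurable_times) auto
  have S_le: "\<bar>S (?D \<omega>) i j\<bar> \<le> 1" if "\<omega> \<in> space M" "i \<in> ?I" "j \<in> ?I" for \<omega> i j
    by (rule ridge_smoother.abs_entry_le_1[OF smoother_S[OF that(1)] that(2,3)])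
  have error: "X i \<omega> \<bullet> alpha_hat \<omega> + g_hat \<omega> (X i \<omega>) - fstar (X i \<omega>)
      = b i (?D \<omega>) + (\<Sum>j\<in>?I. S (?D \<omega>) i j * sample.noise j \<omega>)" if i: "i \<in> ?I" and \<omega>: "\<omega> \<in> space M" for i \<omega>
  proof -
    have sm: "ridge_smoother ?I (ridge_gram mu lam K (\<lambda>i. X i \<omega>)) (smoother_matrix n (ridge_gram mu lam K (\<lambda>i. X i \<omega>)) n) n"
      by (rule ridge_smoother_ridge_gram[OF rkhs mu lam n]) (rule XS[OF _ \<omega>])
    have "X i \<omega> \<bullet> alpha_hat \<omega> + g_hat \<omega> (X i \<omega>)
        = ridge_smoother.fit ?I (smoother_matrix n (ridge_gram mu lam K (\<lambda>i. X i \<omega>)) n) (\<lambda>i. Y i \<omega>) i"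
      by (rule ridge_minimizer_fit[OF rkhs mu lam n XS[OF _ \<omega>] assms(21)[OF \<omega>] i])
    also have "\<dots> = (\<Sum>j\<in>?I. S (?D \<omega>) i j * Y j \<omega>)"
      unfolding ridge_smoother.fit_def[OF sm] using SX[OF i, of _ \<omega>]
      by (intro sum.cong) (simp_all add: S_def)
    also have "\<dots> = (\<Sum>j\<in>?I. S (?D \<omega>) i j * fstar (?D \<omega> j)) + (\<Sum>j\<in>?I. S (?D \<omega>) i j * sample.noise j \<omega>)"
      by (simp add: sample.noise_def D algebra_simps flip: sum.distrib)
    finally show ?thesis by (simp add: b_def D[OF i])
  qed
  have trace: "(\<integral>\<^sup>+\<omega>. ennreal (\<Sum>i\<in>?I. S (?D \<omega>) i i) \<partial>M) \<le> B"
  proof -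
    have "(\<Sum>i\<in>?I. S (?D \<omega>) i i) = (\<Sum>i\<in>?I. smoother_matrix n (ridge_gram mu lam K (\<lambda>i. X i \<omega>)) n i i)" for \<omega>
      using SX[of _ _ \<omega>] by (intro sum.cong) (simp_all add: S_def)
    then show ?thesis
      using expected_smoother_trace_le[where X = X, OF n assms(2) X assms(6,7,12,13) K rkhs eig mu lam]
      by (simp only: B_def)
  qed
  have variance: "ennreal (\<Sum>i\<in>?I. \<Sum>j\<in>?I. \<integral>\<omega>. (S (?D \<omega>) i j)\<^sup>2 \<partial>M) \<le> B"
  proof -
    have int: "integrable M (\<lambda>\<omega>. (S (?D \<omega>) i j)\<^sup>2)" if "i \<in> ?I" "j \<in> ?I" for i j
      using S_le[OF _ that] measurable_compose[OF sample.design_measurable S_meas[OF that]]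
      by (intro sample.integrable_const_bound[where B = 1] AE_I2) (auto simp: abs_square_le_1)
    have eq: "(\<Sum>i\<in>?I. \<Sum>j\<in>?I. \<integral>\<omega>. (S (?D \<omega>) i j)\<^sup>2 \<partial>M) = (\<integral>\<omega>. (\<Sum>i\<in>?I. \<Sum>j\<in>?I. (S (?D \<omega>) i j)\<^sup>2) \<partial>M)"
      by (subst Bochner_Integration.integral_sum, (intro Bochner_Integration.integrable_sum int; simp),
          intro sum.cong refl Bochner_Integration.integral_sum[symmetric] int)
    have "ennreal (\<Sum>i\<in>?I. \<Sum>j\<in>?I. \<integral>\<omega>. (S (?D \<omega>) i j)\<^sup>2 \<partial>M)
        = (\<integral>\<^sup>+\<omega>. ennreal (\<Sum>i\<in>?I. \<Sum>j\<in>?I. (S (?D \<omega>) i j)\<^sup>2) \<partial>M)"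
      unfolding eq by (intro nn_integral_eq_integral[symmetric] Bochner_Integration.integrable_sum int AE_I2 sum_nonneg) auto
    also have "\<dots> \<le> (\<integral>\<^sup>+\<omega>. ennreal (\<Sum>i\<in>?I. S (?D \<omega>) i i) \<partial>M)"
      by (intro nn_integral_mono ennreal_leI ridge_smoother.square_entries_le_trace[OF smoother_S])
    finally show ?thesis using trace by simp
  qed
  have B: "ennreal (\<sigma>\<^sup>2) * (ennreal ((1 / real n) * (\<Sum>i = 1..CARD('d). \<tau> i / (\<tau> i + mu)))
      + (kernel_complexity n eigval lam)\<^sup>2 / ennreal lam) = ennreal (\<sigma>\<^sup>2) * (ennreal (1 / n) * B)"
  proof -
    have "0 \<le> eigval j" for j using eig by (simp add: kernel_eigen_decomposition_def)
    moreover have "0 \<le> (\<Sum>i = 1..CARD('d). \<tau> i / (\<tau> i + mu))"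
      using assms(13) mu by (intro sum_nonneg divide_nonneg_nonneg) (auto intro: add_nonneg_nonneg)
    then have "ennreal ((1 / real n) * (\<Sum>i = 1..CARD('d). \<tau> i / (\<tau> i + mu)))
        = ennreal (1 / n) * ennreal (\<Sum>i = 1..CARD('d). \<tau> i / (\<tau> i + mu))"
      by (intro ennreal_mult) auto
    ultimately show ?thesis
      using lam by (simp only: B_def kernel_complexity_square distrib_left)
  qed
  have risk_le: "risk M n X (\<lambda>\<omega> x. x \<bullet> alpha_hat \<omega> + g_hat \<omega> x - fstar x)
      \<le> risk M n X (\<lambda>_ x. x \<bullet> \<alpha> + g x - fstar x) + ennreal (mu * (norm \<alpha>)\<^sup>2)
        + ennreal (lam * (rkhs_norm ip g)\<^sup>2) + ennreal (\<sigma>\<^sup>2) * (ennreal (1 / n) * B)"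
    if g: "g \<in> H" for \<alpha> g
  proof (cases "risk M n X (\<lambda>_ x. x \<bullet> \<alpha> + g x - fstar x) = \<infinity>")
    case True
    then show ?thesis by simp
  next
    case False
    \<comment> \<open>finite risk of the competitor makes w, and with it the bias, square integrable\<close>
    define w where "w i \<omega> = X i \<omega> \<bullet> \<alpha> + g (X i \<omega>) - fstar (X i \<omega>)" for i \<omega>
    define c where "c = mu * (norm \<alpha>)\<^sup>2 + lam * (rkhs_norm ip g)\<^sup>2"
    have c: "0 \<le> c" using mu lam by (simp add: c_def)
    have w_meas: "w i \<in> borel_measurable M" if i: "i \<in> ?I" for i
    proof -
      have "X i \<in> borel_measurable M" using X[OF i] by (simp add: measurable_restrict_space2_iff)
      moreover have "g \<in> borel_measurable ?N"
        by (intro borel_measurable_continuous_on_restrict rkhs_continuous_on[OF rkhs K g])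
      ultimately show ?thesis
        unfolding w_def[abs_def] using measurable_compose[OF X[OF i]] assms(8)
        by (intro borel_measurable_diff borel_measurable_add borel_measurable_inner) auto
    qed
    have risk_w: "risk M n X (\<lambda>_ x. x \<bullet> \<alpha> + g x - fstar x)
        = ennreal (1 / n) * (\<Sum>i\<in>?I. \<integral>\<^sup>+\<omega>. ennreal ((w i \<omega>)\<^sup>2) \<partial>M)"
      by (simp add: risk_def w_def)
    have w_int: "integrable M (\<lambda>\<omega>. (w i \<omega>)\<^sup>2)" if i: "i \<in> ?I" for i
    proof -
      have "(\<Sum>i\<in>?I. \<integral>\<^sup>+\<omega>. ennreal ((w i \<omega>)\<^sup>2) \<partial>M) \<noteq> \<infinity>"
        using False n unfolding risk_w by (auto simp: ennreal_mult_eq_top_iff)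
      then have "(\<integral>\<^sup>+\<omega>. ennreal ((w i \<omega>)\<^sup>2) \<partial>M) \<noteq> \<infinity>"
        using i by (auto simp: less_top)
      then show ?thesis
        using w_meas[OF i] by (intro integrableI_nonneg) (auto simp: less_top)
    qed
    have bias: "(\<Sum>i\<in>?I. (b i (?D \<omega>))\<^sup>2) / n \<le> (\<Sum>i\<in>?I. (w i \<omega>)\<^sup>2) / n + c" if \<omega>: "\<omega> \<in> space M" for \<omega>
    proof -
      have x: "?D \<omega> i \<in> \<X>" if "i \<in> ?I" for i using XS[OF that \<omega>] D[OF that] by simp
      have sm: "ridge_smoother ?I (ridge_gram mu lam K (?D \<omega>)) (smoother_matrix n (ridge_gram mu lam K (?D \<omega>)) n) n"
        by (rule ridge_smoother_ridge_gram[OF rkhs mu lam n]) (rule x)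
      let ?f = "\<lambda>i. fstar (?D \<omega> i)"
      have "b i (?D \<omega>) = ridge_smoother.fit ?I (smoother_matrix n (ridge_gram mu lam K (?D \<omega>)) n) ?f i - ?f i" for i
        unfolding ridge_smoother.fit_def[OF sm] b_def S_def ..
      moreover have "w i \<omega> = ?D \<omega> i \<bullet> \<alpha> + g (?D \<omega> i) - ?f i" if "i \<in> ?I" for i
        using D[OF that] by (simp add: w_def)
      moreover have "(\<Sum>i\<in>?I. (ridge_smoother.fit ?I (smoother_matrix n (ridge_gram mu lam K (?D \<omega>)) n) ?f i - ?f i)\<^sup>2) / n
          \<le> (\<Sum>i\<in>?I. (?D \<omega> i \<bullet> \<alpha> + g (?D \<omega> i) - ?f i)\<^sup>2) / n + mu * (norm \<alpha>)\<^sup>2 + lam * (rkhs_norm ip g)\<^sup>2"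
        by (rule ridge_bias_le[OF rkhs mu lam n _ g]) (rule x)
      ultimately show ?thesis by (simp add: c_def add.assoc)
    qed
    have w_sum_int: "integrable M (\<lambda>\<omega>. \<Sum>i\<in>?I. (w i \<omega>)\<^sup>2)"
      by (intro Bochner_Integration.integrable_sum w_int)
    have w_sum: "(\<integral>\<omega>. (\<Sum>i\<in>?I. (w i \<omega>)\<^sup>2) \<partial>M) = (\<Sum>i\<in>?I. \<integral>\<omega>. (w i \<omega>)\<^sup>2 \<partial>M)"
      by (intro Bochner_Integration.integral_sum w_int)
    have b_int: "integrable M (\<lambda>\<omega>. (b i (?D \<omega>))\<^sup>2)" if i: "i \<in> ?I" for i
    proof (rule Bochner_Integration.integrable_bound)
      show "integrable M (\<lambda>\<omega>. (\<Sum>i\<in>?I. (w i \<omega>)\<^sup>2) + n * c)" using w_sum_int by simp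
      show "(\<lambda>\<omega>. (b i (?D \<omega>))\<^sup>2) \<in> borel_measurable M"
        using measurable_compose[OF sample.design_measurable b_meas[OF i]] by simp
      show "AE \<omega> in M. norm ((b i (?D \<omega>))\<^sup>2) \<le> norm ((\<Sum>i\<in>?I. (w i \<omega>)\<^sup>2) + n * c)"
      proof (rule AE_I2)
        fix \<omega> assume \<omega>: "\<omega> \<in> space M"
        have "(b i (?D \<omega>))\<^sup>2 \<le> (\<Sum>i\<in>?I. (b i (?D \<omega>))\<^sup>2)"
          using i by (intro member_le_sum) auto
        also have "\<dots> \<le> (\<Sum>i\<in>?I. (w i \<omega>)\<^sup>2) + n * c"
          using bias[OF \<omega>] n by (simp add: field_simps)
        finally show "norm ((b i (?D \<omega>))\<^sup>2) \<le> norm ((\<Sum>i\<in>?I. (w i \<omega>)\<^sup>2) + n * c)" by simp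
      qed
    qed
    have split: "(\<integral>\<^sup>+\<omega>. ennreal ((X i \<omega> \<bullet> alpha_hat \<omega> + g_hat \<omega> (X i \<omega>) - fstar (X i \<omega>))\<^sup>2) \<partial>M)
        = ennreal ((\<integral>\<omega>. (b i (?D \<omega>))\<^sup>2 \<partial>M) + \<sigma>\<^sup>2 * (\<Sum>j\<in>?I. \<integral>\<omega>. (S (?D \<omega>) i j)\<^sup>2 \<partial>M))" if i: "i \<in> ?I" for i
    proof -
      note sq = sample.expectation_linear_smoother_square[of "b i" "\<lambda>j x. S x i j",
          OF b_meas[OF i] S_meas[OF i] S_le[OF _ i] b_int[OF i]]
      have "(\<integral>\<^sup>+\<omega>. ennreal ((X i \<omega> \<bullet> alpha_hat \<omega> + g_hat \<omega> (X i \<omega>) - fstar (X i \<omega>))\<^sup>2) \<partial>M)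
        = (\<integral>\<^sup>+\<omega>. ennreal ((b i (?D \<omega>) + (\<Sum>j\<in>?I. S (?D \<omega>) i j * sample.noise j \<omega>))\<^sup>2) \<partial>M)"
        by (intro nn_integral_cong) (simp add: error[OF i])
      also have "\<dots> = ennreal (\<integral>\<omega>. (b i (?D \<omega>) + (\<Sum>j\<in>?I. S (?D \<omega>) i j * sample.noise j \<omega>))\<^sup>2 \<partial>M)"
        by (rule nn_integral_eq_integral) (use sq(1) in auto)
      finally show ?thesis using sq(2) by simp
    qed
    have penalized_risk: "ennreal ((\<Sum>i\<in>?I. \<integral>\<omega>. (w i \<omega>)\<^sup>2 \<partial>M) / n + c)
        = risk M n X (\<lambda>_ x. x \<bullet> \<alpha> + g x - fstar x) + ennreal (mu * (norm \<alpha>)\<^sup>2) + ennreal (lam * (rkhs_norm ip g)\<^sup>2)"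
    proof -
      have "(\<Sum>i\<in>?I. \<integral>\<^sup>+\<omega>. ennreal ((w i \<omega>)\<^sup>2) \<partial>M) = ennreal (\<Sum>i\<in>?I. \<integral>\<omega>. (w i \<omega>)\<^sup>2 \<partial>M)"
        by (subst sum_ennreal[symmetric], simp, intro sum.cong refl nn_integral_eq_integral w_int) auto
      then show ?thesis
        unfolding risk_w c_def using mu lam
        by (simp add: sum_nonneg add.assoc ennreal_plus flip: ennreal_mult)
    qed
    have "risk M n X (\<lambda>\<omega> x. x \<bullet> alpha_hat \<omega> + g_hat \<omega> x - fstar x)
      = ennreal (1 / n) * (\<Sum>i\<in>?I. ennreal ((\<integral>\<omega>. (b i (?D \<omega>))\<^sup>2 \<partial>M) + \<sigma>\<^sup>2 * (\<Sum>j\<in>?I. \<integral>\<omega>. (S (?D \<omega>) i j)\<^sup>2 \<partial>M)))"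
      unfolding risk_def by (intro arg_cong2[where f = "(*)"] sum.cong refl split)
    also have "\<dots> = ennreal (1 / n) * ennreal ((\<Sum>i\<in>?I. \<integral>\<omega>. (b i (?D \<omega>))\<^sup>2 \<partial>M)
        + \<sigma>\<^sup>2 * (\<Sum>i\<in>?I. \<Sum>j\<in>?I. \<integral>\<omega>. (S (?D \<omega>) i j)\<^sup>2 \<partial>M))"
      by (subst sum_ennreal) (auto simp: sum.distrib sum_distrib_left intro!: add_nonneg_nonneg sum_nonneg)
    also have "\<dots> = ennreal ((\<Sum>i\<in>?I. \<integral>\<omega>. (b i (?D \<omega>))\<^sup>2 \<partial>M) / n)
        + ennreal (\<sigma>\<^sup>2) * (ennreal (1 / n) * ennreal (\<Sum>i\<in>?I. \<Sum>j\<in>?I. \<integral>\<omega>. (S (?D \<omega>) i j)\<^sup>2 \<partial>M))"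
      by (simp add: sum_nonneg distrib_left flip: ennreal_mult ennreal_plus)
    also have "\<dots> \<le> ennreal ((\<Sum>i\<in>?I. \<integral>\<omega>. (w i \<omega>)\<^sup>2 \<partial>M) / n + c) + ennreal (\<sigma>\<^sup>2) * (ennreal (1 / n) * B)"
    proof (intro add_mono mult_left_mono variance ennreal_leI)
      have b_sum_int: "integrable M (\<lambda>\<omega>. \<Sum>i\<in>?I. (b i (?D \<omega>))\<^sup>2)"
        by (intro Bochner_Integration.integrable_sum b_int)
      have "(\<Sum>i\<in>?I. \<integral>\<omega>. (b i (?D \<omega>))\<^sup>2 \<partial>M) = (\<integral>\<omega>. (\<Sum>i\<in>?I. (b i (?D \<omega>))\<^sup>2) \<partial>M)"
        by (intro Bochner_Integration.integral_sum[symmetric] b_int)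
      then have "(\<Sum>i\<in>?I. \<integral>\<omega>. (b i (?D \<omega>))\<^sup>2 \<partial>M) / n = (\<integral>\<omega>. (\<Sum>i\<in>?I. (b i (?D \<omega>))\<^sup>2) / n \<partial>M)"
        by simp
      also have "\<dots> \<le> (\<integral>\<omega>. (\<Sum>i\<in>?I. (w i \<omega>)\<^sup>2) / n + c \<partial>M)"
        using b_sum_int w_sum_int bias by (intro integral_mono) auto
      also have "\<dots> = (\<Sum>i\<in>?I. \<integral>\<omega>. (w i \<omega>)\<^sup>2 \<partial>M) / n + c"
        using w_sum_int by (simp add: sample.prob_space w_sum)
      finally show "(\<Sum>i\<in>?I. \<integral>\<omega>. (b i (?D \<omega>))\<^sup>2 \<partial>M) / n \<le> (\<Sum>i\<in>?I. \<integral>\<omega>. (w i \<omega>)\<^sup>2 \<partial>M) / n + c" .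
    qed auto
    finally show ?thesis unfolding penalized_risk .
  qed
  let ?R = "risk M n X (\<lambda>\<omega> x. x \<bullet> alpha_hat \<omega> + g_hat \<omega> x - fstar x)"
  let ?C = "ennreal (\<sigma>\<^sup>2) * (ennreal (1 / n) * B)"
  let ?F = "\<lambda>(\<alpha>, f). risk M n X (\<lambda>_ x. x \<bullet> \<alpha> + f x - fstar x)
    + ennreal (mu * (norm \<alpha>)\<^sup>2) + ennreal (lam * (rkhs_norm ip f)\<^sup>2)"
  \<comment> \<open>subtracting the variance term reduces the claim to a lower bound of an infimum; this needs it finite\<close>
  show ?thesis
  proof (cases "?C = \<infinity>")
    case True
    then show ?thesis unfolding B by simp
  next
    case False
    have "?R - ?C \<le> ?F p" if "p \<in> UNIV \<times> H" for p
    proof -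
      have "?R \<le> ?F p + ?C" using risk_le that by (cases p) auto
      then show ?thesis using False by (simp add: ennreal_minus_le_iff add.commute[of ?C])
    qed
    then have "?R - ?C \<le> (INF p\<in>UNIV \<times> H. ?F p)" by (rule INF_greatest)
    then have "?R \<le> (INF p\<in>UNIV \<times> H. ?F p) + ?C"
      by (simp add: ennreal_minus_le_iff add.commute[of ?C])
    then show ?thesis unfolding B .
  qed
qed

end
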